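(* Let $k\ge 3$ be an integer and $m=2k-1$. Then \[ \frac{1}{2\left((k-1)^{4k-5}(2k-1)+\frac{(k-1)^{4k-5}-1}{k-2}\right)} \le \delta_{\mathrm{hom}}(\mathcal{C}_{m};\{C_{m}\}) \le \frac{2(m-1)}{2m(m-1)+1} < \frac{1}{m} = \delta_{\mathrm{hom}}(\mathcal{C}_{m};\mathcal{C}_{m}). \]
   Context: Graphs are finite, simple and loopless. $\delta(G)$ is the minimum degree of $G$ and $C_\ell$ is the cycle of length $\ell$. For a family $\mathcal{F}$ of graphs, a graph is $\mathcal{F}$-free if it contains no (not necessarily induced) subgraph isomorphic to a member of $\mathcal{F}$. For odd $m\ge 3$, $\mathcal{C}_m=\{C_3,C_5,\ldots,C_m\}$ is the family of all odd cycles of length at most $m$. For families $\mathcal{F}_1,\mathcal{F}_2$ of graphs, $\delta_{\mathrm{hom}}(\mathcal{F}_1;\mathcal{F}_2)$ is the infimum of all $\alpha$ such that for every $\varepsilon>0$ there is a constant $b$ with the following property: every sufficiently large $\mathcal{F}_1$-free graph $G$ with $\delta(G)\ge(\alpha+\varepsilon)|V(G)|$ admits a homomorphism to some $\mathcal{F}_2$-free graph on at most $b$ vertices. *)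

theory Defs
  imports Complex_Main "HOL-Library.Extended_Real" "Graph_Theory.Graph_Theory"
begin

text \<open>
  A finite simple loopless graph is a \<^locale>\<open>pair_graph\<close>: a finite vertex set with a symmetric,
  irreflexive set of ordered pairs, each edge being represented by its two orientations.
  Vertices are natural numbers; up to isomorphism this covers all finite graphs.
\<close>

definition cycle_graph :: "nat \<Rightarrow> nat pair_pre_digraph" where
  "cycle_graph l = \<lparr> pverts = {..<l},
     parcs = {(i, j). i < l \<and> j < l \<and> (j = (i + 1) mod l \<or> i = (j + 1) mod l)} \<rparr>"

lemma pair_graph_cycle_graph:
  assumes "l \<ge> 2"
  shows "pair_graph (cycle_graph l)"
proof
  show "finite (parcs (cycle_graph l))"
    by (rule finite_subset[of _ "{..<l} \<times> {..<l}"]) (auto simp: cycle_graph_def)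
  show "symmetric (with_proj (cycle_graph l))"
    by (auto simp: symmetric_conv cycle_graph_def)
  show "fst e \<noteq> snd e" if "e \<in> parcs (cycle_graph l)" for e
    using that assms by (auto simp: cycle_graph_def mod_Suc split: if_splits)
qed (auto simp: cycle_graph_def)

definition odd_cycles :: "nat \<Rightarrow> nat pair_pre_digraph set" where
  "odd_cycles m = {cycle_graph l | l. odd l \<and> 3 \<le> l \<and> l \<le> m}"

definition family_free :: "nat pair_pre_digraph set \<Rightarrow> nat pair_pre_digraph \<Rightarrow> bool" where
  "family_free \<F> G \<longleftrightarrow>
     \<not> (\<exists>F\<in>\<F>. \<exists>H :: nat pair_pre_digraph.
          subgraph (with_proj H) (with_proj G) \<and> digraph_iso (with_proj F) (with_proj H))"

text \<open>
  By symmetry the out-degree of a vertex is its degree in the undirected graph. The value for the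
  graph without vertices is unspecified; it is irrelevant below, where only sufficiently large
  graphs are considered.
\<close>

definition min_degree :: "nat pair_pre_digraph \<Rightarrow> nat" where
  "min_degree G = Min (out_degree (with_proj G) ` pverts G)"

definition graph_hom ::
  "(nat \<Rightarrow> nat) \<Rightarrow> nat pair_pre_digraph \<Rightarrow> nat pair_pre_digraph \<Rightarrow> bool" where
  "graph_hom f G H \<longleftrightarrow>
     (\<forall>v\<in>pverts G. f v \<in> pverts H) \<and> (\<forall>(u, v)\<in>parcs G. (f u, f v) \<in> parcs H)"

text \<open>
  The infimum over all real \<open>\<alpha>\<close> is taken in the extended reals, so that it is the genuine infimum
  even when the set of admissible \<open>\<alpha>\<close> is not bounded below.
\<close>

definition delta_hom :: "nat pair_pre_digraph set \<Rightarrow> nat pair_pre_digraph set \<Rightarrow> ereal" where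
  "delta_hom \<F>1 \<F>2 = Inf (ereal ` {\<alpha> :: real. \<forall>\<epsilon>>0. \<exists>b :: nat. \<exists>n0 :: nat. \<forall>G.
     pair_graph G \<and> card (pverts G) \<ge> n0 \<and> family_free \<F>1 G \<and>
     real (min_degree G) \<ge> (\<alpha> + \<epsilon>) * real (card (pverts G)) \<longrightarrow>
     (\<exists>H f. pair_graph H \<and> card (pverts H) \<le> b \<and> family_free \<F>2 H \<and> graph_hom f G H)})"

end

theory Submission
  imports Defs "HOL-Library.Z2" "HOL-Library.Multiset" "HOL-Library.FuncSet" "HOL-Library.Nat_Bijection"
begin

text \<open>
  Write \<open>n\<close> for the number of vertices and \<open>d\<close> for the minimum degree. All four estimates are
  elementary; being free of \<open>C\<^sub>3, C\<^sub>5, \<dots>, C\<^sub>m\<close> is used throughout in the form that there is no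
  closed walk of odd length at most \<open>m\<close> (\<open>family_free_odd_cycles_iff\<close>).

  \<^bold>\<open>Upper bound for the target \<open>C\<^sub>m\<close>.\<close> The homomorphic image is simply the complete graph on
  \<open>m - 1\<close> vertices. Take a maximal set \<open>U\<close> of vertices with pairwise disjoint neighbourhoods; then
  \<open>|U| \<le> m\<close>, and every vertex can be coloured by a member of \<open>U\<close> whose neighbourhood meets its own,
  since two adjacent vertices with the same colour would lie on a closed 5-walk. If \<open>|U| = m\<close>, two
  of the colours can be merged: otherwise almost all vertices are distributed among \<open>m\<close> blocks and the
  relation of one block being the neighbourhood of another is an involution without fixed points on
  the odd number \<open>m\<close> of blocks (\<open>no_mutually_adjacent_classes\<close>).

  \<^bold>\<open>Upper bound for the target family.\<close> Classify the vertices by the members of a bounded, almost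
  dominating set \<open>W\<close> at distance two, and refine this classification boundedly often by the
  classes of the neighbours. A closed walk of odd length \<open>l \<le> m\<close> in the quotient lifts to a long
  walk \<open>u\<^sub>0, u\<^sub>1, \<dots>\<close> in the graph whose classes are periodic with period \<open>l\<close>, and two vertices of the
  same class are joined by walks of length 4 through almost every neighbour of the one. Hence many
  pairs of the neighbourhoods of the \<open>u\<^sub>i\<close> are almost disjoint, which is impossible if
  \<open>d \<ge> (1/m + \<epsilon>) n\<close> (\<open>no_periodic_walk\<close>).

  \<^bold>\<open>Lower bounds.\<close> Both come from one construction (\<open>lift_lower_bound\<close>). Given a finite graph on
  \<open>T \<union> J\<close> whose closed walks of odd length at most \<open>m\<close> all have length \<open>m\<close> and stay in \<open>T\<close>, replace
  the vertices of \<open>J\<close> by large independent sets, which provide the minimum degree, and those of \<open>T\<close>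
  by a fixed number of copies labelled by functions on the edges inside \<open>T\<close>; crossing an edge changes
  exactly the coordinate belonging to that edge. An \<open>m\<close>-cycle in \<open>T\<close> changes each of its coordinates
  once, so it does not lift to a closed walk; but a pigeonhole argument shows that every bounded
  homomorphic image contains an image of \<open>T\<close>. With \<open>T = C\<^sub>m\<close> and \<open>|J| = m\<close> this gives \<open>1/m\<close>. For the
  target \<open>C\<^sub>m\<close> one needs a finite graph \<open>T\<close> without odd cycles shorter than \<open>m\<close> all of whose images
  contain \<open>C\<^sub>m\<close>. The \<open>4k - 4\<close> times iterated generalised Mycielski graph over \<open>K\<^sub>2\<close> with \<open>k - 1\<close> levels
  has this property: its chromatic number is at least \<open>4k - 2\<close> (\<open>has_sphere_colours\<close>, a mod-2
  version of Ky Fan's lemma), all its vertices are within distance \<open>k - 1\<close> of the apex, and in a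
  graph without \<open>C\<^sub>m\<close> a ball of that radius can be coloured with \<open>4k - 6\<close> colours
  (\<open>ball_colouring\<close>).
\<close>

section \<open>Odd cycles and odd closed walks\<close>

definition no_odd_closed_walk :: "('a \<times> 'a) set \<Rightarrow> nat \<Rightarrow> bool" where
  "no_odd_closed_walk R m \<longleftrightarrow> (\<forall>l v. odd l \<and> l \<le> m \<longrightarrow> (v, v) \<notin> R ^^ l)"

lemma no_odd_closed_walkD:
  "no_odd_closed_walk R m \<Longrightarrow> (v, v) \<in> R ^^ l \<Longrightarrow> odd l \<Longrightarrow> l \<le> m \<Longrightarrow> False"
  unfolding no_odd_closed_walk_def by blast

lemma no_odd_closed_walk_mono: "no_odd_closed_walk R m \<Longrightarrow> l \<le> m \<Longrightarrow> no_odd_closed_walk R l"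
  unfolding no_odd_closed_walk_def by force

lemma relpow_append: "(x, y) \<in> R ^^ i \<Longrightarrow> (y, z) \<in> R ^^ j \<Longrightarrow> (x, z) \<in> R ^^ (i + j)"
  by (auto simp: relpow_add)

lemma relpow_rev:
  assumes "sym R" shows "(x, y) \<in> R ^^ l \<Longrightarrow> (y, x) \<in> R ^^ l"
proof (induction l arbitrary: y)
  case (Suc l)
  then obtain z where z: "(x, z) \<in> R ^^ l" "(z, y) \<in> R" by auto
  have "(y, z) \<in> R" using z assms by (meson symE)
  with Suc.IH[OF z(1)] show ?case by (meson relpow_Suc_I2)
qed auto

lemma relpow_of_fun:
  assumes "\<And>t. i \<le> t \<Longrightarrow> t < j \<Longrightarrow> (w t, w (Suc t)) \<in> R" "i \<le> j"
  shows "(w i, w j) \<in> R ^^ (j - i)"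
  using assms(2,1)
proof (induction j rule: dec_induct)
  case (step j)
  then have "(w i, w j) \<in> R ^^ (j - i)" "(w j, w (Suc j)) \<in> R" by auto
  then show ?case using step.hyps by (auto simp: Suc_diff_le)
qed auto

lemma relpow_hom:
  assumes "\<And>u v. (u, v) \<in> R \<Longrightarrow> (f u, f v) \<in> S"
  shows "(x, y) \<in> R ^^ l \<Longrightarrow> (f x, f y) \<in> S ^^ l"
  by (induction l arbitrary: y) (auto intro: relpow_Suc_I assms)

lemma relpow_walk:
  assumes "(x, y) \<in> R ^^ l" obtains w where "w 0 = x" "w l = y" "\<And>i. i < l \<Longrightarrow> (w i, w (Suc i)) \<in> R"
  using assms unfolding relpow_fun_conv by blast

text \<open>
  If a vertex is repeated, the closed walk splits into two shorter closed walks, one of which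
  has odd length.
\<close>

lemma shortest_odd_closed_walk_inj:
  assumes "no_odd_closed_walk R (l - 1)" "odd l"
    and w: "\<And>i. i < l \<Longrightarrow> (w i, w (Suc i)) \<in> R" "w l = w 0"
  shows "inj_on w {..<l}"
proof -
  have "False" if ij: "i < j" "j < l" "w i = w j" for i j
  proof -
    have a: "(w i, w j) \<in> R ^^ (j - i)" by (rule relpow_of_fun) (use w ij in auto)
    have b: "(w j, w l) \<in> R ^^ (l - j)" by (rule relpow_of_fun) (use w ij in auto)
    have c: "(w 0, w i) \<in> R ^^ (i - 0)" by (rule relpow_of_fun) (use w ij in auto)
    have d: "(w j, w j) \<in> R ^^ (l - j + i)" using relpow_append[OF b] c w(2) ij(3) by simp
    show False
    proof (cases "odd (j - i)")
      case True
      moreover have "(w i, w i) \<in> R ^^ (j - i)" using a ij(3) by metis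
      moreover have "j - i \<le> l - 1" using ij by linarith
      ultimately show ?thesis using no_odd_closed_walkD[OF assms(1)] by blast
    next
      case False
      then have "odd (l - j + i)" using \<open>odd l\<close> ij by presburger
      moreover have "l - j + i \<le> l - 1" using ij by linarith
      ultimately show ?thesis by (rule no_odd_closed_walkD[OF assms(1) d])
    qed
  qed
  then show ?thesis by (intro inj_onI) (metis lessThan_iff linorder_neqE_nat)
qed

lemma sym_parcs: "pair_graph G \<Longrightarrow> sym (parcs G)"
proof -
  assume "pair_graph G"
  then interpret pair_graph G .
  show ?thesis using pair_sym_arcs by (simp add: symmetric_def)
qed

lemma pair_graphI:
  assumes "finite V" "R \<subseteq> V \<times> V" "sym R" "irrefl R"
  shows "pair_graph \<lparr> pverts = V, parcs = R \<rparr>"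
proof
  show "finite (parcs \<lparr> pverts = V, parcs = R \<rparr>)" using assms(1,2) finite_subset[OF assms(2)] by simp
  show "symmetric (with_proj \<lparr> pverts = V, parcs = R \<rparr>)"
    using assms by (simp add: symmetric_def)
  show "fst e \<noteq> snd e" if "e \<in> parcs \<lparr> pverts = V, parcs = R \<rparr>" for e
    using that assms(4) by (cases e) (auto simp: irrefl_def)
qed (use assms(1,2) in \<open>auto\<close>)

text \<open>
  Isomorphic copies of a cycle in the sense of the graph library are translated into closed walks
  without repetitions, the form in which they are constructed and excluded below.
\<close>

lemma cycle_subgraph_iff:
  assumes G: "pair_graph G" and l: "l \<ge> 3"
  shows "(\<exists>H. subgraph (with_proj H) (with_proj G) \<and> digraph_iso (with_proj (cycle_graph l)) (with_proj H))
     \<longleftrightarrow> (\<exists>w. (\<forall>i<l. (w i, w (Suc i)) \<in> parcs G) \<and> w l = w 0 \<and> inj_on w {..<l})"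
    (is "?L \<longleftrightarrow> ?R")
proof
  assume ?L
  then obtain H f where H: "subgraph (with_proj H) (with_proj G)"
    and f: "pre_digraph.digraph_isomorphism (with_proj (cycle_graph l)) f"
    and Hf: "with_proj H = app_iso f (with_proj (cycle_graph l))"
    unfolding digraph_iso_def by blast
  let ?g = "iso_verts f"
  have inj: "inj_on ?g {..<l}"
    using f by (auto simp: pre_digraph.digraph_isomorphism_def cycle_graph_def)
  have arc: "(?g u, ?g v) \<in> parcs G" if "(u, v) \<in> parcs (cycle_graph l)" for u v
  proof -
    have 1: "iso_arcs f (u, v) \<in> parcs H"
      using that arg_cong[OF Hf, of arcs] by auto
    have "fst = iso_tail f" "snd = iso_head f"
      using arg_cong[OF Hf, of tail] arg_cong[OF Hf, of head] by auto
    then have "iso_arcs f (u, v) = (?g u, ?g v)"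
      using f that by (auto simp: pre_digraph.digraph_isomorphism_def prod_eq_iff)
    moreover have "parcs H \<subseteq> parcs G" using H by (auto simp: subgraph_def)
    ultimately show ?thesis using 1 by auto
  qed
  define w where "w i = ?g (i mod l)" for i
  have "(w i, w (Suc i)) \<in> parcs G" if "i < l" for i
    unfolding w_def by (rule arc) (use that l in \<open>auto simp: cycle_graph_def mod_Suc\<close>)
  moreover have "w l = w 0" by (simp add: w_def)
  moreover have "inj_on w {..<l}" using inj by (auto simp: w_def inj_on_def)
  ultimately show ?R by blast
next
  assume ?R
  then obtain w where w: "\<And>i. i < l \<Longrightarrow> (w i, w (Suc i)) \<in> parcs G" "w l = w 0" "inj_on w {..<l}" by blast
  let ?C = "cycle_graph l"
  interpret G: pair_graph G by fact
  interpret C: pair_graph ?C by (rule pair_graph_cycle_graph) (use l in simp)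
  define H where "H = \<lparr> pverts = w ` {..<l}, parcs = map_prod w w ` parcs ?C \<rparr>"
  have Cv: "pverts ?C = {..<l}" by (simp add: cycle_graph_def)
  have step: "(w i, w ((i + 1) mod l)) \<in> parcs G" if "i < l" for i
    using w(1)[OF that] w(2) that by (cases "Suc i = l") auto
  have sub: "parcs H \<subseteq> parcs G"
  proof
    fix e assume "e \<in> parcs H"
    then obtain i j where "e = (w i, w j)" "(i, j) \<in> parcs ?C" by (auto simp: H_def)
    then show "e \<in> parcs G" using step[of i] step[of j] symD[OF sym_parcs[OF G]]
      by (auto simp: cycle_graph_def)
  qed
  have vsub: "pverts H \<subseteq> pverts G"
    using w(1) G.in_arcsD1 by (fastforce simp: H_def)
  have Hg: "pair_graph \<lparr> pverts = w ` {..<l}, parcs = map_prod w w ` parcs ?C \<rparr>"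
  proof (rule pair_graphI)
    show "map_prod w w ` parcs ?C \<subseteq> w ` {..<l} \<times> w ` {..<l}" by (auto simp: cycle_graph_def)
    show "sym (map_prod w w ` parcs ?C)"
      using sym_parcs[OF C.pair_graph] by (fastforce simp: sym_def)
    show "irrefl (map_prod w w ` parcs ?C)"
      using sub G.pair_no_loops by (fastforce simp: H_def irrefl_def)
  qed simp
  interpret H: pair_graph H unfolding H_def by (rule Hg)
  have 1: "subgraph (with_proj H) (with_proj G)"
    unfolding subgraph_def compatible_def using sub vsub G.wf_digraph H.wf_digraph by auto
  define f where "f = \<lparr> iso_verts = w, iso_arcs = map_prod w w, iso_head = snd, iso_tail = fst \<rparr>"
  have "parcs ?C \<subseteq> {..<l} \<times> {..<l}" by (auto simp: cycle_graph_def)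
  then have "inj_on (map_prod w w) (parcs ?C)"
    using map_prod_inj_on[OF w(3) w(3)] inj_on_subset by blast
  then have 2: "pre_digraph.digraph_isomorphism (with_proj ?C) f"
    unfolding pre_digraph.digraph_isomorphism_def using w(3) C.wf_digraph
    by (auto simp: f_def Cv)
  have "with_proj H = app_iso f (with_proj ?C)"
    by (auto simp: app_iso_def with_proj_def f_def H_def Cv)
  with 1 2 show ?L unfolding digraph_iso_def by blast
qed

lemma family_free_odd_cycles_iff:
  assumes G: "pair_graph G"
  shows "family_free (odd_cycles m) G \<longleftrightarrow> no_odd_closed_walk (parcs G) m"
proof -
  interpret pair_graph G by fact
  have A: "False" if ff: "family_free (odd_cycles m) G" and l: "odd l" "l \<le> m" "(v, v) \<in> parcs G ^^ l" for l v
    using l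
  proof (induction l arbitrary: v rule: less_induct)
    case (less l)
    have no: "no_odd_closed_walk (parcs G) (l - 1)" unfolding no_odd_closed_walk_def
    proof (intro allI impI notI)
      fix l' u assume "odd l' \<and> l' \<le> l - 1" "(u, u) \<in> parcs G ^^ l'"
      moreover have "l \<noteq> 0" using less.prems(1) by (metis even_zero)
      ultimately have "l' < l" "odd l'" "l' \<le> m" using less.prems(2) by linarith+
      then show False using less.IH[of l' u] \<open>(u, u) \<in> parcs G ^^ l'\<close> by blast
    qed
    obtain w where w: "w 0 = v" "w l = v" "\<And>i. i < l \<Longrightarrow> (w i, w (Suc i)) \<in> parcs G"
      using relpow_walk[OF less.prems(3)] by metis
    have "l \<noteq> 1" using w(1,2) w(3)[of 0] pair_no_loops[of "(v, v)"] by auto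
    then have l3: "l \<ge> 3" using less.prems(1) by presburger
    have "inj_on w {..<l}"
      by (rule shortest_odd_closed_walk_inj[OF no less.prems(1)]) (simp_all add: w(1,2) w(3))
    then have "\<exists>H. subgraph (with_proj H) (with_proj G) \<and> digraph_iso (with_proj (cycle_graph l)) (with_proj H)"
      unfolding cycle_subgraph_iff[OF G l3] using w by (intro exI[of _ w]) simp
    moreover have "cycle_graph l \<in> odd_cycles m" using l3 less.prems(1,2) by (auto simp: odd_cycles_def)
    ultimately show False using ff unfolding family_free_def by blast
  qed
  moreover have False if no: "no_odd_closed_walk (parcs G) m" and nf: "\<not> family_free (odd_cycles m) G"
  proof -
    obtain l where l: "odd l" "3 \<le> l" "l \<le> m" and
      "\<exists>H. subgraph (with_proj H) (with_proj G) \<and> digraph_iso (with_proj (cycle_graph l)) (with_proj H)"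
      using nf unfolding family_free_def odd_cycles_def by blast
    then obtain w where w: "\<forall>i<l. (w i, w (Suc i)) \<in> parcs G" "w l = w 0"
      unfolding cycle_subgraph_iff[OF G l(2)] by blast
    have "(w 0, w l) \<in> parcs G ^^ (l - 0)" by (rule relpow_of_fun) (use w(1) in auto)
    then have "(w 0, w 0) \<in> parcs G ^^ l" using w(2) by simp
    then show False by (rule no_odd_closed_walkD[OF no _ l(1,3)])
  qed
  ultimately show ?thesis unfolding no_odd_closed_walk_def by (metis (no_types, lifting))
qed

lemma family_free_cycle_iff:
  assumes "pair_graph G" "m \<ge> 3"
  shows "family_free {cycle_graph m} G \<longleftrightarrow>
    \<not> (\<exists>w. (\<forall>i<m. (w i, w (Suc i)) \<in> parcs G) \<and> w m = w 0 \<and> inj_on w {..<m})"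
  unfolding cycle_subgraph_iff[OF assms, symmetric] family_free_def by blast

lemma out_degree_eq_nbrs: "out_degree (with_proj G) v = card (parcs G `` {v})"
proof -
  have "out_arcs (with_proj G) v = Pair v ` (parcs G `` {v})" by (auto simp: out_arcs_def)
  then show ?thesis by (simp add: out_degree_def card_image inj_on_def)
qed

lemma min_degree_le:
  assumes "pair_graph G" "v \<in> pverts G"
  shows "min_degree G \<le> card (parcs G `` {v})"
proof -
  interpret pair_graph G by fact
  show ?thesis unfolding min_degree_def out_degree_eq_nbrs[symmetric]
    using assms pair_finite_verts by (intro Min_le) auto
qed

lemma min_degree_ge:
  assumes "pair_graph G" "pverts G \<noteq> {}" "\<And>v. v \<in> pverts G \<Longrightarrow> d \<le> card (parcs G `` {v})"
  shows "d \<le> min_degree G"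
proof -
  interpret pair_graph G by fact
  show ?thesis unfolding min_degree_def
    using assms pair_finite_verts by (subst Min_ge_iff) (auto simp: out_degree_eq_nbrs)
qed

lemma delta_hom_leI:
  assumes "\<And>\<epsilon>. \<epsilon> > 0 \<Longrightarrow> \<exists>b::nat. \<forall>G. pair_graph G \<and> pverts G \<noteq> {} \<and> family_free \<F>1 G \<and>
     real (min_degree G) \<ge> (\<alpha> + \<epsilon>) * real (card (pverts G)) \<longrightarrow>
     (\<exists>H f. pair_graph H \<and> card (pverts H) \<le> b \<and> family_free \<F>2 H \<and> graph_hom f G H)"
  shows "delta_hom \<F>1 \<F>2 \<le> ereal \<alpha>"
proof -
  have "\<exists>b n0 :: nat. \<forall>G. pair_graph G \<and> card (pverts G) \<ge> n0 \<and> family_free \<F>1 G \<and>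
     real (min_degree G) \<ge> (\<alpha> + \<epsilon>) * real (card (pverts G)) \<longrightarrow>
     (\<exists>H f. pair_graph H \<and> card (pverts H) \<le> b \<and> family_free \<F>2 H \<and> graph_hom f G H)"
    if eps: "\<epsilon> > 0" for \<epsilon>
  proof -
    obtain b where "\<forall>G. pair_graph G \<and> pverts G \<noteq> {} \<and> family_free \<F>1 G \<and>
     real (min_degree G) \<ge> (\<alpha> + \<epsilon>) * real (card (pverts G)) \<longrightarrow>
     (\<exists>H f. pair_graph H \<and> card (pverts H) \<le> b \<and> family_free \<F>2 H \<and> graph_hom f G H)"
      using assms[OF eps] by blast
    then show ?thesis by (intro exI[of _ b] exI[of _ 1]) force
  qed
  then show ?thesis unfolding delta_hom_def by (intro Inf_lower imageI) blast
qed

lemma delta_hom_geI: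
  assumes "\<And>\<alpha>. \<lbrakk>\<alpha> < c; \<forall>\<epsilon>>0. \<exists>b n0 :: nat. \<forall>G. pair_graph G \<and> card (pverts G) \<ge> n0 \<and> family_free \<F>1 G \<and>
     real (min_degree G) \<ge> (\<alpha> + \<epsilon>) * real (card (pverts G)) \<longrightarrow>
     (\<exists>H f. pair_graph H \<and> card (pverts H) \<le> b \<and> family_free \<F>2 H \<and> graph_hom f G H)\<rbrakk> \<Longrightarrow> False"
  shows "ereal c \<le> delta_hom \<F>1 \<F>2"
  unfolding delta_hom_def
proof (rule Inf_greatest, clarsimp, goal_cases)
  case (1 \<alpha>)
  show ?case using assms[of \<alpha>] 1 by (meson linorder_not_le)
qed

section \<open>Colouring dense graphs without short odd cycles\<close>

text \<open>
  The involution matches the elements below their image with those above.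
\<close>

lemma even_card_involution:
  fixes U :: "nat set"
  assumes "finite U" "\<And>i. i \<in> U \<Longrightarrow> f i \<in> U" "\<And>i. i \<in> U \<Longrightarrow> f (f i) = i" "\<And>i. i \<in> U \<Longrightarrow> f i \<noteq> i"
  shows "even (card U)"
proof -
  let ?A = "{i \<in> U. i < f i}" and ?B = "{i \<in> U. f i < i}"
  have "bij_betw f ?A ?B"
    by (rule bij_betwI[where g = f]) (auto simp: assms(2,3))
  then have eq: "card ?A = card ?B" by (rule bij_betw_same_card)
  have U: "U = ?A \<union> ?B" using assms(4) by (auto simp: neq_iff)
  have "card (?A \<union> ?B) = card ?A + card ?B"
    by (rule card_Un_disjoint) (use assms(1) in auto)
  then have "card U = card ?B + card ?B" unfolding U[symmetric] eq .
  then show ?thesis by simp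
qed

lemma no_closed_walk_3:
  assumes "no_odd_closed_walk R 5" "(a, b) \<in> R" "(b, c) \<in> R" "(c, a) \<in> R" shows False
proof -
  have "(a, a) \<in> R ^^ 3" using assms(2-) by (auto simp: numeral_3_eq_3)
  then show False by (rule no_odd_closed_walkD[OF assms(1)]) simp_all
qed

lemma no_closed_walk_5:
  assumes "no_odd_closed_walk R 5" "(a, b) \<in> R" "(b, c) \<in> R" "(c, d) \<in> R" "(d, e) \<in> R" "(e, a) \<in> R"
  shows False
proof -
  have "(a, a) \<in> R ^^ 5" using assms(2-) by (auto simp: eval_nat_numeral)
  then show False by (rule no_odd_closed_walkD[OF assms(1)]) simp_all
qed

text \<open>
  The members of \<open>U\<close> have pairwise disjoint neighbourhoods, and \<open>v i j\<close>, \<open>v j i\<close> is an edge joining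
  vertices whose neighbourhoods meet only that of \<open>i\<close> and only that of \<open>j\<close>, respectively. This is
  impossible: the degree condition leaves only \<open>K\<close> vertices outside the \<open>p + 1\<close> neighbourhoods, where
  \<open>K\<close> is less than \<open>d / (2 p)\<close>. So \<open>N (v i j)\<close> is nearly the whole of \<open>N i\<close>, and so is the
  set \<open>S i\<close> of the common neighbours of all \<open>v i j\<close>. The edges \<open>v i j\<close>, \<open>v j i\<close> force the sets
  \<open>Q i\<close> of neighbours of \<open>S i\<close> to be disjoint, and all neighbours of \<open>Q i\<close> to lie in the set \<open>W i\<close>,
  which hardly exceeds \<open>S i\<close>. Therefore each \<open>W i\<close> contains a large part of only one \<open>Q j\<close>, and this
  assignment is an involution of \<open>U\<close> without fixed points, although \<open>U\<close> has odd size.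
\<close>

lemma no_mutually_adjacent_classes:
  fixes V U :: "nat set" and R :: "(nat \<times> nat) set"
  defines "N \<equiv> \<lambda>x. R `` {x}"
  assumes V: "finite V" "R \<subseteq> V \<times> V" "sym R" and no5: "no_odd_closed_walk R 5"
    and deg: "\<And>x. x \<in> V \<Longrightarrow> d \<le> card (N x)"
    and d: "2 * p * card V < (2 * (p + 1) * p + 1) * d"
    and U: "U \<subseteq> V" "card U = p + 1" "\<And>i j. i \<in> U \<Longrightarrow> j \<in> U \<Longrightarrow> i \<noteq> j \<Longrightarrow> N i \<inter> N j = {}"
    and p: "even p" "p \<ge> 2"
    and v: "\<And>i j. i \<in> U \<Longrightarrow> j \<in> U \<Longrightarrow> i \<noteq> j \<Longrightarrow> (v i j, v j i) \<in> R"
      "\<And>i j l. i \<in> U \<Longrightarrow> j \<in> U \<Longrightarrow> i \<noteq> j \<Longrightarrow> l \<in> U \<Longrightarrow> l \<noteq> i \<Longrightarrow> N (v i j) \<inter> N l = {}"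
  shows False
proof -
  have NV: "N x \<subseteq> V" for x using V(2) by (auto simp: N_def)
  have finN: "finite (N x)" for x using NV V(1) finite_subset by blast
  have finU: "finite U" using U(1) V(1) finite_subset by blast
  have symR: "(x, y) \<in> R \<Longrightarrow> (y, x) \<in> R" for x y using V(3) by (meson symE)
  let ?n = "card V"
  have cardI: "card (U - {i}) = p" if "i \<in> U" for i using that U(2) finU by simp
  have UN_ge: "card I * d \<le> card (\<Union>j\<in>I. N j)" if "I \<subseteq> U" for I
  proof -
    have "card (\<Union>j\<in>I. N j) = (\<Sum>j\<in>I. card (N j))"
      by (rule card_UN_disjoint) (use that finU finN U(3) finite_subset[of I U] in \<open>blast+\<close>)
    also have "\<dots> \<ge> (\<Sum>j\<in>I. d)" using deg that U(1) by (intro sum_mono) auto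
    finally show ?thesis by simp
  qed
  have "card (\<Union>j\<in>U. N j) \<le> ?n" using NV V(1) by (intro card_mono) auto
  then have nge: "(p + 1) * d \<le> ?n" using UN_ge[of U] U(2) by simp
  define K where "K = ?n - (p + 1) * d"
  have n_eq: "?n = d + p * d + K" using nge by (simp add: K_def)
  \<comment> \<open>This is the degree hypothesis rewritten; every comparison of sizes below rests on it.\<close>
  have Kd: "2 * (p * K) < d"
    using d unfolding n_eq by (simp add: algebra_simps)
  have K_le: "K \<le> p * K" using p(2) by simp
  define Z where "Z i = V - (\<Union>j\<in>U - {i}. N j)" for i
  have finZ: "finite (Z i)" for i using V(1) by (simp add: Z_def)
  have cardZ: "card (Z i) \<le> d + K" if "i \<in> U" for i
  proof -
    have "card (Z i) = ?n - card (\<Union>j\<in>U - {i}. N j)"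
      unfolding Z_def using NV finU finN by (intro card_Diff_subset) auto
    then show ?thesis using UN_ge[of "U - {i}"] cardI[OF that] n_eq by auto
  qed
  have NZ: "N (v i j) \<subseteq> Z i" if "i \<in> U" "j \<in> U" "i \<noteq> j" for i j
    using v(2)[OF that] NV by (auto simp: Z_def)
  have vV: "v i j \<in> V" if "i \<in> U" "j \<in> U" "i \<noteq> j" for i j using v(1)[OF that] V(2) by auto
  have ZN: "card (Z i - N (v i j)) \<le> card (Z i) - d" if "i \<in> U" "j \<in> U" "i \<noteq> j" for i j
    using card_Diff_subset[OF finN NZ[OF that]] deg[OF vV[OF that]] by simp
  have dZ: "d \<le> card (Z i)" if i: "i \<in> U" for i
  proof -
    have "U - {i} \<noteq> {}" using cardI[OF i] p(2) by (metis card.empty not_numeral_le_zero)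
    then obtain j where "j \<in> U" "i \<noteq> j" by auto
    then show ?thesis using card_mono[OF finZ NZ[OF i]] deg[OF vV[OF i]] by fastforce
  qed
  define S where "S i = (\<Inter>j\<in>U - {i}. N (v i j)) \<inter> Z i" for i
  have cardS: "d \<le> card (S i) + (p - 1) * K" if i: "i \<in> U" for i
  proof -
    obtain e where e: "card (Z i) = d + e" using dZ[OF i] le_Suc_ex by blast
    have "Z i - S i \<subseteq> (\<Union>j\<in>U - {i}. Z i - N (v i j))" by (auto simp: S_def)
    then have "card (Z i - S i) \<le> card (\<Union>j\<in>U - {i}. Z i - N (v i j))"
      using finU finZ by (intro card_mono) auto
    also have "\<dots> \<le> (\<Sum>j\<in>U - {i}. card (Z i - N (v i j)))" using finU by (intro card_UN_le) auto
    also have "\<dots> \<le> (\<Sum>j\<in>U - {i}. e)" using ZN[OF i] e by (intro sum_mono) fastforce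
    finally have 1: "card (Z i - S i) \<le> p * e" using cardI[OF i] by simp
    have "card (Z i) = card (Z i - S i) + card (S i)"
      using card_Diff_subset[of "S i" "Z i"] finZ[of i] card_mono[of "Z i" "S i"]
      by (auto simp: S_def)
    then have 2: "d + e \<le> p * e + card (S i)" using 1 e by simp
    obtain q where q: "p = Suc q" using p(2) by (cases p) auto
    have "q * e \<le> q * K" using cardZ[OF i] e by simp
    then have "d \<le> card (S i) + q * K" using 2 unfolding q mult_Suc by linarith
    then show ?thesis by (simp add: q)
  qed
  have pK: "(p - 1) * K + K = p * K" using p(2) by (cases p) auto
  have SK: "K < card (S i)" if "i \<in> U" for i using cardS[OF that] pK Kd by linarith
  have Sne: "S i \<noteq> {}" if "i \<in> U" for i using SK[OF that] by auto
  have SN: "x \<in> N (v i j)" if "x \<in> S i" "j \<in> U" "i \<noteq> j" for x i j using that by (auto simp: S_def)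
  define Q where "Q i = R `` S i" for i
  have QV: "Q i \<subseteq> V" for i using V(2) by (auto simp: Q_def)
  have finQ: "finite (Q i)" for i using QV V(1) finite_subset by blast
  have dQ: "d \<le> card (Q i)" if i: "i \<in> U" for i
  proof -
    obtain s where s: "s \<in> S i" using Sne[OF i] by blast
    then have "N s \<subseteq> Q i" "s \<in> V" by (auto simp: N_def Q_def S_def Z_def)
    then show ?thesis using deg[of s] card_mono[OF finQ] order_trans by blast
  qed
  have Qdisj: "Q i \<inter> Q j = {}" if ij: "i \<in> U" "j \<in> U" "i \<noteq> j" for i j
  proof -
    have False if "s \<in> S i" "(s, y) \<in> R" "t \<in> S j" "(t, y) \<in> R" for s t y
      using no_closed_walk_5[OF no5, of s "v i j" "v j i" t y]
        SN[OF that(1) ij(2,3)] SN[OF that(3) ij(1)] v(1)[OF ij] ij that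
      by (auto simp: N_def dest: symR)
    then show ?thesis by (auto simp: Q_def)
  qed
  have other: "\<exists>j\<in>U. j \<noteq> i" if "i \<in> U" for i
    using cardI[OF that] p(2) by (metis Diff_iff card.empty ex_in_conv insertCI not_numeral_le_zero)
  have QS: "Q i \<inter> S i = {}" if i: "i \<in> U" for i
  proof -
    obtain j where j: "j \<in> U" "j \<noteq> i" using other[OF i] by blast
    have False if "s \<in> S i" "(s, y) \<in> R" "y \<in> S i" for s y
      using no_closed_walk_3[OF no5, of s y "v i j"] SN[OF that(1) j(1)] SN[OF that(3) j(1)] j that
      by (auto simp: N_def dest: symR)
    then show ?thesis by (auto simp: Q_def)
  qed
  define W where "W i = V - (\<Union>j\<in>U - {i}. N (v j i))" for i
  have finW: "finite (W i)" for i using V(1) by (simp add: W_def)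
  have SW: "S i \<subseteq> W i" if i: "i \<in> U" for i
  proof
    fix x assume x: "x \<in> S i"
    have "x \<notin> N (v j i)" if j: "j \<in> U" "j \<noteq> i" for j
      using no_closed_walk_3[OF no5, of x "v i j" "v j i"] SN[OF x j(1)] v(1)[OF i j(1)] j
      by (auto simp: N_def dest: symR)
    then show "x \<in> W i" using x by (auto simp: W_def S_def Z_def)
  qed
  have cardW: "card (W i) \<le> d + K + p * K" if i: "i \<in> U" for i
  proof -
    have "x \<in> N i \<union> (\<Union>j\<in>U - {i}. Z j - N (v j i))" if x: "x \<in> W i" for x
    proof (cases "\<exists>j\<in>U. x \<in> N j")
      case True
      then obtain j where j: "j \<in> U" "x \<in> N j" by blast
      then have "x \<in> Z j" using U(3)[of j] NV[of j] by (auto simp: Z_def)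
      then show ?thesis using j x by (cases "j = i") (auto simp: W_def)
    next
      case False
      obtain j where j: "j \<in> U" "j \<noteq> i" using other[OF i] by blast
      then show ?thesis using False x by (auto simp: W_def Z_def)
    qed
    then have "card (W i) \<le> card (N i \<union> (\<Union>j\<in>U - {i}. Z j - N (v j i)))"
      using finU finN finZ by (intro card_mono) auto
    also have "\<dots> \<le> card (N i) + card (\<Union>j\<in>U - {i}. Z j - N (v j i))" by (rule card_Un_le)
    also have "card (\<Union>j\<in>U - {i}. Z j - N (v j i)) \<le> (\<Sum>j\<in>U - {i}. card (Z j - N (v j i)))"
      using finU by (intro card_UN_le) auto
    also have "\<dots> \<le> (\<Sum>j\<in>U - {i}. K)"
    proof (rule sum_mono)
      fix j assume j: "j \<in> U - {i}"
      then have "card (Z j - N (v j i)) \<le> card (Z j) - d" using ZN[of j i] i by auto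
      then show "card (Z j - N (v j i)) \<le> K" using cardZ[of j] j by auto
    qed
    also have "(\<Sum>j\<in>U - {i}. K) = p * K" using cardI[OF i] by simp
    also have "card (N i) \<le> card (Z i)"
      using U(3)[of i] NV[of i] i by (intro card_mono finZ) (auto simp: Z_def)
    finally show ?thesis using cardZ[OF i] by simp
  qed
  \<comment> \<open>\<open>rel i j\<close> says that \<open>Q j\<close> is essentially the block \<open>S i\<close>.\<close>
  define rel where "rel i j \<longleftrightarrow> i \<in> U \<and> j \<in> U \<and> d \<le> card (Q j \<inter> W i)" for i j
  have relI: "rel i j" if ij: "i \<in> U" "j \<in> U" "Q i \<inter> S j \<noteq> {}" for i j
  proof -
    obtain y s where y: "y \<in> S j" and s: "s \<in> S i" "(s, y) \<in> R" using ij(3) by (auto simp: Q_def)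
    have "x \<in> W i" if x: "x \<in> N y" for x
    proof -
      have "x \<notin> N (v l i)" if l: "l \<in> U" "l \<noteq> i" for l
        using no_closed_walk_5[OF no5, of s y x "v l i" "v i l"] SN[OF s(1) l(1)] v(1)[OF ij(1) l(1)] s l x
        by (auto simp: N_def dest: symR)
      then show ?thesis using x NV by (auto simp: W_def)
    qed
    then have "N y \<subseteq> Q j \<inter> W i" using y by (auto simp: Q_def N_def)
    then have "card (N y) \<le> card (Q j \<inter> W i)" using finQ by (intro card_mono) auto
    then show ?thesis using deg[of y] y ij by (auto simp: rel_def S_def Z_def)
  qed
  have relS: "Q j \<inter> S i \<noteq> {}" if r: "rel i j" for i j
  proof
    assume "Q j \<inter> S i = {}"
    then have "card (Q j \<inter> W i) \<le> card (W i - S i)" using finW by (intro card_mono) auto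
    also have "\<dots> = card (W i) - card (S i)"
      using SW finite_subset[OF SW finW] r by (intro card_Diff_subset) (auto simp: rel_def)
    finally have "d \<le> card (W i) - card (S i)" using r by (simp add: rel_def)
    then show False using cardW[of i] cardS[of i] r pK Kd unfolding rel_def by linarith
  qed
  have rel_fun: "j = l" if "rel i j" "rel i l" for i j l
  proof (rule ccontr)
    assume "j \<noteq> l"
    then have "card ((Q j \<inter> W i) \<union> (Q l \<inter> W i)) = card (Q j \<inter> W i) + card (Q l \<inter> W i)"
      using Qdisj[of j l] that finW by (intro card_Un_disjoint) (auto simp: rel_def)
    moreover have "card ((Q j \<inter> W i) \<union> (Q l \<inter> W i)) \<le> card (W i)"
      using finW by (intro card_mono) auto
    ultimately show False using that cardW[of i] Kd K_le unfolding rel_def by linarith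
  qed
  have total: "\<exists>i. rel j i" if j: "j \<in> U" for j
  proof -
    have "\<exists>i\<in>U. Q i \<inter> S j \<noteq> {}"
    proof (rule ccontr)
      assume "\<not> (\<exists>i\<in>U. Q i \<inter> S j \<noteq> {})"
      then have "card (S j) \<le> card (V - (\<Union>i\<in>U. Q i))"
        using V(1) by (intro card_mono) (auto simp: S_def Z_def)
      also have "\<dots> = ?n - card (\<Union>i\<in>U. Q i)"
        using QV finU finQ by (intro card_Diff_subset) auto
      also have "card (\<Union>i\<in>U. Q i) = (\<Sum>i\<in>U. card (Q i))"
        by (rule card_UN_disjoint) (use finU finQ Qdisj in \<open>blast+\<close>)
      finally have 1: "card (S j) \<le> ?n - (\<Sum>i\<in>U. card (Q i))" .
      have "(\<Sum>i\<in>U. d) \<le> (\<Sum>i\<in>U. card (Q i))" using dQ by (intro sum_mono) auto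
      then have "d + p * d \<le> (\<Sum>i\<in>U. card (Q i))" using U(2) by simp
      then show False using 1 SK[OF j] n_eq by linarith
    qed
    then obtain i where "i \<in> U" "Q i \<inter> S j \<noteq> {}" by blast
    then show ?thesis using relI[OF _ j] relS relI[OF j] by blast
  qed
  define f where "f j = (SOME i. rel j i)" for j
  have f: "rel j (f j)" if "j \<in> U" for j using someI_ex[OF total[OF that]] by (simp add: f_def)
  have "even (card U)"
  proof (rule even_card_involution[OF finU, of f])
    fix i assume i: "i \<in> U"
    show fU: "f i \<in> U" using f[OF i] by (simp add: rel_def)
    have "rel (f i) i" by (rule relI[OF fU i relS[OF f[OF i]]])
    then show "f (f i) = i" using rel_fun[OF f[OF fU]] by blast
    show "f i \<noteq> i" using relS[OF f[OF i]] QS[OF i] by auto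
  qed
  then show False using U(2) p(1) by simp
qed

text \<open>
  For a maximal set \<open>U\<close> of vertices with disjoint neighbourhoods, \<open>M x\<close> is the set of admissible
  colours of \<open>x\<close>; adjacent vertices have disjoint sets of colours because of closed 5-walks. When \<open>U\<close>
  has \<open>p + 1\<close> elements, some two colours \<open>i\<close>, \<open>j\<close> are such that no edge joins a vertex with only the
  colour \<open>i\<close> to one with only the colour \<open>j\<close>; then all vertices with no colour outside \<open>{i, j}\<close> form an
  independent set and can share one colour.
\<close>

lemma proper_colouring_of_dense:
  fixes V :: "nat set" and R :: "(nat \<times> nat) set"
  assumes V: "finite V" "R \<subseteq> V \<times> V" "sym R" and no5: "no_odd_closed_walk R 5"
    and deg: "\<And>x. x \<in> V \<Longrightarrow> d \<le> card (R `` {x})"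
    and d: "2 * p * card V < (2 * (p + 1) * p + 1) * d"
    and p: "even p" "p \<ge> 2"
  shows "\<exists>c :: nat \<Rightarrow> nat. (\<forall>x\<in>V. c x < p) \<and> (\<forall>(x, y)\<in>R. c x \<noteq> c y)"
proof -
  define N where "N x = R `` {x}" for x
  have NV: "N x \<subseteq> V" for x using V(2) by (auto simp: N_def)
  have finN: "finite (N x)" for x using NV V(1) finite_subset by blast
  have symR: "(x, y) \<in> R \<Longrightarrow> (y, x) \<in> R" for x y using V(3) by (meson symE)
  have d0: "d > 0" using d by (cases d) auto
  define F where "F = {U. U \<subseteq> V \<and> (\<forall>i\<in>U. \<forall>j\<in>U. i \<noteq> j \<longrightarrow> N i \<inter> N j = {})}"
  have finF: "finite F" using V(1) by (simp add: F_def)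
  have "F \<noteq> {}" by (auto simp: F_def)
  then obtain U where UF: "U \<in> F" and "\<forall>U'\<in>F. U \<subseteq> U' \<longrightarrow> U = U'"
    using finite_has_maximal[OF finF] by metis
  then have Umax: "U = U'" if "U' \<in> F" "U \<subseteq> U'" for U' using that by blast
  have U: "U \<subseteq> V" "\<And>i j. i \<in> U \<Longrightarrow> j \<in> U \<Longrightarrow> i \<noteq> j \<Longrightarrow> N i \<inter> N j = {}"
    using UF by (auto simp: F_def)
  have finU: "finite U" using U V(1) finite_subset by blast
  have "card U * d = (\<Sum>j\<in>U. d)" by simp
  also have "\<dots> \<le> (\<Sum>j\<in>U. card (N j))" using deg U by (intro sum_mono) (auto simp: N_def)
  also have "\<dots> = card (\<Union>j\<in>U. N j)"
    by (rule card_UN_disjoint[symmetric]) (use finU finN U in \<open>blast+\<close>)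
  also have "\<dots> \<le> card V" using NV V(1) by (intro card_mono) auto
  finally have Ud: "card U * d \<le> card V" .
  have U_le: "card U \<le> p + 1"
  proof (rule ccontr)
    assume "\<not> card U \<le> p + 1"
    then have "(p + 2) * d \<le> card V"
      using Ud mult_le_mono1[of "p + 2" "card U" d] by linarith
    then have "2 * p * ((p + 2) * d) \<le> 2 * p * card V" by (rule mult_le_mono2)
    then have "2 * p * ((p + 2) * d) < (2 * (p + 1) * p + 1) * d" using d by linarith
    then have "2 * p * (p + 2) < 2 * (p + 1) * p + 1" using d0 by (metis mult.assoc mult_less_cancel2)
    then show False using p(2) by (simp add: algebra_simps)
  qed
  define M where "M x = {u \<in> U. N u \<inter> N x \<noteq> {}}" for x
  have Mne: "M x \<noteq> {}" if x: "x \<in> V" for x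
  proof
    assume M: "M x = {}"
    have "N x \<noteq> {}" using deg[OF x] d0 by (auto simp: N_def)
    then have "x \<notin> U" using M by (auto simp: M_def)
    moreover have "insert x U \<in> F" using U M x by (auto simp: M_def F_def)
    ultimately show False using Umax by blast
  qed
  have Mindep: "M x \<inter> M y = {}" if "(x, y) \<in> R" for x y
  proof -
    have False if "u \<in> M x" "u \<in> M y" for u
      using that \<open>(x, y) \<in> R\<close> no_closed_walk_5[OF no5, of x _ u _ y]
      by (auto simp: M_def N_def dest: symR)
    then show ?thesis by blast
  qed
  have conclude: ?thesis if C: "finite C" "card C \<le> p" and
    col: "\<And>x. x \<in> V \<Longrightarrow> col x \<in> C" "\<And>x y. (x, y) \<in> R \<Longrightarrow> col x \<noteq> col y" for C and col :: "nat \<Rightarrow> nat"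
  proof -
    obtain h where h: "bij_betw h C {0..<card C}" using ex_bij_betw_finite_nat[OF C(1)] by blast
    have "h (col x) < p" if "x \<in> V" for x
      using bij_betwE[OF h] col(1)[OF that] C(2) by force
    moreover have "h (col x) \<noteq> h (col y)" if "(x, y) \<in> R" for x y
      using inj_onD[OF bij_betw_imp_inj_on[OF h]] col that V(2) by blast
    ultimately show ?thesis by (intro exI[of _ "h \<circ> col"]) auto
  qed
  show ?thesis
  proof (cases "card U \<le> p")
    case True
    have 1: "(SOME u. u \<in> M x) \<in> M x" if "x \<in> V" for x using Mne[OF that] some_in_eq by auto
    show ?thesis
    proof (rule conclude[OF finU True])
      fix x assume "x \<in> V" then show "(SOME u. u \<in> M x) \<in> U" using 1[of x] by (auto simp: M_def)
    next
      fix x y assume xy: "(x, y) \<in> R"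
      then have "x \<in> V" "y \<in> V" using V(2) by auto
      then show "(SOME u. u \<in> M x) \<noteq> (SOME u. u \<in> M y)" using 1[of x] 1[of y] Mindep[OF xy] by auto
    qed
  next
    case False
    then have cU: "card U = p + 1" using U_le by simp
    define A where "A i = {x \<in> V. M x = {i}}" for i
    have "\<exists>i\<in>U. \<exists>j\<in>U. i \<noteq> j \<and> R \<inter> A i \<times> A j = {}"
    proof (rule ccontr)
      assume no: "\<not> ?thesis"
      define e where "e i j = (SOME z. z \<in> R \<inter> A i \<times> A j)" for i j
      have e: "e i j \<in> R \<inter> A i \<times> A j" if "i \<in> U" "j \<in> U" "i \<noteq> j" for i j
        using no that some_in_eq unfolding e_def by metis
      define v where "v i j = (if i < j then fst (e i j) else snd (e j i))" for i j
      have vR: "(v i j, v j i) \<in> R" and vA: "v i j \<in> A i" if "i \<in> U" "j \<in> U" "i \<noteq> j" for i j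
        using e[of i j] e[of j i] that by (cases "i < j"; force simp: v_def dest: symR)+
      show False
      proof (rule no_mutually_adjacent_classes[OF V no5 _ d _ cU _ p, of v])
        show "R `` {v i j} \<inter> R `` {l} = {}" if "i \<in> U" "j \<in> U" "i \<noteq> j" "l \<in> U" "l \<noteq> i" for i j l
          using vA[OF that(1-3)] that(4,5) by (auto simp: A_def M_def N_def)
      qed (use deg U vR in \<open>auto simp: N_def\<close>)
    qed
    then obtain i j where ij: "i \<in> U" "j \<in> U" "i \<noteq> j" "R \<inter> A i \<times> A j = {}" by blast
    define D where "D x = M x - {i, j}" for x
    define col where "col x = (if D x \<noteq> {} then (SOME u. u \<in> D x) else i)" for x
    have c1: "col x \<in> D x" if "D x \<noteq> {}" for x using that some_in_eq by (auto simp: col_def)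
    show ?thesis
    proof (rule conclude[of "U - {j}"])
      show "card (U - {j}) \<le> p" using cU ij(2) finU by simp
      show "col x \<in> U - {j}" if "x \<in> V" for x
        using c1[of x] ij by (cases "D x = {}") (auto simp: D_def M_def col_def)
      show "col x \<noteq> col y" if xy: "(x, y) \<in> R" for x y
      proof (cases "D x = {} \<and> D y = {}")
        case True
        have xyV: "x \<in> V" "y \<in> V" using xy V(2) by auto
        have "M x \<subseteq> {i, j}" "M y \<subseteq> {i, j}" using True by (auto simp: D_def)
        then have "M x = {i} \<and> M y = {j} \<or> M x = {j} \<and> M y = {i}"
          using Mne[OF xyV(1)] Mne[OF xyV(2)] Mindep[OF xy] by blast
        then have "(x, y) \<in> A i \<times> A j \<or> (y, x) \<in> A i \<times> A j" using xyV by (auto simp: A_def)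
        then have False using ij(4) xy symR by blast
        then show ?thesis ..
      next
        case False
        show ?thesis
        proof (cases "D x = {} \<or> D y = {}")
          case True
          have "col z = i" if "D z = {}" for z using that by (simp add: col_def)
          moreover have "col z \<noteq> i" if "D z \<noteq> {}" for z using c1[OF that] by (auto simp: D_def)
          ultimately show ?thesis using False True by metis
        next
          case F: False
          then show ?thesis using c1[of x] c1[of y] Mindep[OF xy] by (auto simp: D_def)
        qed
      qed
    qed (use finU in auto)
  qed
qed

text \<open>
  The complete graph on \<open>m - 1\<close> vertices has too few vertices to contain \<open>C\<^sub>m\<close>.
\<close>

lemma single_cycle_upper_bound:
  assumes m: "odd m" "m \<ge> 5"
  shows "delta_hom (odd_cycles m) {cycle_graph m}
    \<le> ereal (2 * (real m - 1) / (2 * real m * (real m - 1) + 1))"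
proof (rule delta_hom_leI)
  fix \<epsilon> :: real assume \<epsilon>: "\<epsilon> > 0"
  define p where "p = m - 1"
  have p: "m = p + 1" "even p" "p \<ge> 2" using m by (auto simp: p_def)
  define \<beta> where "\<beta> = 2 * (real m - 1) / (2 * real m * (real m - 1) + 1)"
  have \<beta>: "\<beta> = real (2 * p) / real (2 * (p + 1) * p + 1)" by (simp add: \<beta>_def p(1) algebra_simps)
  show "\<exists>b::nat. \<forall>G. pair_graph G \<and> pverts G \<noteq> {} \<and> family_free (odd_cycles m) G \<and>
     real (min_degree G) \<ge> (2 * (real m - 1) / (2 * real m * (real m - 1) + 1) + \<epsilon>) * real (card (pverts G)) \<longrightarrow>
     (\<exists>H f. pair_graph H \<and> card (pverts H) \<le> b \<and> family_free {cycle_graph m} H \<and> graph_hom f G H)"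
    unfolding \<beta>_def[symmetric]
  proof (intro exI[of _ p] allI impI, elim conjE)
    fix G :: "nat pair_pre_digraph"
    assume G: "pair_graph G" and ne: "pverts G \<noteq> {}" and ff: "family_free (odd_cycles m) G"
      and md: "(\<beta> + \<epsilon>) * real (card (pverts G)) \<le> real (min_degree G)"
    interpret pair_graph G by fact
    let ?V = "pverts G" and ?R = "parcs G"
    have V: "finite ?V" "?R \<subseteq> ?V \<times> ?V" "sym ?R"
      using pair_finite_verts sym_parcs[OF G] by (auto dest: in_arcsD1 in_arcsD2)
    have "no_odd_closed_walk ?R m" using family_free_odd_cycles_iff[OF G] ff by blast
    then have no5: "no_odd_closed_walk ?R 5" using m(2) by (rule no_odd_closed_walk_mono)
    have "real (card ?V) > 0" using ne V(1) by (simp add: card_gt_0_iff)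
    then have "\<beta> * real (card ?V) < (\<beta> + \<epsilon>) * real (card ?V)" using \<epsilon> by (intro mult_strict_right_mono) auto
    then have "\<beta> * real (card ?V) < real (min_degree G)" using md by linarith
    then have "real (2 * p) * real (card ?V) < real (2 * (p + 1) * p + 1) * real (min_degree G)"
      unfolding \<beta> by (simp add: divide_less_eq mult.commute del: of_nat_add of_nat_mult of_nat_Suc)
    then have "real (2 * p * card ?V) < real ((2 * (p + 1) * p + 1) * min_degree G)" by (simp only: of_nat_mult)
    then have d: "2 * p * card ?V < (2 * (p + 1) * p + 1) * min_degree G" by (simp only: of_nat_less_iff)
    obtain c :: "nat \<Rightarrow> nat" where c: "\<forall>x\<in>?V. c x < p" "\<forall>(x, y)\<in>?R. c x \<noteq> c y"
      using proper_colouring_of_dense[OF V no5 min_degree_le[OF G] d p(2,3)] by blast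
    let ?K = "{(i, j). i < p \<and> j < p \<and> i \<noteq> j}"
    have H: "pair_graph \<lparr> pverts = {..<p}, parcs = ?K \<rparr>"
      by (rule pair_graphI) (auto simp: sym_def irrefl_def)
    have "family_free {cycle_graph m} \<lparr> pverts = {..<p}, parcs = ?K \<rparr>"
    proof -
      have "m \<ge> 3" using m by simp
      moreover have False if w: "\<forall>i<m. (w i, w (Suc i)) \<in> ?K" "inj_on w {..<m}" for w
      proof -
        have "w ` {..<m} \<subseteq> {..<p}" using w(1) by auto
        then have "card (w ` {..<m}) \<le> card {..<p}" by (intro card_mono) auto
        then show False using w(2) p(1) by (simp add: card_image)
      qed
      ultimately show ?thesis using family_free_cycle_iff[OF H] by auto
    qed
    moreover have "graph_hom c G \<lparr> pverts = {..<p}, parcs = ?K \<rparr>"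
      using c V(2) by (auto simp: graph_hom_def)
    ultimately show "\<exists>H f. pair_graph H \<and> card (pverts H) \<le> p \<and> family_free {cycle_graph m} H \<and> graph_hom f G H"
      using H by (intro exI[of _ "\<lparr> pverts = {..<p}, parcs = ?K \<rparr>"] exI[of _ c]) simp
  qed
qed

section \<open>Bounded homomorphic images above density 1/m\<close>

text \<open>
  Greedy choice: as long as more than \<open>\<eta> n\<close> vertices are not adjacent to \<open>W\<close>, double counting of
  the edges at these vertices gives a vertex that is adjacent to at least \<open>c \<eta> n\<close> of them.
\<close>

lemma bounded_dominating_set:
  fixes V :: "'a set" and c \<eta> :: real
  assumes V: "finite V" "R \<subseteq> V \<times> V" "sym R" and c: "c > 0" and \<eta>: "\<eta> > 0"
    and deg: "\<And>v. v \<in> V \<Longrightarrow> c * card V \<le> card (R `` {v})" and K: "real K * (c * \<eta>) \<ge> 1"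
  shows "\<exists>W\<subseteq>V. card W \<le> K \<and> real (card {v \<in> V. R `` {v} \<inter> W = {}}) \<le> \<eta> * card V"
proof -
  let ?n = "real (card V)"
  define Y where "Y W = {v \<in> V. R `` {v} \<inter> W = {}}" for W
  have finY: "finite (Y W)" for W using V(1) by (simp add: Y_def)
  have "\<exists>W\<subseteq>V. card W \<le> j \<and> (real (card (Y W)) \<le> \<eta> * ?n \<or> real (card (Y W)) + real j * (c * \<eta> * ?n) \<le> ?n)" for j
  proof (induction j)
    case 0
    have "card (Y {}) \<le> card V" unfolding Y_def using V(1) by (intro card_mono) auto
    then show ?case by (intro exI[of _ "{}"]) simp
  next
    case (Suc j)
    then obtain W where W: "W \<subseteq> V" "card W \<le> j"
      "real (card (Y W)) \<le> \<eta> * ?n \<or> real (card (Y W)) + real j * (c * \<eta> * ?n) \<le> ?n" by blast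
    show ?case
    proof (cases "real (card (Y W)) \<le> \<eta> * ?n")
      case True
      then show ?thesis using W by (intro exI[of _ W]) auto
    next
      case False
      then have big: "\<eta> * ?n < real (card (Y W))" by simp
      have deg_sum: "real (card (R `` {w} \<inter> Y W)) = (\<Sum>y\<in>Y W. of_bool ((w, y) \<in> R))" for w
        using finY by (simp add: Int_def conj_commute)
      have "\<exists>w\<in>V. c * \<eta> * ?n \<le> real (card (R `` {w} \<inter> Y W))"
      proof (rule ccontr)
        assume "\<not> ?thesis"
        then have small: "real (card (R `` {w} \<inter> Y W)) \<le> c * \<eta> * ?n" if "w \<in> V" for w using that by force
        have "real (card (Y W)) * (c * ?n) = (\<Sum>y\<in>Y W. c * ?n)" by simp
        also have "\<dots> \<le> (\<Sum>y\<in>Y W. real (card (R `` {y})))" using deg by (intro sum_mono) (auto simp: Y_def)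
        also have "\<dots> = (\<Sum>y\<in>Y W. \<Sum>w\<in>V. of_bool ((w, y) \<in> R))"
        proof (rule sum.cong)
          fix y assume "y \<in> Y W"
          have "R `` {y} = {w \<in> V. (w, y) \<in> R}" using V(2,3) by (auto dest: symD)
          then show "real (card (R `` {y})) = (\<Sum>w\<in>V. of_bool ((w, y) \<in> R))"
            using V(1) by (simp add: Int_def)
        qed simp
        also have "\<dots> = (\<Sum>w\<in>V. real (card (R `` {w} \<inter> Y W)))" unfolding deg_sum by (rule sum.swap)
        also have "\<dots> \<le> (\<Sum>w\<in>V. c * \<eta> * ?n)" using small by (intro sum_mono)
        also have "\<dots> = \<eta> * ?n * (c * ?n)" by simp
        finally have le: "real (card (Y W)) * (c * ?n) \<le> \<eta> * ?n * (c * ?n)" .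
        have "Y W \<noteq> {}" using big \<eta> by (auto simp: mult_less_0_iff)
        then have "?n > 0" using V(1) by (auto simp: Y_def card_gt_0_iff)
        then show False using le big c by (simp add: mult_le_cancel_right)
      qed
      then obtain w where w: "w \<in> V" "c * \<eta> * ?n \<le> real (card (R `` {w} \<inter> Y W))" by blast
      have "Y (insert w W) = Y W - (R `` {w} \<inter> Y W)" using V(3) by (auto simp: Y_def dest: symD)
      then have "card (Y (insert w W)) + card (R `` {w} \<inter> Y W) = card (Y W)"
        using finY[of W] card_mono[OF finY[of W], of "R `` {w} \<inter> Y W"] by (simp add: card_Diff_subset)
      then have "real (card (Y (insert w W))) + real (card (R `` {w} \<inter> Y W)) = real (card (Y W))"
        by (metis of_nat_add)
      then have "real (card (Y (insert w W))) + real (Suc j) * (c * \<eta> * ?n) \<le> ?n"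
        using w(2) W(3) False by (simp add: algebra_simps)
      moreover have "card (insert w W) \<le> Suc j"
        using W(2) card_insert_le_m1[of "Suc j" W w] by simp
      ultimately show ?thesis using w(1) W(1) by (intro exI[of _ "insert w W"]) auto
    qed
  qed
  from this[of K] obtain W where W: "W \<subseteq> V" "card W \<le> K"
    "real (card (Y W)) \<le> \<eta> * ?n \<or> real (card (Y W)) + real K * (c * \<eta> * ?n) \<le> ?n" by blast
  have "real (card (Y W)) \<le> \<eta> * ?n"
  proof (rule ccontr)
    assume "\<not> ?thesis"
    then have "real (card (Y W)) + real K * (c * \<eta>) * ?n \<le> ?n" "\<eta> * ?n < real (card (Y W))"
      using W(3) by (auto simp: algebra_simps)
    moreover have "1 * ?n \<le> real K * (c * \<eta>) * ?n" using K by (intro mult_right_mono) auto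
    moreover have "0 \<le> \<eta> * ?n" using \<eta> by simp
    ultimately show False by linarith
  qed
  then show ?thesis using W(1,2) unfolding Y_def by blast
qed

text \<open>
  Colour refinement: in each round the class of a vertex is extended by the set of the classes of its
  neighbours. After \<open>d\<close> rounds the class of a vertex determines which sequences of original classes
  occur on walks of length \<open>d\<close> starting there.
\<close>

primrec refine :: "('a \<times> 'a) set \<Rightarrow> ('a \<Rightarrow> nat) \<Rightarrow> nat \<Rightarrow> 'a \<Rightarrow> nat" where
  "refine R g 0 = g"
| "refine R g (Suc d) = (\<lambda>x. prod_encode (refine R g d x, set_encode (refine R g d ` (R `` {x}))))"

primrec refine_bound :: "nat \<Rightarrow> nat \<Rightarrow> nat" where
  "refine_bound b 0 = b"
| "refine_bound b (Suc d) = refine_bound b d * 2 ^ refine_bound b d"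

lemma card_refine:
  assumes V: "finite V" "R \<subseteq> V \<times> V" and b: "card (g ` V) \<le> b"
  shows "card (refine R g d ` V) \<le> refine_bound b d"
proof (induction d)
  case (Suc d)
  let ?I = "refine R g d ` V"
  have finI: "finite ?I" using V(1) by simp
  have "refine R g (Suc d) ` V \<subseteq> prod_encode ` (?I \<times> set_encode ` Pow ?I)" using V(2) by auto
  then have "card (refine R g (Suc d) ` V) \<le> card (prod_encode ` (?I \<times> set_encode ` Pow ?I))"
    using finI by (intro card_mono) auto
  also have "\<dots> \<le> card (?I \<times> set_encode ` Pow ?I)" using finI by (intro card_image_le) auto
  also have "\<dots> = card ?I * card (set_encode ` Pow ?I)" by (rule card_cartesian_product)
  also have "\<dots> \<le> card ?I * 2 ^ card ?I"
    using finI by (intro mult_le_mono2) (metis card_Pow card_image_le finite_Pow_iff)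
  also have "\<dots> \<le> refine_bound b d * 2 ^ refine_bound b d"
    using Suc.IH by (intro mult_le_mono power_increasing) auto
  finally show ?case by simp
qed (simp add: b)

lemma refine_Suc_eqD:
  assumes "finite (R `` {x})" "finite (R `` {y})" "refine R g (Suc d) x = refine R g (Suc d) y"
  shows "refine R g d x = refine R g d y" "refine R g d ` (R `` {x}) = refine R g d ` (R `` {y})"
  using assms by (auto dest: set_encode_inf inj_onD[OF inj_on_set_encode])

lemma refine_mono_eq:
  assumes "\<And>x. finite (R `` {x})" "refine R g d x = refine R g d y" "d' \<le> d"
  shows "refine R g d' x = refine R g d' y"
  using assms(2,3)
proof (induction d)
  case (Suc d)
  from refine_Suc_eqD(1)[OF assms(1,1) Suc.prems(1)] Suc show ?case by (auto simp: le_Suc_eq)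
qed simp

text \<open>
  Every edge of the quotient comes from some edge of the graph, but consecutive edges need not share
  a vertex. At the cost of one level of refinement per step, a walk can nevertheless be continued
  from the vertex already reached; \<open>D\<close> levels of refinement allow \<open>D\<close> steps.
\<close>

lemma quotient_walk_lift:
  fixes R :: "('a \<times> 'a) set" and g0 :: "'a \<Rightarrow> nat"
  assumes fin: "\<And>x. finite (R `` {x})" and l: "l > 0"
    and walk: "(p, p) \<in> (map_prod (refine R g0 D) (refine R g0 D) ` R) ^^ l"
  shows "\<exists>u. (\<forall>i<D. (u i, u (Suc i)) \<in> R) \<and>
     (\<forall>i\<le>D. \<forall>j\<le>D. i mod l = j mod l \<longrightarrow> g0 (u i) = g0 (u j))"
proof -
  let ?g = "refine R g0"
  obtain P where P: "P 0 = p" "P l = p" "\<And>i. i < l \<Longrightarrow> (P i, P (Suc i)) \<in> map_prod (?g D) (?g D) ` R"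
    using relpow_walk[OF walk] by metis
  define p' where "p' i = P (i mod l)" for i
  have step: "(p' i, p' (Suc i)) \<in> map_prod (?g D) (?g D) ` R" for i
    using P(3)[of "i mod l"] P(1,2) l by (auto simp: p'_def mod_Suc split: if_splits)
  have "\<exists>x. ?g D x = p' i" for i using step[of i] by (auto simp: map_prod_def)
  then obtain rep' where rep': "\<And>i. ?g D (rep' i) = p' i" by metis
  define rep where "rep i = rep' (i mod l)" for i
  have rep: "?g D (rep i) = p' i" for i using rep' by (simp add: rep_def p'_def)
  have "\<exists>u. (\<forall>i<n. (u i, u (Suc i)) \<in> R) \<and> (\<forall>i\<le>n. ?g (D - i) (u i) = ?g (D - i) (rep i))" if "n \<le> D" for n
    using that
  proof (induction n)
    case 0
    then show ?case by (intro exI[of _ "\<lambda>_. rep 0"]) simp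
  next
    case (Suc n)
    then obtain u where u: "\<forall>i<n. (u i, u (Suc i)) \<in> R" "\<forall>i\<le>n. ?g (D - i) (u i) = ?g (D - i) (rep i)" by auto
    obtain x y where xy: "(x, y) \<in> R" "?g D x = p' n" "?g D y = p' (Suc n)" using step[of n] by auto
    define d where "d = D - Suc n"
    have Dn: "D - n = Suc d" using Suc.prems by (simp add: d_def Suc_diff_Suc)
    have "?g D x = ?g D (rep n)" using xy(2) rep[of n] by simp
    from refine_mono_eq[OF fin this diff_le_self[of D n]] u(2)[rule_format, OF le_refl]
    have "?g (Suc d) x = ?g (Suc d) (u n)" unfolding Dn by (rule trans[OF _ sym])
    from refine_Suc_eqD(2)[OF fin fin this] have "?g d y \<in> ?g d ` (R `` {u n})" using xy(1) by blast
    then obtain y' where y': "(u n, y') \<in> R" "?g d y' = ?g d y" by auto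
    have "?g D y = ?g D (rep (Suc n))" using xy(3) rep[of "Suc n"] by simp
    from refine_mono_eq[OF fin this diff_le_self[of D "Suc n"]] y'(2)
    have "?g d y' = ?g d (rep (Suc n))" by (simp add: d_def)
    then show ?case using u y'(1)
      by (intro exI[of _ "u(Suc n := y')"]) (auto simp: d_def less_Suc_eq le_Suc_eq)
  qed
  then obtain u where u: "\<forall>i<D. (u i, u (Suc i)) \<in> R" "\<forall>i\<le>D. ?g (D - i) (u i) = ?g (D - i) (rep i)" by blast
  have "g0 (u i) = g0 (rep i)" if "i \<le> D" for i
  proof -
    have "?g (D - i) (u i) = ?g (D - i) (rep i)" using u(2) that by blast
    from refine_mono_eq[OF fin this, of 0] show ?thesis by simp
  qed
  moreover have "rep i = rep j" if "i mod l = j mod l" for i j using that by (simp add: rep_def)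
  ultimately show ?thesis using u(1) by (intro exI[of _ u]) metis
qed

text \<open>
  All elements lie in two residue classes \<open>i\<close> and \<open>i + 2\<close> modulo \<open>m\<close>: three classes with pairwise
  difference \<open>\<plusminus> 2\<close> would require \<open>m\<close> to divide 6. Shifting the elements of the class \<open>i + 2\<close> by
  \<open>m - 2\<close> moves them into the class \<open>i\<close>, and by hypothesis they do not collide with those already
  there.
\<close>

lemma card_le_of_sparse_differences:
  fixes P :: "nat set"
  assumes m: "odd m" "m \<ge> 5" and P: "P \<subseteq> {..<m * M}"
    and diff: "\<And>a b. a \<in> P \<Longrightarrow> b \<in> P \<Longrightarrow> a < b \<Longrightarrow> (b - a) mod m \<in> {0, 2, m - 2} \<and> b - a \<noteq> m - 2"
  shows "card P \<le> M + 1"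
proof (cases "P = {}")
  case False
  have finP: "finite P" using P finite_subset by blast
  define a0 where "a0 = Min P"
  have a0: "a0 \<in> P" "\<And>b. b \<in> P \<Longrightarrow> a0 \<le> b" using False finP by (auto simp: a0_def)
  define q where "q b = (b - a0) div m" for b
  define r where "r b = (b - a0) mod m" for b
  have b_eq: "b = a0 + m * q b + r b" if "b \<in> P" for b
    using a0(2)[OF that] by (simp add: q_def r_def)
  have r: "r b \<in> {0, 2, m - 2}" if "b \<in> P" for b
  proof (cases "b = a0")
    case False
    then show ?thesis using diff[OF a0(1) that] a0(2)[OF that] unfolding r_def by linarith
  qed (simp add: r_def)
  have qM: "Suc (q b) \<le> M" if "b \<in> P" for b
  proof -
    have "b - a0 < M * m" using P that by (auto simp: mult.commute)
    then show ?thesis unfolding q_def by (simp add: Suc_le_eq less_mult_imp_div_less)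
  qed
  have no_gap: "b \<noteq> c + (m - 2)" if "b \<in> P" "c \<in> P" for b c
  proof
    assume "b = c + (m - 2)"
    then have "c < b" "b - c = m - 2" using m by simp_all
    then show False using diff[OF that(2,1)] by blast
  qed
  have "\<exists>\<psi>. inj_on \<psi> P \<and> \<psi> ` P \<subseteq> {..M}"
  proof (cases "\<exists>b\<in>P. r b = m - 2")
    case False
    then have r': "r b = 0 \<or> r b = 2" if "b \<in> P" for b using r[OF that] that by blast
    define \<psi> where "\<psi> b = (if r b = 0 then q b else Suc (q b))" for b
    have "b = c" if bc: "b \<in> P" "c \<in> P" "\<psi> b = \<psi> c" "r b \<le> r c" for b c
    proof -
      have eb: "b = a0 + m * q b + r b" and ec: "c = a0 + m * q c + r c" using b_eq bc by blast+
      consider "r b = r c" | "r b = 0" "r c = 2" using r'[OF bc(1)] r'[OF bc(2)] bc(4) by auto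
      then show ?thesis
      proof cases
        case 1
        then have "q b = q c" using bc(3) by (auto simp: \<psi>_def split: if_splits)
        then show ?thesis using 1 eb ec by simp
      next
        case 2
        then have "q b = Suc (q c)" using bc(3) by (simp add: \<psi>_def)
        then have "b = a0 + (m + m * q c)" "c = a0 + m * q c + 2" using eb ec 2 by simp_all
        then have "b = c + (m - 2)" using m by linarith
        then show ?thesis using no_gap bc by blast
      qed
    qed
    then have "inj_on \<psi> P" by (intro inj_onI) (metis nat_le_linear)
    moreover have "\<psi> ` P \<subseteq> {..M}" using qM by (fastforce simp: \<psi>_def)
    ultimately show ?thesis by blast
  next
    case True
    then obtain c where c: "c \<in> P" "r c = m - 2" by blast
    have m6: "m \<noteq> 6" using m by auto
    \<comment> \<open>The classes of \<open>a\<^sub>0 + 2\<close> and \<open>a\<^sub>0 - 2\<close> differ by 4, so only one of them occurs.\<close>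
    have no2: "r b \<noteq> 2" if b: "b \<in> P" for b
    proof
      assume rb: "r b = 2"
      have eb: "b = a0 + m * q b + 2" and ec: "c = a0 + m * q c + (m - 2)" using b_eq b c rb by metis+
      show False
      proof (cases "q b \<le> q c")
        case True
        then obtain e where e: "q c = q b + e" using le_Suc_ex by blast
        have d: "c - b = m * e + (m - 4)" "b < c" using eb ec m by (auto simp: e algebra_simps)
        have "(c - b) mod m = (m - 4) mod m" unfolding d(1) by (rule mod_mult_self4)
        then have "(c - b) mod m = m - 4" using m by simp
        then show False using diff[OF b c(1) d(2)] m m6 by auto
      next
        case False
        then obtain e where e: "q b = q c + Suc e" by (metis add_Suc_right less_imp_Suc_add not_le)
        have d: "b - c = m * e + 4" "c < b" using eb ec m by (auto simp: e algebra_simps)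
        have "(b - c) mod m = 4 mod m" unfolding d(1) by (rule mod_mult_self4)
        then have "(b - c) mod m = 4" using m by simp
        then show False using diff[OF c(1) b d(2)] m m6 by auto
      qed
    qed
    have "b = c" if bc: "b \<in> P" "c \<in> P" "q b = q c" "r c \<le> r b" for b c
    proof -
      have eb: "b = a0 + m * q b + r b" and ec: "c = a0 + m * q c + r c" using b_eq bc by blast+
      consider "r b = r c" | "r c = 0" "r b = m - 2"
        using r[OF bc(1)] r[OF bc(2)] no2[OF bc(1)] no2[OF bc(2)] bc(4) by auto
      then show ?thesis
      proof cases
        case 1
        then show ?thesis using eb ec bc(3) by simp
      next
        case 2
        then have "b = c + (m - 2)" using eb ec bc(3) by simp
        then show ?thesis using no_gap bc by blast
      qed
    qed
    then have "inj_on q P" by (intro inj_onI) (metis nat_le_linear)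
    moreover have "q ` P \<subseteq> {..M}" using qM by fastforce
    ultimately show ?thesis by blast
  qed
  then obtain \<psi> where "inj_on \<psi> P" "\<psi> ` P \<subseteq> {..M}" by blast
  then have "card P \<le> card {..M}" by (intro card_inj_on_le) auto
  then show ?thesis by simp
qed simp

text \<open>
  Let \<open>A i\<close> be the neighbourhood of \<open>u i\<close> without the small exceptional set \<open>Y\<close>. A common element of
  \<open>A i\<close> and \<open>A j\<close> closes the walk between \<open>u i\<close> and \<open>u j\<close> at the cost of two further steps; this
  excludes common elements for odd \<open>j - i \<le> m - 2\<close>. By \<open>same\<close>, a common element of \<open>A a\<close> and \<open>A b\<close>
  also yields a walk of length 4 from \<open>u b\<close> to any \<open>u c\<close> with \<open>c\<close> congruent to \<open>a\<close> modulo \<open>l\<close>; this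
  excludes common elements whenever such a \<open>c\<close> has odd distance at most \<open>m - 4\<close> from \<open>b\<close>.

  If \<open>l \<le> m - 4\<close>, the second fact applies with \<open>a = b\<close>, so that \<open>A a\<close> would be empty. If \<open>l = m - 2\<close>,
  the two facts together show that \<open>m\<close> consecutive sets \<open>A i\<close> are pairwise disjoint, and they are too
  large for that. If \<open>l = m\<close>, they show that a vertex lies in at most \<open>M + 1\<close> of \<open>m M\<close> consecutive sets,
  so that the average size of these sets is at most \<open>(1/m + 1/(m M)) n\<close>.
\<close>

lemma no_periodic_walk:
  fixes V :: "'a set" and g0 :: "'a \<Rightarrow> nat"
  assumes V: "finite V" "V \<noteq> {}" "R \<subseteq> V \<times> V" "sym R" and no: "no_odd_closed_walk R m"
    and m: "odd m" "m \<ge> 5" and \<epsilon>: "\<epsilon> > 0"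
    and deg: "\<And>v. v \<in> V \<Longrightarrow> (1 / real m + \<epsilon>) * card V \<le> card (R `` {v})"
    and Y: "Y \<subseteq> V" "real (card Y) \<le> \<epsilon> / 2 * card V"
    and same: "\<And>x y s. g0 x = g0 y \<Longrightarrow> (x, s) \<in> R \<Longrightarrow> s \<notin> Y \<Longrightarrow> y \<in> V \<Longrightarrow> (y, s) \<in> R ^^ 3"
    and M: "real m * real M * \<epsilon> / 2 > 1" and D: "D = m * (M + 2)"
    and u: "\<And>i. i < D \<Longrightarrow> (u i, u (Suc i)) \<in> R"
    and per: "\<And>i j. i \<le> D \<Longrightarrow> j \<le> D \<Longrightarrow> i mod l = j mod l \<Longrightarrow> g0 (u i) = g0 (u j)"
    and l: "odd l" "l \<le> m"
  shows False
proof -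
  let ?n = "real (card V)"
  have n0: "?n > 0" using V(1,2) by (simp add: card_gt_0_iff)
  have D2: "2 * m \<le> D" "m * M + m \<le> D" unfolding D by (auto simp: algebra_simps)
  have uV: "u i \<in> V" if "i \<le> D" for i
  proof (cases "i < D")
    case True then show ?thesis using u V(3) by blast
  next
    case False
    then have "i - 1 < D" "Suc (i - 1) = i" using that D2 m by auto
    then show ?thesis using u[of "i - 1"] V(3) by auto
  qed
  have symR: "(a, b) \<in> R \<Longrightarrow> (b, a) \<in> R" for a b using V(4) by (meson symE)
  define A where "A i = R `` {u i} - Y" for i
  have finR: "finite (R `` {x})" for x by (rule finite_subset[OF _ V(1)]) (use V(3) in auto)
  have AV: "A i \<subseteq> V" for i using V(3) by (auto simp: A_def)
  have finA: "finite (A i)" for i using AV V(1) finite_subset by blast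
  have cardA: "(1 / real m + \<epsilon> / 2) * ?n \<le> real (card (A i))" if "i \<le> D" for i
  proof -
    have "card (R `` {u i}) \<le> card (A i \<union> Y)"
      unfolding A_def using finR V(1) Y(1) finite_subset by (intro card_mono) auto
    also have "\<dots> \<le> card (A i) + card Y" by (rule card_Un_le)
    finally have "real (card (R `` {u i})) \<le> real (card (A i)) + real (card Y)" by linarith
    then show ?thesis using deg[OF uV[OF that]] Y(2) by (simp add: algebra_simps)
  qed
  have walk: "(u i, u j) \<in> R ^^ (j - i)" if "i \<le> j" "j \<le> D" for i j
    by (rule relpow_of_fun) (use that u in auto)
  have real_disj: "A i \<inter> A j = {}" if ij: "i < j" "j \<le> D" "odd (j - i)" "j - i + 2 \<le> m" for i j
  proof -
    have False if "s \<in> A i" "s \<in> A j" for s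
    proof -
      have "(u j, s) \<in> R" "(s, u i) \<in> R" using that by (auto simp: A_def intro: symR)
      then have "(u j, u i) \<in> R ^^ 2" by (auto simp: numeral_2_eq_2)
      from relpow_append[OF walk[of i j] this] have "(u i, u i) \<in> R ^^ (j - i + 2)" using ij by simp
      from no_odd_closed_walkD[OF no this] show False using ij by simp
    qed
    then show ?thesis by blast
  qed
  have jump_disj: "A a \<inter> A b = {}"
    if abc: "a \<le> D" "b \<le> D" "c \<le> D" "a mod l = c mod l" and q: "q = (if c \<le> b then b - c else c - b)"
      "odd q" "q + 4 \<le> m" for a b c q
  proof -
    have bc: "(u b, u c) \<in> R ^^ q"
      using walk[of c b] walk[of b c] relpow_rev[OF V(4)] abc q(1) by (auto split: if_splits)
    have False if s: "s \<in> A a" "s \<in> A b" for s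
    proof -
      have "(u c, s) \<in> R ^^ 3"
        by (rule same[of "u a"]) (use per[OF abc(1,3,4)] s uV[OF abc(3)] in \<open>auto simp: A_def\<close>)
      moreover have "(s, u b) \<in> R ^^ 1" using s by (auto simp: A_def intro: symR)
      ultimately have "(u c, u c) \<in> R ^^ (3 + 1 + q)" using bc relpow_append by metis
      from no_odd_closed_walkD[OF no this] show False using q by simp
    qed
    then show ?thesis by blast
  qed
  have "even (m - l)" using l m by simp
  then obtain e where "m - l = 2 * e" by (elim evenE)
  then have "m = l + 2 * e" using l(2) by linarith
  moreover have "e = 0 \<or> e = 1 \<or> e \<ge> 2" by linarith
  ultimately consider "l + 4 \<le> m" | "l = m - 2" | "l = m" by fastforce
  then show False
  proof cases
    case 1
    have "A 0 \<inter> A 0 = {}" by (rule jump_disj[of 0 0 l l]) (use 1 l D2 in auto)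
    moreover have "0 < (1 / real m + \<epsilon> / 2) * ?n" using n0 \<epsilon> m by (intro mult_pos_pos add_pos_pos) auto
    then have "real (card (A 0)) > 0" using cardA[of 0] by linarith
    ultimately show False by simp
  next
    case 2
    have disj: "A i \<inter> A j = {}" if ij: "i < j" "j < m" for i j
    proof (cases "odd (j - i)")
      case True
      moreover have "even (m - 1)" using m by simp
      ultimately have "j - i \<noteq> m - 1" by metis
      moreover have "j - i \<le> m - 1" using ij by linarith
      ultimately have "j - i + 2 \<le> m" using True ij m by presburger
      then show ?thesis using True ij D2 by (intro real_disj) auto
    next
      case False
      then have "2 \<le> j - i" using ij by presburger
      show ?thesis
      proof (rule jump_disj[where c = "i + l"])
        show "i mod l = (i + l) mod l" by simp
        show "odd (if i + l \<le> j then j - (i + l) else i + l - j)" using False l ij by presburger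
        show "(if i + l \<le> j then j - (i + l) else i + l - j) + 4 \<le> m" using 2 m ij \<open>2 \<le> j - i\<close> by auto
      qed (use ij D2 2 in auto)
    qed
    have "real m * ((1 / real m + \<epsilon> / 2) * ?n) = (\<Sum>i<m. (1 / real m + \<epsilon> / 2) * ?n)" by simp
    also have "\<dots> \<le> (\<Sum>i<m. real (card (A i)))" using D2 by (intro sum_mono cardA) auto
    also have "\<dots> = real (card (\<Union>i<m. A i))"
    proof -
      have "card (\<Union>i<m. A i) = (\<Sum>i<m. card (A i))"
      proof (rule card_UN_disjoint)
        show "\<forall>i\<in>{..<m}. \<forall>j\<in>{..<m}. i \<noteq> j \<longrightarrow> A i \<inter> A j = {}"
          using disj by (metis inf_commute lessThan_iff linorder_neqE_nat)
      qed (use finA in auto)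
      then show ?thesis by simp
    qed
    also have "\<dots> \<le> ?n" using AV V(1) by (auto intro!: card_mono)
    finally have "(1 + real m * \<epsilon> / 2) * ?n \<le> 1 * ?n" using m by (simp add: algebra_simps)
    from mult_right_le_imp_le[OF this n0] have "real m * \<epsilon> / 2 \<le> 0" by simp
    then show False using \<epsilon> m by (simp add: mult_le_0_iff)
  next
    case 3
    let ?L = "m * M"
    have card_P: "card {a. a < ?L \<and> s \<in> A a} \<le> M + 1" for s
    proof (rule card_le_of_sparse_differences[OF m])
      fix a b assume "a \<in> {a. a < ?L \<and> s \<in> A a}" "b \<in> {a. a < ?L \<and> s \<in> A a}" and ab: "a < b"
      then have L: "a < ?L" "b < ?L" and meet: "A a \<inter> A b \<noteq> {}" by auto
      then have abD: "a \<le> D" "b \<le> D" using D2 by auto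
      have gap: "b - a \<noteq> m - 2"
      proof
        assume "b - a = m - 2"
        moreover have "odd (m - 2)" "m - 2 + 2 \<le> m" using m by auto
        ultimately show False using real_disj[OF ab abD(2)] meet by metis
      qed
      define r where "r = (b - a) mod m"
      have r: "r < m" "r \<le> b - a" using m by (auto simp: r_def)
      have bar: "(b - r) mod m = a mod m"
      proof -
        have "m dvd (b - a) - r" unfolding r_def by (rule dvd_minus_mod)
        then obtain e where "b - a - r = m * e" by blast
        then have "b - r = a + m * e" using r(2) ab by linarith
        then show ?thesis by simp
      qed
      have "r \<in> {0, 2, m - 2}"
      proof (cases "odd r")
        case True
        have "\<not> r + 4 \<le> m"
        proof
          assume "r + 4 \<le> m"
          have "A a \<inter> A b = {}"
            by (rule jump_disj[where c = "b - r" and q = r]) (use abD bar 3 True \<open>r + 4 \<le> m\<close> r in auto)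
          then show False using meet by blast
        qed
        moreover have "r \<noteq> m - 1" "r \<noteq> m - 3" using True m by auto
        ultimately have "r = m - 2" using r(1) by linarith
        then show ?thesis by simp
      next
        case False
        have "\<not> 4 \<le> r"
        proof
          assume r4: "4 \<le> r"
          have "(b + (m - r)) mod m = a mod m"
          proof -
            have "b + (m - r) = (b - r) + m" using r ab by linarith
            then show ?thesis using bar by simp
          qed
          then have "A a \<inter> A b = {}"
            by (intro jump_disj[where c = "b + (m - r)" and q = "m - r"]) (use abD L D2 3 False r4 r m in auto)
          then show False using meet by blast
        qed
        moreover have "r \<noteq> 1" "r \<noteq> 3" using False by auto
        ultimately have "r = 0 \<or> r = 2" by linarith
        then show ?thesis by blast
      qed
      then show "(b - a) mod m \<in> {0, 2, m - 2} \<and> b - a \<noteq> m - 2" using gap by (simp add: r_def)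
    qed auto
    have "real ?L * ((1 / real m + \<epsilon> / 2) * ?n) = (\<Sum>a<?L. (1 / real m + \<epsilon> / 2) * ?n)" by simp
    also have "\<dots> \<le> (\<Sum>a<?L. real (card (A a)))" using D2 by (intro sum_mono cardA) auto
    also have "\<dots> = (\<Sum>a<?L. \<Sum>s\<in>V. of_bool (s \<in> A a))"
    proof (rule sum.cong)
      fix a show "real (card (A a)) = (\<Sum>s\<in>V. of_bool (s \<in> A a))"
        using V(1) AV[of a] by (simp add: Int_absorb1)
    qed simp
    also have "\<dots> = (\<Sum>s\<in>V. \<Sum>a<?L. of_bool (s \<in> A a))" by (rule sum.swap)
    also have "\<dots> \<le> (\<Sum>s\<in>V. real (M + 1))"
    proof (rule sum_mono)
      fix s
      have "(\<Sum>a<?L. of_bool (s \<in> A a)) = real (card {a. a < ?L \<and> s \<in> A a})" by (simp add: Int_def)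
      then show "(\<Sum>a<?L. of_bool (s \<in> A a)) \<le> real (M + 1)" using card_P[of s] by simp
    qed
    also have "\<dots> = real (M + 1) * ?n" by simp
    finally have "real ?L * (1 / real m + \<epsilon> / 2) * ?n \<le> real (M + 1) * ?n" by (simp only: mult.assoc)
    then have "real ?L * (1 / real m + \<epsilon> / 2) \<le> real (M + 1)" by (rule mult_right_le_imp_le[OF _ n0])
    moreover have "real ?L * (1 / real m + \<epsilon> / 2) = real M + real m * real M * \<epsilon> / 2" using m by (simp add: field_simps)
    ultimately show False using M by simp
  qed
qed

text \<open>
  A vertex is classified by the members of an almost dominating set that it reaches in two steps.
  If \<open>x\<close> and \<open>y\<close> have the same class and \<open>s\<close> is a neighbour of \<open>x\<close> adjacent to \<open>w \<in> W\<close>, then \<open>y\<close>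
  also reaches \<open>w\<close> in two steps, hence \<open>s\<close> in three. The bound on the image depends on \<open>\<epsilon>\<close> and
  \<open>m\<close> alone.
\<close>

lemma odd_cycles_upper_bound:
  assumes m: "odd m" "m \<ge> 5"
  shows "delta_hom (odd_cycles m) (odd_cycles m) \<le> ereal (1 / real m)"
proof (rule delta_hom_leI)
  fix \<epsilon> :: real assume \<epsilon>: "\<epsilon> > 0"
  have m0: "real m > 0" using m by simp
  obtain K :: nat where K: "real K > 1 / (1 / real m * (\<epsilon> / 2))" using reals_Archimedean2 by blast
  have K1: "real K * (1 / real m * (\<epsilon> / 2)) \<ge> 1" using K \<epsilon> m0 by (simp add: field_simps)
  \<comment> \<open>For this \<open>M\<close>, a family of \<open>m M\<close> sets of size \<open>(1/m + \<epsilon>/2) n\<close> covers more than \<open>(M + 1) n\<close> points.\<close>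
  obtain M :: nat where M: "real M > 2 / (real m * \<epsilon>)" using reals_Archimedean2 by blast
  have M1: "real m * real M * \<epsilon> / 2 > 1" using M \<epsilon> m0 by (simp add: field_simps)
  \<comment> \<open>Walks of length \<open>m M\<close> with two further periods, into which the shifted indices \<open>c\<close> may fall.\<close>
  define D where "D = m * (M + 2)"
  show "\<exists>b::nat. \<forall>G. pair_graph G \<and> pverts G \<noteq> {} \<and> family_free (odd_cycles m) G \<and>
     real (min_degree G) \<ge> (1 / real m + \<epsilon>) * real (card (pverts G)) \<longrightarrow>
     (\<exists>H f. pair_graph H \<and> card (pverts H) \<le> b \<and> family_free (odd_cycles m) H \<and> graph_hom f G H)"
  proof (intro exI[of _ "refine_bound (2 ^ K) D"] allI impI, elim conjE)
    fix G :: "nat pair_pre_digraph"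
    assume G: "pair_graph G" and ne: "pverts G \<noteq> {}" and ff: "family_free (odd_cycles m) G"
      and md: "(1 / real m + \<epsilon>) * real (card (pverts G)) \<le> real (min_degree G)"
    interpret pair_graph G by fact
    let ?V = "pverts G" and ?R = "parcs G"
    have V: "finite ?V" "?R \<subseteq> ?V \<times> ?V" "sym ?R"
      using pair_finite_verts sym_parcs[OF G] by (auto dest: in_arcsD1 in_arcsD2)
    have no: "no_odd_closed_walk ?R m" using family_free_odd_cycles_iff[OF G] ff by blast
    have deg: "(1 / real m + \<epsilon>) * card ?V \<le> card (?R `` {v})" if "v \<in> ?V" for v
      using md min_degree_le[OF G that] by linarith
    have deg': "1 / real m * card ?V \<le> card (?R `` {v})" if "v \<in> ?V" for v
    proof -
      have "1 / real m * card ?V \<le> (1 / real m + \<epsilon>) * card ?V" using \<epsilon> by (intro mult_right_mono) auto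
      then show ?thesis using deg[OF that] by linarith
    qed
    obtain W where W: "W \<subseteq> ?V" "card W \<le> K" "real (card {v \<in> ?V. ?R `` {v} \<inter> W = {}}) \<le> \<epsilon> / 2 * card ?V"
      using bounded_dominating_set[OF V _ _ deg' K1] m0 \<epsilon> by auto
    have finW: "finite W" using W(1) V(1) finite_subset by blast
    define Y where "Y = {v \<in> ?V. ?R `` {v} \<inter> W = {}}"
    define near where "near x = {w \<in> W. \<exists>s. (x, s) \<in> ?R \<and> (s, w) \<in> ?R}" for x
    define g0 where "g0 x = set_encode (near x)" for x
    have same: "(y, s) \<in> ?R ^^ 3" if xys: "g0 x = g0 y" "(x, s) \<in> ?R" "s \<notin> Y" "y \<in> ?V" for x y s
    proof -
      have "near x = near y" using xys(1) finW unfolding g0_def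
        by (subst (asm) inj_on_eq_iff[OF inj_on_set_encode]) (auto simp: near_def)
      moreover obtain w where w: "w \<in> W" "(s, w) \<in> ?R" using xys(2,3) V(2) by (auto simp: Y_def)
      ultimately obtain s' where "(y, s') \<in> ?R" "(s', w) \<in> ?R" using xys(2) by (auto simp: near_def)
      moreover have "(w, s) \<in> ?R" using w(2) V(3) by (meson symE)
      ultimately show ?thesis by (auto simp: numeral_3_eq_3)
    qed
    define g where "g = refine ?R g0 D"
    define Q where "Q = map_prod g g ` ?R"
    have fin: "finite (?R `` {x})" for x by (rule finite_subset[OF _ V(1)]) (use V(2) in auto)
    have noQ: "no_odd_closed_walk Q m" unfolding no_odd_closed_walk_def
    proof (intro allI impI notI, elim conjE)
      fix l p assume l: "odd l" "l \<le> m" and walk: "(p, p) \<in> Q ^^ l"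
      obtain u where u: "\<forall>i<D. (u i, u (Suc i)) \<in> ?R"
        "\<forall>i\<le>D. \<forall>j\<le>D. i mod l = j mod l \<longrightarrow> g0 (u i) = g0 (u j)"
        using quotient_walk_lift[OF fin odd_pos[OF l(1)] walk[unfolded Q_def g_def]] by blast
      show False
      proof (rule no_periodic_walk[OF V(1) ne V(2,3) no m \<epsilon>])
        show "(1 / real m + \<epsilon>) * card ?V \<le> card (?R `` {v})" if "v \<in> ?V" for v by (rule deg[OF that])
        show "Y \<subseteq> ?V" by (auto simp: Y_def)
        show "real (card Y) \<le> \<epsilon> / 2 * card ?V" using W(3) by (simp add: Y_def)
        show "(y, s) \<in> ?R ^^ 3" if "g0 x = g0 y" "(x, s) \<in> ?R" "s \<notin> Y" "y \<in> ?V" for x y s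
          using that by (rule same)
        show "(u i, u (Suc i)) \<in> ?R" if "i < D" for i using u(1) that by blast
        show "g0 (u i) = g0 (u j)" if "i \<le> D" "j \<le> D" "i mod l = j mod l" for i j using u(2) that by blast
      qed (use M1 D_def l in auto)
    qed
    have H: "pair_graph \<lparr> pverts = g ` ?V, parcs = Q \<rparr>"
    proof (rule pair_graphI)
      show "finite (g ` ?V)" using V(1) by simp
      show "Q \<subseteq> g ` ?V \<times> g ` ?V" using V(2) by (auto simp: Q_def)
      show "sym Q" using V(3) by (force simp: Q_def sym_def)
      show "irrefl Q"
      proof (rule irreflI)
        fix p show "(p, p) \<notin> Q" using no_odd_closed_walkD[OF noQ, of p 1] m by auto
      qed
    qed
    have "card (g0 ` ?V) \<le> card (set_encode ` Pow W)"
      using finW by (intro card_mono) (auto simp: g0_def near_def)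
    also have "\<dots> \<le> card (Pow W)" using finW by (intro card_image_le) simp
    also have "\<dots> \<le> 2 ^ K" using finW W(2) by (simp add: card_Pow)
    finally have "card (g ` ?V) \<le> refine_bound (2 ^ K) D" unfolding g_def by (rule card_refine[OF V(1,2)])
    moreover have "graph_hom g G \<lparr> pverts = g ` ?V, parcs = Q \<rparr>" by (auto simp: graph_hom_def Q_def)
    moreover have "family_free (odd_cycles m) \<lparr> pverts = g ` ?V, parcs = Q \<rparr>"
      using family_free_odd_cycles_iff[OF H] noQ by simp
    ultimately show "\<exists>H f. pair_graph H \<and> card (pverts H) \<le> refine_bound (2 ^ K) D \<and>
        family_free (odd_cycles m) H \<and> graph_hom f G H"
      using H by (intro exI[of _ "\<lparr> pverts = g ` ?V, parcs = Q \<rparr>"] exI[of _ g]) simp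
  qed
qed

section \<open>Sparse lifts of finite graphs\<close>

text \<open>
  A colour class that contains no two points differing exactly in the coordinate \<open>e\<close> is mapped
  injectively by forgetting \<open>e\<close>, so it has at most \<open>N ^ (card Ed - 1)\<close> points. Fewer than \<open>N\<close> such classes
  cannot cover the cube, so some class contains pairs for all \<open>e\<close> simultaneously.
\<close>

lemma monochromatic_pairs:
  fixes \<kappa> :: "('e \<Rightarrow> nat) \<Rightarrow> 'c"
  assumes Ed: "finite Ed" and S: "finite S" "card S < N" and \<kappa>: "\<And>x. x \<in> Ed \<rightarrow>\<^sub>E {..<N} \<Longrightarrow> \<kappa> x \<in> S"
  shows "\<exists>s. \<forall>e\<in>Ed. \<exists>x\<in>Ed \<rightarrow>\<^sub>E {..<N}. \<exists>y\<in>Ed \<rightarrow>\<^sub>E {..<N}. \<kappa> x = s \<and> \<kappa> y = s \<and>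
     (\<forall>e'\<in>Ed. x e' = y e' \<longleftrightarrow> e' \<noteq> e)"
proof (rule ccontr)
  let ?X = "Ed \<rightarrow>\<^sub>E {..<N}"
  define P where "P s e \<longleftrightarrow> (\<exists>x\<in>?X. \<exists>y\<in>?X. \<kappa> x = s \<and> \<kappa> y = s \<and>
     (\<forall>e'\<in>Ed. x e' = y e' \<longleftrightarrow> e' \<noteq> e))" for s e
  assume "\<not> ?thesis"
  then have "\<not> (\<exists>s. \<forall>e\<in>Ed. P s e)" by (simp only: P_def not_False_eq_True)
  then have "\<forall>s. \<exists>e. e \<in> Ed \<and> \<not> P s e" by blast
  then obtain \<epsilon> where \<epsilon>: "\<And>s. \<epsilon> s \<in> Ed" and "\<And>s. \<not> P s (\<epsilon> s)"
    by metis
  then have none: "\<not> (\<forall>e'\<in>Ed. x e' = y e' \<longleftrightarrow> e' \<noteq> \<epsilon> s)"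
    if "x \<in> ?X" "y \<in> ?X" "\<kappa> x = s" "\<kappa> y = s" for s x y
    using that unfolding P_def by blast
  have card_class: "card {x \<in> ?X. \<kappa> x = s} \<le> N ^ (card Ed - 1)" for s
  proof -
    let ?Y = "(Ed - {\<epsilon> s}) \<rightarrow>\<^sub>E {..<N}"
    have "inj_on (\<lambda>x. restrict x (Ed - {\<epsilon> s})) {x \<in> ?X. \<kappa> x = s}"
    proof (rule inj_onI, rule ccontr)
      fix x y assume x: "x \<in> {x \<in> ?X. \<kappa> x = s}" and y: "y \<in> {x \<in> ?X. \<kappa> x = s}"
        and eq: "restrict x (Ed - {\<epsilon> s}) = restrict y (Ed - {\<epsilon> s})" and "x \<noteq> y"
      have off: "x e = y e" if "e \<in> Ed" "e \<noteq> \<epsilon> s" for e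
        using fun_cong[OF eq, of e] that by simp
      have "x \<in> ?X" "y \<in> ?X" using x y by auto
      then have "x (\<epsilon> s) \<noteq> y (\<epsilon> s)" using \<open>x \<noteq> y\<close> off PiE_ext[of x Ed "\<lambda>_. {..<N}" y] by metis
      then show False using none[of x y s] x y off by blast
    qed
    moreover have "(\<lambda>x. restrict x (Ed - {\<epsilon> s})) ` {x \<in> ?X. \<kappa> x = s} \<subseteq> ?Y"
      by (auto simp: PiE_iff restrict_def split: if_splits)
    moreover have "finite ?Y" using Ed by (intro finite_PiE) auto
    ultimately have "card {x \<in> ?X. \<kappa> x = s} \<le> card ?Y" by (intro card_inj_on_le)
    then show ?thesis using Ed \<epsilon>[of s] by (simp add: card_PiE)
  qed
  have "?X = (\<Union>s\<in>S. {x \<in> ?X. \<kappa> x = s})" using \<kappa> by auto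
  from arg_cong[OF this, of card] have "card ?X = card (\<Union>s\<in>S. {x \<in> ?X. \<kappa> x = s})" .
  also have "\<dots> \<le> (\<Sum>s\<in>S. card {x \<in> ?X. \<kappa> x = s})" by (rule card_UN_le[OF S(1)])
  also have "\<dots> \<le> (\<Sum>s\<in>S. N ^ (card Ed - 1))" using card_class by (intro sum_mono) auto
  also have "\<dots> = card S * N ^ (card Ed - 1)" by simp
  also have "\<dots> < N * N ^ (card Ed - 1)" using S(2) by simp
  also have "\<dots> = N ^ card Ed"
  proof -
    have "card Ed \<noteq> 0" using \<epsilon> Ed by auto
    then show ?thesis by (cases "card Ed") simp_all
  qed
  finally show False using Ed by (simp add: card_PiE)
qed

definition edge_labels :: "nat set \<Rightarrow> (nat \<times> nat) set \<Rightarrow> nat set set" where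
  "edge_labels T A = {{u, v} | u v. u \<in> T \<and> v \<in> T \<and> (u, v) \<in> A}"

text \<open>
  The copies of a vertex of \<open>T\<close> are labelled by the points of a cube with one coordinate for each edge
  inside \<open>T\<close>. The copies of a vertex of \<open>J\<close> only need \<open>t\<close> different labels; constant functions
  are used so that both kinds of labels have the same type.
\<close>

definition lift_labels :: "nat set \<Rightarrow> (nat \<times> nat) set \<Rightarrow> nat \<Rightarrow> nat \<Rightarrow> nat \<Rightarrow> (nat set \<Rightarrow> nat) set" where
  "lift_labels T A N t u = (if u \<in> T then edge_labels T A \<rightarrow>\<^sub>E {..<N} else (\<lambda>c _. c) ` {..<t})"

definition lift_edges ::
  "nat set \<Rightarrow> nat set \<Rightarrow> (nat \<times> nat) set \<Rightarrow> nat \<Rightarrow> nat \<Rightarrow> ((nat \<times> (nat set \<Rightarrow> nat)) \<times> (nat \<times> (nat set \<Rightarrow> nat))) set" where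
  "lift_edges T J A N t = {((u, x), (v, y)). u \<in> T \<union> J \<and> v \<in> T \<union> J \<and> x \<in> lift_labels T A N t u \<and>
     y \<in> lift_labels T A N t v \<and> (u, v) \<in> A \<and>
     (u \<in> T \<and> v \<in> T \<longrightarrow> (\<forall>e\<in>edge_labels T A. x e = y e \<longleftrightarrow> e \<noteq> {u, v}))}"

text \<open>
  A closed walk of odd length at most \<open>m\<close> projects to a cycle of length \<open>m\<close> inside \<open>T\<close>. It traverses
  its first edge only once, so the coordinate of the label at this edge changes in the first step and
  never again, and the labels cannot match at the end.
\<close>

lemma lift_no_odd_closed_walk:
  assumes odd: "no_odd_closed_walk A (m - 1)" and m: "odd m" "m \<ge> 3"
    and inT: "\<And>w i. (\<And>i. i < m \<Longrightarrow> (w i, w (Suc i)) \<in> A) \<Longrightarrow> w m = w 0 \<Longrightarrow> i < m \<Longrightarrow> w i \<in> T"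
  shows "no_odd_closed_walk (lift_edges T J A N t) m"
  unfolding no_odd_closed_walk_def
proof (intro allI impI notI, elim conjE)
  fix l p assume l: "odd l" "l \<le> m" and walk: "(p, p) \<in> lift_edges T J A N t ^^ l"
  have proj: "(fst u, fst v) \<in> A" if "(u, v) \<in> lift_edges T J A N t" for u v
    using that by (cases u; cases v) (simp add: lift_edges_def)
  have "(fst p, fst p) \<in> A ^^ l" by (rule relpow_hom[where f = fst, OF proj walk])
  from no_odd_closed_walkD[OF odd this l(1)] have "\<not> l \<le> m - 1" by blast
  with l(2) have lm: "l = m" by linarith
  obtain W where W: "W 0 = p" "W m = p" "\<And>i. i < m \<Longrightarrow> (W i, W (Suc i)) \<in> lift_edges T J A N t"
    using relpow_walk[OF walk[unfolded lm]] by metis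
  define w where "w i = fst (W i)" for i
  define x where "x i = snd (W i)" for i
  have wA: "(w i, w (Suc i)) \<in> A" if "i < m" for i
    unfolding w_def by (rule proj[OF W(3)[OF that]])
  have wc: "w m = w 0" and xc: "x m = x 0" using W(1,2) by (simp_all add: w_def x_def)
  have inj: "inj_on w {..<m}" by (rule shortest_odd_closed_walk_inj[OF odd m(1) wA wc])
  have wT': "w i \<in> T" if "i < m" for i by (rule inT[OF wA wc that])
  have wT: "w i \<in> T" if "i \<le> m" for i
    using wT'[of i] wT'[of 0] that wc m(2) by (cases "i = m") simp_all
  have change: "x i e = x (Suc i) e \<longleftrightarrow> e \<noteq> {w i, w (Suc i)}" if "i < m" "e \<in> edge_labels T A" for i e
  proof -
    have "((w i, x i), (w (Suc i), x (Suc i))) \<in> lift_edges T J A N t"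
      using W(3)[OF that(1)] by (simp add: w_def x_def)
    then have "\<forall>e\<in>edge_labels T A. x i e = x (Suc i) e \<longleftrightarrow> e \<noteq> {w i, w (Suc i)}"
      using wT[of i] wT[of "Suc i"] that(1) unfolding lift_edges_def by simp
    then show ?thesis using that(2) by (rule bspec)
  qed
  define e where "e = {w 0, w (Suc 0)}"
  have eE: "e \<in> edge_labels T A" using wT[of 0] wT[of 1] wA[of 0] m(2) by (auto simp: e_def edge_labels_def)
  have "x (Suc 0) e = x i e" if "1 \<le> i" "i \<le> m" for i using that
  proof (induction i rule: dec_induct)
    case (step j)
    have "w j \<noteq> w 0" using inj_onD[OF inj, of j 0] step.hyps step.prems by auto
    moreover have "w (Suc j) \<noteq> w 0 \<or> w j \<noteq> w (Suc 0)"
    proof (cases "Suc j = m")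
      case True
      then show ?thesis using inj_onD[OF inj, of j "Suc 0"] step.hyps m(2) by auto
    next
      case False
      then show ?thesis using inj_onD[OF inj, of "Suc j" 0] step.prems by auto
    qed
    ultimately have "e \<noteq> {w j, w (Suc j)}" unfolding e_def by (auto simp: doubleton_eq_iff)
    then show ?case using step.IH step.prems change[of j e] eE by auto
  qed simp
  from this[of m] have "x (Suc 0) e = x 0 e" using xc m(2) by simp
  then show False using change[of 0 e] eE m(2) by (simp add: e_def)
qed

text \<open>
  With \<open>t\<close> large the lift has about \<open>card J * t\<close> vertices and minimum degree at least \<open>t\<close>, because every
  vertex of the finite graph has a neighbour in \<open>J\<close>. A homomorphism to a graph on at most \<open>b\<close> vertices
  colours the points of the cube by the tuple of images of all vertices of \<open>T\<close> with this
  label; for \<open>N > b ^ card T\<close> there is a colour \<open>s\<close> as in \<open>monochromatic_pairs\<close>, and \<open>s\<close> is a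
  homomorphism from \<open>T\<close>.
\<close>

lemma lift_lower_bound:
  fixes T J :: "nat set" and A :: "(nat \<times> nat) set"
  assumes fin: "finite T" "finite J" and TJ: "T \<inter> J = {}" "J \<noteq> {}"
    and A: "A \<subseteq> (T \<union> J) \<times> (T \<union> J)" "sym A"
    and odd: "no_odd_closed_walk A (m - 1)" and m: "odd m" "m \<ge> 3"
    and inT: "\<And>w i. (\<And>i. i < m \<Longrightarrow> (w i, w (Suc i)) \<in> A) \<Longrightarrow> w m = w 0 \<Longrightarrow> i < m \<Longrightarrow> w i \<in> T"
    and nbrJ: "\<And>v. v \<in> T \<union> J \<Longrightarrow> \<exists>j\<in>J. (v, j) \<in> A"
    and nohom: "\<And>H f. pair_graph H \<Longrightarrow> family_free \<F>2 H \<Longrightarrow>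
       (\<And>u v. (u, v) \<in> A \<Longrightarrow> u \<in> T \<Longrightarrow> v \<in> T \<Longrightarrow> (f u, f v) \<in> parcs H) \<Longrightarrow> False"
  shows "ereal (1 / real (card J)) \<le> delta_hom (odd_cycles m) \<F>2"
proof (rule delta_hom_geI)
  let ?J = "real (card J)"
  fix \<alpha> assume less: "\<alpha> < 1 / ?J" and adm: "\<forall>\<epsilon>>0. \<exists>b n0 :: nat. \<forall>G. pair_graph G \<and>
     card (pverts G) \<ge> n0 \<and> family_free (odd_cycles m) G \<and>
     real (min_degree G) \<ge> (\<alpha> + \<epsilon>) * real (card (pverts G)) \<longrightarrow>
     (\<exists>H f. pair_graph H \<and> card (pverts H) \<le> b \<and> family_free \<F>2 H \<and> graph_hom f G H)"
  have J0: "card J > 0" using TJ(2) fin(2) by (simp add: card_gt_0_iff)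
  define \<gamma> where "\<gamma> = (\<alpha> + 1 / ?J) / 2"
  have \<gamma>: "\<alpha> < \<gamma>" "\<gamma> < 1 / ?J" using less by (simp_all add: \<gamma>_def field_simps)
  then have \<gamma>J: "\<gamma> * ?J < 1" using J0 by (simp add: field_simps)
  obtain b n0 :: nat where bn: "\<And>G. pair_graph G \<Longrightarrow> card (pverts G) \<ge> n0 \<Longrightarrow> family_free (odd_cycles m) G \<Longrightarrow>
     real (min_degree G) \<ge> \<gamma> * real (card (pverts G)) \<Longrightarrow>
     (\<exists>H f. pair_graph H \<and> card (pverts H) \<le> b \<and> family_free \<F>2 H \<and> graph_hom f G H)"
  proof -
    have "\<gamma> - \<alpha> > 0" "\<alpha> + (\<gamma> - \<alpha>) = \<gamma>" using \<gamma>(1) by simp_all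
    from adm[rule_format, OF this(1), unfolded this(2)] obtain b n0 :: nat where
      "\<forall>G. pair_graph G \<and> card (pverts G) \<ge> n0 \<and> family_free (odd_cycles m) G \<and>
        real (min_degree G) \<ge> \<gamma> * real (card (pverts G)) \<longrightarrow>
        (\<exists>H f. pair_graph H \<and> card (pverts H) \<le> b \<and> family_free \<F>2 H \<and> graph_hom f G H)"
      by (elim exE)
    then show thesis by (intro that[of n0 b]) (metis (mono_tags))
  qed
  let ?Ed = "edge_labels T A"
  have "?Ed \<subseteq> Pow T" by (auto simp: edge_labels_def)
  then have finE: "finite ?Ed" using fin(1) finite_subset by blast
  define N where "N = b ^ card T + 1"
  let ?X = "?Ed \<rightarrow>\<^sub>E {..<N}"
  have finX: "finite ?X" using finE by (intro finite_PiE) auto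
  define c0 where "c0 = real (card T * card ?X)"
  obtain t :: nat where t: "real t \<ge> max (real n0) (\<gamma> * c0 / (1 - \<gamma> * ?J))"
    using real_arch_simple by blast
  have "\<gamma> * c0 / (1 - \<gamma> * ?J) \<le> real t" using t by simp
  then have "\<gamma> * c0 \<le> real t * (1 - \<gamma> * ?J)" using \<gamma>J by (simp add: pos_divide_le_eq)
  then have t2: "\<gamma> * (c0 + ?J * real t) \<le> real t" by (simp add: algebra_simps)
  let ?L = "lift_labels T A N t"
  define V where "V = Sigma (T \<union> J) ?L"
  define EE where "EE = lift_edges T J A N t"
  have cardL: "card (?L u) = (if u \<in> T then card ?X else t)" for u
    by (auto simp: lift_labels_def card_image inj_on_def fun_eq_iff)
  have finL: "finite (?L u)" for u using finX by (simp add: lift_labels_def)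
  have finV: "finite V" unfolding V_def using fin finL by blast
  have "card V = (\<Sum>u\<in>T \<union> J. card (?L u))" unfolding V_def using fin finL by (intro card_SigmaI) auto
  also have "\<dots> = (\<Sum>u\<in>T. card (?L u)) + (\<Sum>u\<in>J. card (?L u))" using fin TJ(1) by (rule sum.union_disjoint)
  also have "(\<Sum>u\<in>J. card (?L u)) = (\<Sum>u\<in>J. t)" using TJ(1) by (intro sum.cong) (auto simp: cardL)
  finally have cardV: "card V = card T * card ?X + card J * t" by (simp add: cardL)
  have EEV: "EE \<subseteq> V \<times> V" by (auto simp: EE_def V_def lift_edges_def)
  have symEE: "sym EE" using A(2) by (auto intro!: symI simp: EE_def lift_edges_def insert_commute dest: symD)
  have noEE: "no_odd_closed_walk EE m" unfolding EE_def
  proof (rule lift_no_odd_closed_walk[OF odd m])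
    show "w i \<in> T" if "\<And>i. i < m \<Longrightarrow> (w i, w (Suc i)) \<in> A" "w m = w 0" "i < m" for w i
      using that by (rule inT)
  qed
  have irEE: "irrefl EE"
  proof (rule irreflI)
    fix p show "(p, p) \<notin> EE" using no_odd_closed_walkD[OF noEE, of p 1] m(2) by auto
  qed
  obtain \<phi> where \<phi>: "bij_betw \<phi> V {0..<card V}" using ex_bij_betw_finite_nat[OF finV] by blast
  have inj\<phi>: "inj_on \<phi> V" using \<phi> by (rule bij_betw_imp_inj_on)
  define G where "G = \<lparr> pverts = \<phi> ` V, parcs = map_prod \<phi> \<phi> ` EE \<rparr>"
  have arcG: "(\<phi> p, \<phi> q) \<in> parcs G" if "(p, q) \<in> EE" for p q using that by (force simp: G_def)
  have G: "pair_graph G" unfolding G_def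
  proof (rule pair_graphI)
    show "finite (\<phi> ` V)" using finV by simp
    show "map_prod \<phi> \<phi> ` EE \<subseteq> \<phi> ` V \<times> \<phi> ` V" using EEV by auto
    show "sym (map_prod \<phi> \<phi> ` EE)" using symEE by (force simp: sym_def)
    show "irrefl (map_prod \<phi> \<phi> ` EE)"
    proof (rule irreflI, rule notI)
      fix a assume "(a, a) \<in> map_prod \<phi> \<phi> ` EE"
      then obtain p q where pq: "(p, q) \<in> EE" "\<phi> p = \<phi> q" by auto
      then have "p = q" using inj_onD[OF inj\<phi>] EEV by blast
      then show False using pq(1) irreflD[OF irEE, of q] by blast
    qed
  qed
  have "no_odd_closed_walk (parcs G) m" unfolding no_odd_closed_walk_def
  proof (intro allI impI notI, elim conjE)
    fix l a assume l: "odd l" "l \<le> m" and walk: "(a, a) \<in> parcs G ^^ l"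
    have "(inv_into V \<phi> a, inv_into V \<phi> a) \<in> EE ^^ l"
    proof (rule relpow_hom[where f = "inv_into V \<phi>", OF _ walk])
      fix a b assume "(a, b) \<in> parcs G"
      then obtain p q where pq: "(p, q) \<in> EE" "a = \<phi> p" "b = \<phi> q" by (auto simp: G_def)
      then have "inv_into V \<phi> a = p" "inv_into V \<phi> b = q" using EEV inj\<phi> by auto
      then show "(inv_into V \<phi> a, inv_into V \<phi> b) \<in> EE" using pq(1) by simp
    qed
    from no_odd_closed_walkD[OF noEE this l] show False .
  qed
  then have ffG: "family_free (odd_cycles m) G" using family_free_odd_cycles_iff[OF G] by blast
  have cardG: "card (pverts G) = card V" using card_image[OF inj\<phi>] by (simp add: G_def)
  have "t \<le> card J * t" using J0 by simp
  then have tV: "t \<le> card V" unfolding cardV by linarith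
  have "t \<le> min_degree G" if "t > 0"
  proof (rule min_degree_ge[OF G])
    show "pverts G \<noteq> {}" using tV that cardG by auto
  next
    fix a assume "a \<in> pverts G"
    then obtain u x where ux: "(u, x) \<in> V" "a = \<phi> (u, x)" by (auto simp: G_def)
    then obtain j where j: "j \<in> J" "(u, j) \<in> A" using nbrJ[of u] by (auto simp: V_def)
    have jT: "j \<notin> T" using j TJ by auto
    have sub: "Pair j ` ?L j \<subseteq> V" using j by (auto simp: V_def)
    have "((u, x), (j, c)) \<in> EE" if "c \<in> ?L j" for c
      using that ux(1) j jT by (auto simp: EE_def lift_edges_def V_def)
    then have "\<phi> ` (Pair j ` ?L j) \<subseteq> parcs G `` {a}" using arcG ux(2) by auto
    moreover have "finite (parcs G `` {a})"
    proof (rule finite_subset)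
      show "parcs G `` {a} \<subseteq> \<phi> ` V" using EEV by (auto simp: G_def)
    qed (use finV in simp)
    ultimately have "card (\<phi> ` (Pair j ` ?L j)) \<le> card (parcs G `` {a})" by (intro card_mono)
    moreover have "card (\<phi> ` (Pair j ` ?L j)) = t"
      using inj_on_subset[OF inj\<phi> sub] jT by (simp add: card_image inj_on_def cardL)
    ultimately show "t \<le> card (parcs G `` {a})" by simp
  qed
  then have "real t \<le> real (min_degree G)" by (cases "t = 0") auto
  moreover have "\<gamma> * real (card V) \<le> real t" using t2 unfolding cardV c0_def by simp
  ultimately have "\<gamma> * real (card (pverts G)) \<le> real (min_degree G)" unfolding cardG by linarith
  moreover have "n0 \<le> card (pverts G)" using t tV cardG by simp
  ultimately obtain H f where H: "pair_graph H" "card (pverts H) \<le> b" "family_free \<F>2 H" "graph_hom f G H"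
    using bn[OF G _ ffG] by blast
  interpret H: pair_graph H by fact
  define \<kappa> where "\<kappa> x = restrict (\<lambda>u. f (\<phi> (u, x))) T" for x
  have "\<exists>s. \<forall>e\<in>?Ed. \<exists>x\<in>?X. \<exists>y\<in>?X. \<kappa> x = s \<and> \<kappa> y = s \<and> (\<forall>e'\<in>?Ed. x e' = y e' \<longleftrightarrow> e' \<noteq> e)"
  proof (rule monochromatic_pairs[OF finE])
    show "finite (T \<rightarrow>\<^sub>E pverts H)" using fin(1) H.pair_finite_verts by (intro finite_PiE) auto
    show "card (T \<rightarrow>\<^sub>E pverts H) < N"
      using fin(1) H(2) by (simp add: card_PiE N_def less_Suc_eq_le power_mono)
    fix x assume x: "x \<in> ?X"
    have "f (\<phi> (u, x)) \<in> pverts H" if "u \<in> T" for u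
      using H(4) that x by (auto simp: graph_hom_def G_def V_def lift_labels_def)
    then show "\<kappa> x \<in> T \<rightarrow>\<^sub>E pverts H" by (auto simp: \<kappa>_def)
  qed
  then obtain s where s: "\<forall>e\<in>?Ed. \<exists>x\<in>?X. \<exists>y\<in>?X. \<kappa> x = s \<and> \<kappa> y = s \<and> (\<forall>e'\<in>?Ed. x e' = y e' \<longleftrightarrow> e' \<noteq> e)"
    by (elim exE)
  show False
  proof (rule nohom[OF H(1,3)])
    fix u v assume uv: "(u, v) \<in> A" "u \<in> T" "v \<in> T"
    then have "{u, v} \<in> ?Ed" by (auto simp: edge_labels_def)
    from bspec[OF s this] obtain x y where x: "x \<in> ?X" and y: "y \<in> ?X"
      and "\<kappa> x = s \<and> \<kappa> y = s \<and> (\<forall>e'\<in>?Ed. x e' = y e' \<longleftrightarrow> e' \<noteq> {u, v})"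
      by (elim bexE)
    then have xy: "\<forall>e'\<in>?Ed. x e' = y e' \<longleftrightarrow> e' \<noteq> {u, v}" "\<kappa> x = s" "\<kappa> y = s" by simp_all
    have "((u, x), (v, y)) \<in> EE" using uv x y xy(1) by (simp add: EE_def lift_edges_def lift_labels_def)
    from arcG[OF this] have "(f (\<phi> (u, x)), f (\<phi> (v, y))) \<in> parcs H" using H(4) by (auto simp: graph_hom_def)
    moreover have "s u = f (\<phi> (u, x))" "s v = f (\<phi> (v, y))" using fun_cong[OF xy(2), of u] fun_cong[OF xy(3), of v] uv by (simp_all add: \<kappa>_def)
    ultimately show "(s u, s v) \<in> parcs H" by simp
  qed
qed

text \<open>
  A criterion for the hypotheses of \<open>lift_lower_bound\<close>. A closed walk of length \<open>m\<close> has pairwise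
  distinct images under \<open>\<pi>\<close>, so it cannot visit a vertex all of whose neighbours have the same
  image (a vertex of \<open>F\<close>). A vertex all of whose neighbours outside \<open>F\<close> have the same image
  is then avoided as well.
\<close>

lemma closed_walks_avoid_folded:
  fixes A :: "('a \<times> 'a) set" and B :: "('b \<times> 'b) set"
  assumes hom: "\<And>u v. (u, v) \<in> A \<Longrightarrow> (\<pi> u, \<pi> v) \<in> B" and B: "no_odd_closed_walk B (m - 1)"
    and m: "odd m" "m \<ge> 3" and A: "A \<subseteq> (T \<union> J) \<times> (T \<union> J)" "sym A"
    and fold1: "\<And>v a b. v \<in> F \<Longrightarrow> (v, a) \<in> A \<Longrightarrow> (v, b) \<in> A \<Longrightarrow> \<pi> a = \<pi> b"
    and fold2: "\<And>v a b. v \<in> J - F \<Longrightarrow> (v, a) \<in> A \<Longrightarrow> (v, b) \<in> A \<Longrightarrow> a \<notin> F \<Longrightarrow> b \<notin> F \<Longrightarrow> \<pi> a = \<pi> b"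
  shows "no_odd_closed_walk A (m - 1)"
    and "\<forall>w. (\<forall>i<m. (w i, w (Suc i)) \<in> A) \<and> w m = w 0 \<longrightarrow> (\<forall>i<m. w i \<in> T)"
proof -
  show "no_odd_closed_walk A (m - 1)" unfolding no_odd_closed_walk_def
  proof (intro allI impI notI, elim conjE)
    fix l v assume l: "odd l" "l \<le> m - 1" and "(v, v) \<in> A ^^ l"
    then have "(\<pi> v, \<pi> v) \<in> B ^^ l" using relpow_hom[where f = \<pi>, OF hom] by metis
    from no_odd_closed_walkD[OF B this l] show False .
  qed
next
  have "w i \<in> T" if w: "\<And>i. i < m \<Longrightarrow> (w i, w (Suc i)) \<in> A" "w m = w 0" and i: "i < m" for w i
  proof -
  have inj: "inj_on (\<lambda>i. \<pi> (w i)) {..<m}"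
    by (rule shortest_odd_closed_walk_inj[OF B m(1)]) (simp_all add: hom w)
  have symA: "(a, b) \<in> A \<Longrightarrow> (b, a) \<in> A" for a b using A(2) by (meson symE)
  have two: "\<exists>p q. p < m \<and> q < m \<and> p \<noteq> q \<and> (w j, w p) \<in> A \<and> (w j, w q) \<in> A" if j: "j < m" for j
  proof -
    define p where "p = (if j = 0 then m - 1 else j - 1)"
    define q where "q = (if Suc j = m then 0 else Suc j)"
    have "(w p, w j) \<in> A" using w(1)[of p] w(2) j m(2) by (auto simp: p_def split: if_splits)
    moreover have "(w j, w q) \<in> A" using w(1)[OF j] w(2) by (auto simp: q_def)
    moreover have "p < m" "q < m" "p \<noteq> q" using j m(2) by (auto simp: p_def q_def)
    ultimately show ?thesis using symA by blast
  qed
  have notF: "w j \<notin> F" if j: "j < m" for j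
  proof
    assume F: "w j \<in> F"
    obtain p q where pq: "p < m" "q < m" "p \<noteq> q" "(w j, w p) \<in> A" "(w j, w q) \<in> A" using two[OF j] by blast
    then show False using fold1[OF F pq(4,5)] inj_onD[OF inj] by auto
  qed
  have "w i \<notin> J"
  proof
    assume J: "w i \<in> J"
    obtain p q where pq: "p < m" "q < m" "p \<noteq> q" "(w i, w p) \<in> A" "(w i, w q) \<in> A" using two[OF i] by blast
    have "\<pi> (w p) = \<pi> (w q)" by (rule fold2[OF _ pq(4,5)]) (use J notF i pq in auto)
    then show False using pq inj_onD[OF inj] by auto
  qed
  then show "w i \<in> T" using w(1)[OF i] A(1) by auto
  qed
  then show "\<forall>w. (\<forall>i<m. (w i, w (Suc i)) \<in> A) \<and> w m = w 0 \<longrightarrow> (\<forall>i<m. w i \<in> T)" by blast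
qed

text \<open>
  Unrolling the cycle onto the integers: a walk of length \<open>l\<close> moves by an integer \<open>z\<close> with \<open>|z| \<le> l\<close>
  and the parity of \<open>l\<close>, and it is closed only if \<open>m\<close> divides \<open>z\<close>.
\<close>

lemma cycle_no_odd_closed_walk: "no_odd_closed_walk (parcs (cycle_graph m)) (m - 1)"
  unfolding no_odd_closed_walk_def
proof (intro allI impI notI, elim conjE)
  fix l v assume l: "odd l" "l \<le> m - 1" and walk: "(v, v) \<in> parcs (cycle_graph m) ^^ l"
  have "\<exists>z::int. \<bar>z\<bar> \<le> int l \<and> even (z + int l) \<and> int m dvd int y - int x - z"
    if "(x, y) \<in> parcs (cycle_graph m) ^^ l" for x y l
    using that
  proof (induction l arbitrary: y)
    case 0
    then show ?case by (intro exI[of _ 0]) simp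
  next
    case (Suc l)
    then obtain y' where y': "(x, y') \<in> parcs (cycle_graph m) ^^ l" "(y', y) \<in> parcs (cycle_graph m)" by auto
    obtain z where z: "\<bar>z\<bar> \<le> int l" "even (z + int l)" "int m dvd int y' - int x - z"
      using Suc.IH[OF y'(1)] by blast
    have "\<exists>d::int. \<bar>d\<bar> = 1 \<and> int m dvd int y - int y' - d"
    proof (cases "y = (y' + 1) mod m")
      case True
      have "int m dvd (int y' + 1) mod int m - (int y' + 1)"
        using mod_eq_dvd_iff[of "(int y' + 1) mod int m" "int m" "int y' + 1"] by simp
      then show ?thesis using True by (intro exI[of _ 1]) (simp add: of_nat_mod algebra_simps)
    next
      case False
      then have y: "y' = (y + 1) mod m" using y'(2) by (auto simp: cycle_graph_def)
      have "int m dvd (int y + 1) mod int m - (int y + 1)"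
        using mod_eq_dvd_iff[of "(int y + 1) mod int m" "int m" "int y + 1"] by simp
      then have "int m dvd - ((int y + 1) mod int m - (int y + 1))" by (rule dvd_minus_iff[THEN iffD2])
      then show ?thesis using y by (intro exI[of _ "-1"]) (simp add: of_nat_mod algebra_simps)
    qed
    then obtain d :: int where d: "\<bar>d\<bar> = 1" "int m dvd int y - int y' - d" by blast
    have "int m dvd (int y' - int x - z) + (int y - int y' - d)" using z(3) d(2) by (rule dvd_add)
    then have "int m dvd int y - int x - (z + d)" by (simp add: algebra_simps)
    moreover have "\<bar>z + d\<bar> \<le> int (Suc l)" using z(1) d(1) by simp
    moreover have "even (z + d + int (Suc l))" using z(2) d(1) by (cases "d = 1") (auto simp: abs_if split: if_splits)
    ultimately show ?case by blast
  qed
  from this[OF walk] obtain z :: int where z: "\<bar>z\<bar> \<le> int l" "even (z + int l)" "int m dvd - z" by auto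
  then have "z \<noteq> 0" using l(1) by auto
  then have "int m \<le> \<bar>z\<bar>" using dvd_imp_le_int[OF _ z(3)] by simp
  then show False using z(1) l odd_pos[OF l(1)] by linarith
qed

text \<open>
  Here \<open>T\<close> is the cycle on \<open>{..<m}\<close>, each vertex \<open>u\<close> has a private partner \<open>m + u\<close> in \<open>J\<close>, and \<open>J\<close>
  carries just enough edges to leave no vertex isolated: the path on \<open>m, m + 1, m + 2\<close> and a
  perfect matching of the rest by edges joining consecutive numbers (\<open>m\<close> is odd). The map \<open>\<pi>\<close> sends
  \<open>m + i\<close> to a neighbour of \<open>i\<close> on the cycle, chosen such that all neighbours of \<open>m + i\<close> are mapped
  to \<open>i\<close>. Only the end \<open>m + 2\<close> of the path does not fit; its only neighbour
  outside \<open>F\<close> is \<open>2\<close>. Any homomorphic image of the cycle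
  contains a closed walk of length \<open>m\<close>.
\<close>

lemma odd_cycles_lower_bound:
  assumes m: "odd m" "m \<ge> 5"
  shows "ereal (1 / real m) \<le> delta_hom (odd_cycles m) (odd_cycles m)"
proof -
  define T J where "T = {..<m}" and "J = {m..<2 * m}"
  define A0 where "A0 = {(u, (u + 1) mod m) | u. u < m} \<union> {(u, u + m) | u. u < m} \<union>
    {(m + i, m + i + 1) | i. i + 1 < m \<and> (i = 0 \<or> odd i)}"
  define A where "A = A0 \<union> A0\<inverse>"
  define \<pi> where "\<pi> v = (if v < m then v else if v = m + 1 then 0
     else if v = m \<or> odd (v - m) then v - m + 1 else v - m - 1)" for v
  define F where "F = J - {m + 2}"
  have AV: "A \<subseteq> (T \<union> J) \<times> (T \<union> J)" using m by (auto simp: A_def A0_def T_def J_def)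
  have symA: "sym A" by (auto simp: A_def sym_def)
  have hom0: "(\<pi> u, \<pi> v) \<in> parcs (cycle_graph m)" if uv: "(u, v) \<in> A0" for u v
  proof -
    consider "u < m" "v = (u + 1) mod m" | "u < m" "v = u + m"
      | i where "u = m + i" "v = m + i + 1" "i + 1 < m" "i = 0 \<or> odd i"
      using uv by (auto simp: A0_def)
    then show ?thesis
    proof cases
      case 1
      then show ?thesis using m by (auto simp: \<pi>_def cycle_graph_def)
    next
      case 2
      have "u + 1 < m" if "odd u" using 2 m that by presburger
      then show ?thesis using 2 m by (auto simp: \<pi>_def cycle_graph_def elim!: evenE)
    next
      case 3
      then show ?thesis using 3 m by (auto simp: \<pi>_def cycle_graph_def)
    qed
  qed
  have "parcs (cycle_graph m) = (parcs (cycle_graph m))\<inverse>" by (auto simp: cycle_graph_def)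
  then have hom: "(\<pi> u, \<pi> v) \<in> parcs (cycle_graph m)" if "(u, v) \<in> A" for u v
    using that hom0 unfolding A_def by blast
  have nbr: "\<pi> a = i \<or> i = 2 \<and> a \<in> F" if edge: "(m + i, a) \<in> A" for i a
  proof -
    have i: "i < m" using edge AV m by (auto simp: T_def J_def)
    have "a = i \<or> (a = m + i + 1 \<and> i + 1 < m \<and> (i = 0 \<or> odd i)) \<or> (i > 0 \<and> a = m + (i - 1) \<and> (i = 1 \<or> odd (i - 1)))"
    proof -
      have "m + i \<noteq> Suc a mod m" using mod_less_divisor[of m "Suc a"] m by linarith
      then show ?thesis using edge i by (auto simp: A_def A0_def)
    qed
    then consider "a = i" | "a = m + i + 1" "i + 1 < m" "i = 0" | "a = m + i + 1" "i + 1 < m" "odd i"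
      | "i = 1" "a = m" | "i > 0" "even i" "a = m + (i - 1)" by auto
    then show ?thesis
    proof cases
      case 5
      then show ?thesis using i m by (cases "i = 2") (auto simp: \<pi>_def F_def J_def)
    qed (use i m in \<open>auto simp: \<pi>_def\<close>)
  qed
  have "ereal (1 / real (card J)) \<le> delta_hom (odd_cycles m) (odd_cycles m)"
  proof (rule lift_lower_bound[where T = T and A = A])
    show "no_odd_closed_walk A (m - 1)"
      and "\<And>w i. (\<And>i. i < m \<Longrightarrow> (w i, w (Suc i)) \<in> A) \<Longrightarrow> w m = w 0 \<Longrightarrow> i < m \<Longrightarrow> w i \<in> T"
    proof -
      have 1: "\<pi> a = \<pi> b" if "v \<in> F" "(v, a) \<in> A" "(v, b) \<in> A" for v a b
        using nbr[of "v - m" a] nbr[of "v - m" b] that by (auto simp: F_def J_def)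
      have 2: "\<pi> a = \<pi> b" if "v \<in> J - F" "(v, a) \<in> A" "(v, b) \<in> A" "a \<notin> F" "b \<notin> F" for v a b
        using nbr[of "v - m" a] nbr[of "v - m" b] that by (auto simp: F_def J_def)
      have m3: "m \<ge> 3" using m by simp
      note * = closed_walks_avoid_folded[where \<pi> = \<pi> and F = F, OF hom cycle_no_odd_closed_walk m(1) m3 AV symA 1 2]
      show "no_odd_closed_walk A (m - 1)" by (rule *(1))
      show "w i \<in> T" if "\<And>i. i < m \<Longrightarrow> (w i, w (Suc i)) \<in> A" "w m = w 0" "i < m" for w i
        using *(2) that by simp
    qed
  next
    fix v assume v: "v \<in> T \<union> J"
    show "\<exists>j\<in>J. (v, j) \<in> A"
    proof (cases "v < m")
      case True
      then show ?thesis by (intro bexI[of _ "v + m"]) (auto simp: A_def A0_def J_def)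
    next
      case False
      define i where "i = v - m"
      have i: "v = m + i" "i < m" using v False by (auto simp: T_def J_def i_def)
      show ?thesis
      proof (cases "i = 0 \<or> odd i")
        case True
        then have "i + 1 < m" using i m by (cases "i = 0") (auto, presburger)
        then show ?thesis using True i by (intro bexI[of _ "m + i + 1"]) (auto simp: A_def A0_def J_def)
      next
        case F: False
        then have "(m + (i - 1), m + (i - 1) + 1) \<in> A0" using i unfolding A0_def by fastforce
        then show ?thesis using F i by (intro bexI[of _ "m + (i - 1)"]) (auto simp: A_def J_def)
      qed
    qed
  next
    fix H f assume H: "pair_graph H" "family_free (odd_cycles m) H"
      and f: "\<And>u v. (u, v) \<in> A \<Longrightarrow> u \<in> T \<Longrightarrow> v \<in> T \<Longrightarrow> (f u, f v) \<in> parcs H"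
    have "(f (i mod m), f (Suc i mod m)) \<in> parcs H" if "i < m" for i
    proof (rule f)
      have "(i mod m, Suc i mod m) \<in> A0" using that unfolding A0_def by auto
      then show "(i mod m, Suc i mod m) \<in> A" by (simp add: A_def)
    qed (use m in \<open>auto simp: T_def\<close>)
    then have "(f (0 mod m), f (m mod m)) \<in> parcs H ^^ (m - 0)"
      by (intro relpow_of_fun) auto
    then show False using family_free_odd_cycles_iff[OF H(1)] H(2) no_odd_closed_walkD[of _ m _ m] m(1) by auto
  qed (use m AV symA in \<open>auto simp: T_def J_def\<close>)
  then show ?thesis by (simp add: J_def)
qed

section \<open>A chromatic lower bound from chains over the two-element field\<close>

text \<open>
  Sums over \<^typ>\<open>bit\<close> are to be treated as sums in a ring, not as exclusive disjunctions.
\<close>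

declare add_bit_eq_xor [simp del]

lemma bit_double [simp]: "(x::bit) + x = 0"
  by (cases x) auto

text \<open>
  Chains over the field with two elements are represented as lists of simplices, a simplex being the
  list of its vertices, and are used only through the sums of functions over them. The boundary
  operator is therefore given in dual form: \<open>coboundary F \<sigma>\<close> is the sum of \<open>F\<close> over the lists that
  arise from \<open>\<sigma>\<close> by deleting one entry.
\<close>

primrec coboundary :: "('a list \<Rightarrow> bit) \<Rightarrow> 'a list \<Rightarrow> bit" where
  "coboundary F [] = 0"
| "coboundary F (x # xs) = F xs + coboundary (\<lambda>ys. F (x # ys)) xs"

lemma coboundary_add: "coboundary (\<lambda>ys. F ys + G ys) xs = coboundary F xs + coboundary G xs"
  by (induction xs arbitrary: F G) (simp_all add: algebra_simps)

lemma coboundary_zero [simp]: "coboundary (\<lambda>ys. 0) xs = 0"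
  by (induction xs) simp_all

lemma coboundary_map: "coboundary F (map f xs) = coboundary (\<lambda>ys. F (map f ys)) xs"
  by (induction xs arbitrary: F) simp_all

text \<open>
  The standard decomposition of a prism over a simplex, with the two ends embedded by \<open>f\<close> and \<open>g\<close>;
  \<open>coboundary_prism\<close> states that it is a chain homotopy between \<open>f\<close> and \<open>g\<close>.
\<close>

primrec prism :: "('a \<Rightarrow> 'b) \<Rightarrow> ('a \<Rightarrow> 'b) \<Rightarrow> 'a list \<Rightarrow> 'b list list" where
  "prism f g [] = []"
| "prism f g (x # xs) = (f x # g x # map g xs) # map ((#) (f x)) (prism f g xs)"

lemma sum_list_add: "(\<Sum>x\<leftarrow>xs. f x + g x) = (\<Sum>x\<leftarrow>xs. f x) + (\<Sum>x\<leftarrow>xs. (g x :: bit))"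
  by (induction xs) (simp_all add: algebra_simps)

lemma coboundary_prism:
  "(\<Sum>\<tau>\<leftarrow>prism f g \<sigma>. coboundary F \<tau>) = F (map f \<sigma>) + F (map g \<sigma>) + coboundary (\<lambda>\<rho>. \<Sum>\<tau>\<leftarrow>prism f g \<rho>. F \<tau>) \<sigma>"
proof (induction \<sigma> arbitrary: F)
  case (Cons x xs)
  have "(\<Sum>\<tau>\<leftarrow>prism f g xs. coboundary F (f x # \<tau>)) =
     (\<Sum>\<tau>\<leftarrow>prism f g xs. F \<tau>) + (\<Sum>\<tau>\<leftarrow>prism f g xs. coboundary (\<lambda>ys. F (f x # ys)) \<tau>)"
    by (simp add: sum_list_add)
  then show ?case
    by (simp add: Cons.IH coboundary_map coboundary_add comp_def algebra_simps)
qed simp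

lemma set_prism:
  "\<tau> \<in> set (prism f g \<sigma>) \<Longrightarrow> set \<tau> \<subseteq> f ` set \<sigma> \<union> g ` set \<sigma> \<and> length \<tau> = Suc (length \<sigma>)"
  by (induction \<sigma> arbitrary: \<tau>) fastforce+

primrec alternating :: "bool \<Rightarrow> nat list \<Rightarrow> bool" where
  "alternating b [] = True"
| "alternating b (x # xs) = (even x = b \<and> alternating (\<not> b) xs)"

text \<open>
  From a word with alternating signs, only the deletion of one of its ends leaves an alternating word,
  and exactly one of the two starts with the sign \<open>b\<close>. In any other word, the deletions that leave an
  alternating word starting with \<open>b\<close> come in pairs.
\<close>

lemma coboundary_alternating:
  "xs \<noteq> [] \<Longrightarrow> coboundary (\<lambda>ys. of_bool (alternating b ys)) xs =
     of_bool (alternating b xs) + of_bool (alternating (\<not> b) xs)"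
proof (induction xs arbitrary: b)
  case (Cons x xs)
  show ?case
  proof (cases "xs = []")
    case False
    show ?thesis using Cons.IH[OF False, of "\<not> b"]
      by (cases "even x = b") (auto simp: algebra_simps)
  qed (cases b, auto)
qed simp

text \<open>
  Indicator of the simplices whose labels are distinct and, in increasing order, alternate
  in sign, starting with the sign \<open>b\<close>. The signed label \<open>\<plusminus> c\<close> is encoded as \<open>2 * c\<close> or \<open>2 * c + 1\<close>,
  so that the parity is the sign and the order is that of the absolute values, unless both signs
  of one label occur.
\<close>

definition fan :: "bool \<Rightarrow> nat list \<Rightarrow> bit" where
  "fan b xs = of_bool (distinct xs \<and> alternating b (sort xs))"

lemma coboundary_mset: "coboundary (\<lambda>ys. g (mset ys)) xs = (\<Sum>y\<in>#mset xs. g (mset xs - {#y#}))"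
proof (induction xs arbitrary: g)
  case (Cons x xs)
  have "(\<Sum>y\<in>#mset xs. g (add_mset x (mset xs) - {#y#})) = (\<Sum>y\<in>#mset xs. g (add_mset x (mset xs - {#y#})))"
    by (intro arg_cong[of _ _ sum_mset] image_mset_cong) (auto simp: diff_union_swap2)
  then show ?case using Cons.IH[of "\<lambda>M. g (add_mset x M)"] by simp
qed simp

lemma coboundary_cong_subseqs:
  "(\<And>ys. ys \<in> set (subseqs xs) \<Longrightarrow> F ys = G ys) \<Longrightarrow> coboundary F xs = coboundary G xs"
proof (induction xs arbitrary: F G)
  case (Cons x xs)
  have "F xs = G xs" using Cons.prems subseqs_refl[of xs] by (simp add: Let_def)
  moreover have "coboundary (\<lambda>ys. F (x # ys)) xs = coboundary (\<lambda>ys. G (x # ys)) xs"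
    by (rule Cons.IH) (use Cons.prems in \<open>simp add: Let_def\<close>)
  ultimately show ?case by simp
qed simp

lemma strict_sorted_subseqs:
  "ys \<in> set (subseqs xs) \<Longrightarrow> sorted_wrt (<) (xs :: nat list) \<Longrightarrow> sorted_wrt (<) ys \<and> set ys \<subseteq> set xs"
  by (induction xs arbitrary: ys) (fastforce simp: Let_def)+

text \<open>
  The identity behind Ky Fan's lemma. It reduces to \<open>coboundary_alternating\<close> by sorting; if an entry is
  repeated, the deletions of its two copies cancel and all others leave the repetition.
\<close>

lemma coboundary_fan:
  assumes "xs \<noteq> []" shows "coboundary (fan b) xs = fan b xs + fan (\<not> b) xs"
proof -
  define g where "g M = (of_bool (distinct (sorted_list_of_multiset M) \<and>
    alternating b (sorted_list_of_multiset M)) :: bit)" for M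
  have fg: "fan b = (\<lambda>ys. g (mset ys))"
    by (auto simp: fan_def g_def fun_eq_iff)
  show ?thesis
  proof (cases "distinct xs")
    case True
    let ?s = "sort xs"
    have ss: "sorted_wrt (<) ?s" using True by (simp add: strict_sorted_iff)
    have "coboundary (fan b) xs = coboundary (fan b) ?s" unfolding fg coboundary_mset by simp
    also have "\<dots> = coboundary (\<lambda>ys. of_bool (alternating b ys)) ?s"
    proof (rule coboundary_cong_subseqs)
      fix ys assume "ys \<in> set (subseqs ?s)"
      then have "sorted_wrt (<) ys" using strict_sorted_subseqs ss by blast
      then have "sorted ys" "distinct ys" by (auto simp: strict_sorted_iff)
      then show "fan b ys = of_bool (alternating b ys)" by (simp add: fan_def sorted_sort_id)
    qed
    also have "\<dots> = of_bool (alternating b ?s) + of_bool (alternating (\<not> b) ?s)"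
    proof (rule coboundary_alternating)
      show "?s \<noteq> []" using assms by (metis mset_sort mset_zero_iff)
    qed
    finally show ?thesis using True by (simp add: fan_def)
  next
    case False
    then obtain us a vs ws where xs: "xs = us @ [a] @ vs @ [a] @ ws" using not_distinct_decomp by blast
    define M where "M = mset (us @ vs @ ws)"
    have M: "mset xs = add_mset a (add_mset a M)" by (simp add: xs M_def)
    have gz: "g (add_mset a (add_mset a M')) = 0" for M'
    proof -
      have "\<not> distinct (sorted_list_of_multiset (add_mset a (add_mset a M')))"
      proof
        assume "distinct (sorted_list_of_multiset (add_mset a (add_mset a M')))"
        then have "count (mset (sorted_list_of_multiset (add_mset a (add_mset a M')))) a \<le> 1"
          by (simp only: distinct_count_atmost_1) simp
        then show False by simp
      qed
      then show ?thesis by (simp add: g_def)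
    qed
    have "g (mset xs - {#y#}) = 0" if "y \<in># M" for y
    proof -
      have "mset xs - {#y#} = add_mset a (add_mset a (M - {#y#}))"
        unfolding M using that by (simp add: multi_drop_mem_not_eq)
      then show ?thesis by (simp only: gz)
    qed
    then have "(\<Sum>y\<in>#M. g (mset xs - {#y#})) = 0" by (intro sum_mset.neutral) auto
    then have "coboundary (fan b) xs = 0" unfolding fg coboundary_mset by (simp add: M)
    then show ?thesis using False by (simp add: fan_def)
  qed
qed

definition swap_parity :: "nat \<Rightarrow> nat" where
  "swap_parity x = (if even x then Suc x else x - 1)"

lemma fan_swap_parity:
  assumes "\<And>x y. x \<in> set xs \<Longrightarrow> y \<in> set xs \<Longrightarrow> x div 2 = y div 2 \<Longrightarrow> x = y"
  shows "fan b (map swap_parity xs) = fan (\<not> b) xs"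
proof -
  have less: "swap_parity x < swap_parity y" if "x \<in> set xs" "y \<in> set xs" "x < y" for x y
  proof -
    have "x div 2 \<noteq> y div 2" using assms[OF that(1,2)] that(3) by blast
    then have "x div 2 < y div 2" using that(3) div_le_mono[of x y 2] by linarith
    then show ?thesis unfolding swap_parity_def by (auto elim!: evenE oddE)
  qed
  have inj: "inj_on swap_parity (set xs)"
  proof (rule inj_onI, rule ccontr)
    fix x y assume "x \<in> set xs" "y \<in> set xs" "swap_parity x = swap_parity y" "x \<noteq> y"
    then show False using less[of x y] less[of y x] by (cases "x < y") auto
  qed
  have "sorted (map swap_parity (sort xs))" unfolding sorted_map
  proof (rule sorted_wrt_mono_rel[OF _ sorted_sort])
    fix x y assume xy: "x \<in> set (sort xs)" "y \<in> set (sort xs)" "x \<le> y"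
    then show "swap_parity x \<le> swap_parity y" using less[of x y] by (cases "x = y") auto
  qed
  then have "sort (map swap_parity xs) = map swap_parity (sort xs)"
    by (intro properties_for_sort) auto
  moreover have "alternating b (map swap_parity ys) = alternating (\<not> b) ys" for ys
    by (induction ys arbitrary: b) (auto simp: swap_parity_def)
  ultimately show ?thesis using inj by (simp add: fan_def distinct_map)
qed

definition antipode :: "nat \<times> bool \<Rightarrow> nat \<times> bool" where
  "antipode = map_prod id Not"

lemma antipode_simps [simp]: "antipode (v, s) = (v, \<not> s)" "antipode (antipode x) = x"
  by (simp_all add: antipode_def prod_eq_iff)

text \<open>
  The simplices of the box complex of a graph: two sets of vertices, marked \<open>True\<close> and
  \<open>False\<close>, with all edges between them; either of the sets may be empty. The antipode exchanges the
  two sets.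
\<close>

definition biclique :: "nat set \<Rightarrow> (nat \<times> nat) set \<Rightarrow> (nat \<times> bool) set \<Rightarrow> bool" where
  "biclique V R X \<longleftrightarrow> fst ` X \<subseteq> V \<and> (\<forall>u v. (u, True) \<in> X \<and> (v, False) \<in> X \<longrightarrow> (u, v) \<in> R)"

lemma biclique_mono: "biclique V R X \<Longrightarrow> Y \<subseteq> X \<Longrightarrow> biclique V R Y"
  unfolding biclique_def by blast

lemma biclique_antipode: "sym R \<Longrightarrow> biclique V R X \<Longrightarrow> biclique V R (antipode ` X)"
  unfolding biclique_def antipode_def by (force dest: symD)

text \<open>
  A chain map from the antipodally symmetric cell structure of the \<open>n\<close>-sphere, with two cells in each
  dimension, to the box complex. The chain \<open>h i\<close> is the image of one of the two \<open>i\<close>-cells, and the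
  boundary of an \<open>i + 1\<close>-cell is the sum of the two \<open>i\<close>-cells.
\<close>

definition has_sphere :: "nat set \<Rightarrow> (nat \<times> nat) set \<Rightarrow> nat \<Rightarrow> bool" where
  "has_sphere V R n \<longleftrightarrow> (\<exists>h :: nat \<Rightarrow> (nat \<times> bool) list list.
     (\<forall>i\<le>n. \<forall>\<sigma>\<in>set (h i). length \<sigma> = Suc i \<and> biclique V R (set \<sigma>)) \<and>
     (\<Sum>\<sigma>\<leftarrow>h 0. 1 :: bit) = 1 \<and>
     (\<forall>i<n. \<forall>F. (\<Sum>\<sigma>\<leftarrow>h (Suc i). coboundary F \<sigma>) = (\<Sum>\<sigma>\<leftarrow>h i. F \<sigma> + F (map antipode \<sigma>))))"

text \<open>
  Label a vertex of the box complex by its colour and its mark. By \<open>coboundary_fan\<close> the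
  parity of the number of alternating simplices, counted with both starting signs, is the same for all
  the chains \<open>h i\<close>; it is 1 for \<open>h 0\<close>. So \<open>h n\<close> contains a simplex with \<open>n + 1\<close> distinct colours: a
  colour cannot occur with both signs, because oppositely marked vertices of a simplex are
  adjacent.
\<close>

lemma has_sphere_colours:
  assumes "has_sphere V R n" and c: "\<And>v. v \<in> V \<Longrightarrow> c v < N" "\<And>u v. (u, v) \<in> R \<Longrightarrow> c u \<noteq> c v"
  shows "n < N"
proof -
  obtain h :: "nat \<Rightarrow> (nat \<times> bool) list list" where
    h: "\<And>i \<sigma>. i \<le> n \<Longrightarrow> \<sigma> \<in> set (h i) \<Longrightarrow> length \<sigma> = Suc i \<and> biclique V R (set \<sigma>)" and
    h0: "(\<Sum>\<sigma>\<leftarrow>h 0. 1 :: bit) = 1" and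
    hS: "\<And>i F. i < n \<Longrightarrow> (\<Sum>\<sigma>\<leftarrow>h (Suc i). coboundary F \<sigma>) = (\<Sum>\<sigma>\<leftarrow>h i. F \<sigma> + F (map antipode \<sigma>))"
    using assms(1) unfolding has_sphere_def by blast
  define lab where "lab x = (if snd x then 2 * c (fst x) else Suc (2 * c (fst x)))" for x
  have coherent: "x = y" if xy: "biclique V R (set \<sigma>)" "x \<in> set (map lab \<sigma>)" "y \<in> set (map lab \<sigma>)"
    "x div 2 = y div 2" for x y \<sigma>
  proof -
    obtain u s v t where uv: "(u, s) \<in> set \<sigma>" "(v, t) \<in> set \<sigma>" "x = lab (u, s)" "y = lab (v, t)"
      using xy(2,3) by auto
    then have cc: "c u = c v" using xy(4) by (auto simp: lab_def split: if_splits)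
    then have "s = t" using c(2)[of u v] c(2)[of v u] xy(1) uv(1,2) unfolding biclique_def by (cases s; cases t) auto
    then show ?thesis using cc uv by (simp add: lab_def)
  qed
  have lab_anti: "map lab (map antipode \<sigma>) = map swap_parity (map lab \<sigma>)" for \<sigma>
    by (auto simp: lab_def swap_parity_def antipode_def)
  have one: "(\<Sum>\<sigma>\<leftarrow>h i. fan True (map lab \<sigma>) + fan False (map lab \<sigma>)) = 1" if "i \<le> n" for i
    using that
  proof (induction i)
    case 0
    have "(\<Sum>\<sigma>\<leftarrow>h 0. fan True (map lab \<sigma>) + fan False (map lab \<sigma>)) = (\<Sum>\<sigma>\<leftarrow>h 0. 1)"
    proof (intro arg_cong[of _ _ sum_list] map_cong refl)
      fix \<sigma> assume "\<sigma> \<in> set (h 0)"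
      then obtain x where "\<sigma> = [x]" using h[of 0 \<sigma>] by (auto simp: length_Suc_conv)
      then show "fan True (map lab \<sigma>) + fan False (map lab \<sigma>) = 1" by (simp add: fan_def)
    qed
    then show ?case using h0 by simp
  next
    case (Suc i)
    have "(\<Sum>\<sigma>\<leftarrow>h (Suc i). fan True (map lab \<sigma>) + fan False (map lab \<sigma>)) =
      (\<Sum>\<sigma>\<leftarrow>h (Suc i). coboundary (\<lambda>\<sigma>. fan True (map lab \<sigma>)) \<sigma>)"
    proof (intro arg_cong[of _ _ sum_list] map_cong refl)
      fix \<sigma> assume "\<sigma> \<in> set (h (Suc i))"
      then have "map lab \<sigma> \<noteq> []" using h[of "Suc i" \<sigma>] Suc.prems by auto
      then show "fan True (map lab \<sigma>) + fan False (map lab \<sigma>) = coboundary (\<lambda>\<sigma>. fan True (map lab \<sigma>)) \<sigma>"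
        using coboundary_fan[of "map lab \<sigma>" True] by (simp add: coboundary_map)
    qed
    also have "\<dots> = (\<Sum>\<sigma>\<leftarrow>h i. fan True (map lab \<sigma>) + fan True (map lab (map antipode \<sigma>)))"
      using Suc.prems by (intro hS) simp
    also have "\<dots> = (\<Sum>\<sigma>\<leftarrow>h i. fan True (map lab \<sigma>) + fan False (map lab \<sigma>))"
    proof (intro arg_cong[of _ _ sum_list] map_cong refl)
      fix \<sigma> assume "\<sigma> \<in> set (h i)"
      then have "biclique V R (set \<sigma>)" using h[of i \<sigma>] Suc.prems by auto
      then have "fan True (map swap_parity (map lab \<sigma>)) = fan (\<not> True) (map lab \<sigma>)"
        using coherent by (intro fan_swap_parity) blast
      then show "fan True (map lab \<sigma>) + fan True (map lab (map antipode \<sigma>)) =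
        fan True (map lab \<sigma>) + fan False (map lab \<sigma>)" unfolding lab_anti by simp
    qed
    finally show ?case using Suc by simp
  qed
  have "\<exists>\<sigma>\<in>set (h n). fan True (map lab \<sigma>) + fan False (map lab \<sigma>) \<noteq> 0"
  proof (rule ccontr)
    assume "\<not> ?thesis"
    then have "(\<Sum>\<sigma>\<leftarrow>h n. fan True (map lab \<sigma>) + fan False (map lab \<sigma>)) = (\<Sum>\<sigma>\<leftarrow>h n. 0)"
      by (intro arg_cong[of _ _ sum_list] map_cong refl) auto
    then show False using one[of n] by simp
  qed
  moreover have "fan True xs + fan False xs = 0" if "\<not> distinct xs" for xs using that by (simp add: fan_def)
  ultimately obtain \<sigma> where \<sigma>: "\<sigma> \<in> set (h n)" "distinct (map lab \<sigma>)" by blast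
  have b: "biclique V R (set \<sigma>)" and len: "length \<sigma> = Suc n" using h[OF _ \<sigma>(1)] by auto
  have "distinct (map (\<lambda>x. x div 2) (map lab \<sigma>))"
    using \<sigma>(2) coherent[OF b] by (subst distinct_map) (auto intro!: inj_onI)
  moreover have "set (map (\<lambda>x. x div 2) (map lab \<sigma>)) \<subseteq> {..<N}"
    using b c(1) by (auto simp: lab_def biclique_def)
  ultimately have "Suc n \<le> card {..<N}"
    using card_mono[of "{..<N}" "set (map (\<lambda>x. x div 2) (map lab \<sigma>))"] distinct_card len by fastforce
  then show ?thesis by simp
qed

text \<open>
  If the equator of the new sphere, which is the sum of \<open>h n\<close> and its antipode, can be deformed to a
  point through the maps \<open>g 0, \<dots>, g T\<close>, then the trace of this deformation is the missing
  hemisphere. The deformation proceeds by prisms; their ends telescope, and the constant end vanishes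
  because the equator has an even number of simplices.
\<close>

lemma has_sphere_suspension:
  fixes g :: "nat \<Rightarrow> nat \<times> bool \<Rightarrow> nat \<times> bool"
  assumes sph: "has_sphere V R n" and "n \<ge> 1" and "sym R"
    and contig: "\<And>t X. t < T \<Longrightarrow> biclique V R X \<Longrightarrow> biclique V' R' (g t ` X \<union> g (Suc t) ` X)"
    and g0: "\<And>x. g 0 (antipode x) = antipode (g 0 x)" and gT: "\<And>x. g T x = z" and "T > 0"
  shows "has_sphere V' R' (Suc n)"
proof -
  obtain h :: "nat \<Rightarrow> (nat \<times> bool) list list" where
    h: "\<And>i \<sigma>. i \<le> n \<Longrightarrow> \<sigma> \<in> set (h i) \<Longrightarrow> length \<sigma> = Suc i \<and> biclique V R (set \<sigma>)" and
    h0: "(\<Sum>\<sigma>\<leftarrow>h 0. 1 :: bit) = 1" and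
    hS: "\<And>i F. i < n \<Longrightarrow> (\<Sum>\<sigma>\<leftarrow>h (Suc i). coboundary F \<sigma>) = (\<Sum>\<sigma>\<leftarrow>h i. F \<sigma> + F (map antipode \<sigma>))"
    using sph unfolding has_sphere_def by blast
  define y where "y = h n @ map (map antipode) (h n)"
  have y: "length \<sigma> = Suc n \<and> biclique V R (set \<sigma>)" if "\<sigma> \<in> set y" for \<sigma>
    using that h[of n] biclique_antipode[OF \<open>sym R\<close>] by (auto simp: y_def)
  have cycle: "(\<Sum>\<sigma>\<leftarrow>y. coboundary F \<sigma>) = 0" for F
  proof -
    obtain i where i: "n = Suc i" using \<open>n \<ge> 1\<close> by (cases n) auto
    have "(\<Sum>\<sigma>\<leftarrow>y. coboundary F \<sigma>) = (\<Sum>\<sigma>\<leftarrow>h n. coboundary F \<sigma>) + (\<Sum>\<sigma>\<leftarrow>h n. coboundary (\<lambda>\<sigma>. F (map antipode \<sigma>)) \<sigma>)"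
      by (simp add: y_def comp_def coboundary_map)
    also have "\<dots> = 0" using hS[of i] by (simp add: i comp_def sum_list_add algebra_simps)
    finally show ?thesis .
  qed
  \<comment> \<open>The trace of the deformation.\<close>
  define D where "D = concat (map (\<lambda>t. concat (map (prism (g t) (g (Suc t))) y)) [0..<T])"
  have sum_concat: "(\<Sum>\<tau>\<leftarrow>concat C. F \<tau>) = (\<Sum>c\<leftarrow>C. \<Sum>\<tau>\<leftarrow>c. F \<tau>)" for C :: "'x list list" and F :: "'x \<Rightarrow> bit"
    by (induction C) simp_all
  have tele: "(\<Sum>t\<leftarrow>[0..<k]. a t + a (Suc t)) = a 0 + (a k :: bit)" for a k
    by (induction k) (simp_all add: algebra_simps)
  have prism_y: "(\<Sum>\<tau>\<leftarrow>concat (map (prism f f') y). coboundary F \<tau>) = (\<Sum>\<sigma>\<leftarrow>y. F (map f \<sigma>)) + (\<Sum>\<sigma>\<leftarrow>y. F (map f' \<sigma>))"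
    for f f' and F :: "(nat \<times> bool) list \<Rightarrow> bit"
  proof -
    have "(\<Sum>\<tau>\<leftarrow>concat (map (prism f f') y). coboundary F \<tau>) = (\<Sum>\<sigma>\<leftarrow>y. \<Sum>\<tau>\<leftarrow>prism f f' \<sigma>. coboundary F \<tau>)"
      by (simp add: sum_concat comp_def)
    then show ?thesis by (simp add: coboundary_prism sum_list_add cycle)
  qed
  have D: "(\<Sum>\<tau>\<leftarrow>D. coboundary F \<tau>) = (\<Sum>\<sigma>\<leftarrow>y. F (map (g 0) \<sigma>))" for F
  proof -
    have "(\<Sum>\<tau>\<leftarrow>D. coboundary F \<tau>) = (\<Sum>t\<leftarrow>[0..<T]. (\<Sum>\<sigma>\<leftarrow>y. F (map (g t) \<sigma>)) + (\<Sum>\<sigma>\<leftarrow>y. F (map (g (Suc t)) \<sigma>)))"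
      unfolding D_def sum_concat by (simp add: comp_def prism_y)
    also have "\<dots> = (\<Sum>\<sigma>\<leftarrow>y. F (map (g 0) \<sigma>)) + (\<Sum>\<sigma>\<leftarrow>y. F (map (g T) \<sigma>))" by (rule tele)
    also have "(\<Sum>\<sigma>\<leftarrow>y. F (map (g T) \<sigma>)) = (\<Sum>\<sigma>\<leftarrow>y. F (replicate (Suc n) z))"
    proof (intro arg_cong[of _ _ sum_list] map_cong refl arg_cong[of _ _ F])
      fix \<sigma> assume "\<sigma> \<in> set y"
      then show "map (g T) \<sigma> = replicate (Suc n) z" using y[of \<sigma>] gT
        by (metis map_replicate_const map_eq_conv)
    qed
    also have "\<dots> = 0" by (simp add: y_def comp_def)
    finally show ?thesis by simp
  qed
  have contig0: "biclique V' R' (g 0 ` X)" if "biclique V R X" for X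
    using contig[of 0 X] that \<open>T > 0\<close> biclique_mono by blast
  define h' where "h' i = (if i \<le> n then map (map (g 0)) (h i) else D)" for i
  have "length \<sigma> = Suc i \<and> biclique V' R' (set \<sigma>)" if i\<sigma>: "i \<le> Suc n" "\<sigma> \<in> set (h' i)" for i \<sigma>
  proof (cases "i \<le> n")
    case True
    then show ?thesis using i\<sigma> h[of i] contig0 by (auto simp: h'_def)
  next
    case False
    then have i: "i = Suc n" using i\<sigma> by simp
    then obtain t \<rho> where t: "t < T" "\<rho> \<in> set y" "\<sigma> \<in> set (prism (g t) (g (Suc t)) \<rho>)"
      using i\<sigma> False by (auto simp: h'_def D_def)
    have "biclique V' R' (g t ` set \<rho> \<union> g (Suc t) ` set \<rho>)" using contig[OF t(1)] y[OF t(2)] by simp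
    then have "biclique V' R' (set \<sigma>)" by (rule biclique_mono) (use set_prism[OF t(3)] in simp)
    then show ?thesis using set_prism[OF t(3)] y[OF t(2)] i by simp
  qed
  moreover have "(\<Sum>\<sigma>\<leftarrow>h' 0. 1 :: bit) = 1" using h0 by (simp add: h'_def comp_def)
  moreover have "(\<Sum>\<sigma>\<leftarrow>h' (Suc i). coboundary F \<sigma>) = (\<Sum>\<sigma>\<leftarrow>h' i. F \<sigma> + F (map antipode \<sigma>))" if "i < Suc n" for i F
  proof (cases "i < n")
    case True
    then show ?thesis using hS[OF True, of "\<lambda>\<sigma>. F (map (g 0) \<sigma>)"]
      by (simp add: h'_def comp_def coboundary_map g0)
  next
    case False
    then have "i = n" using that by simp
    then show ?thesis using D[of F] by (simp add: h'_def y_def comp_def sum_list_add g0)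
  qed
  ultimately show ?thesis unfolding has_sphere_def by (intro exI[of _ h']) auto
qed

section \<open>Iterated generalised Mycielski graphs\<close>

text \<open>
  The generalised Mycielski graph over \<open>R\<close> on \<open>{..<n}\<close>: copies \<open>i * n + v\<close> of the vertices \<open>v\<close> on the
  levels \<open>i = 0, \<dots>, r - 1\<close>, edges of \<open>R\<close> inside level 0 and between consecutive levels, and the
  apex \<open>r * n\<close>, adjacent to the last level. The level of a vertex is its quotient by \<open>n\<close>, which is \<open>r\<close>
  for the apex.
\<close>

definition myc :: "nat \<Rightarrow> nat \<Rightarrow> (nat \<times> nat) set \<Rightarrow> (nat \<times> nat) set" where
  "myc r n R = {(x, y). x \<le> r * n \<and> y \<le> r * n \<and>
     (x div n < r \<and> y div n < r \<and> (x mod n, y mod n) \<in> R \<and>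
        (x div n = 0 \<and> y div n = 0 \<or> y div n = Suc (x div n) \<or> x div n = Suc (y div n)) \<or>
      x div n = r \<and> Suc (y div n) = r \<or> y div n = r \<and> Suc (x div n) = r)}"

lemma sym_myc: "sym R \<Longrightarrow> sym (myc r n R)"
  by (rule symI) (auto simp: myc_def dest: symD)

lemma myc_range: "myc r n R \<subseteq> {..<r * n + 1} \<times> {..<r * n + 1}"
  by (auto simp: myc_def)

text \<open>
  The copy of \<open>v\<close> on level \<open>i\<close>, where the apex counts as level \<open>r\<close> for every \<open>v\<close>.
\<close>

definition myc_vertex :: "nat \<Rightarrow> nat \<Rightarrow> nat \<Rightarrow> nat \<Rightarrow> nat" where
  "myc_vertex r n i v = (if i < r then i * n + v else r * n)"

lemma myc_vertex_le:
  assumes "v < n" shows "myc_vertex r n i v \<le> r * n"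
proof (cases "i < r")
  case True
  then have "Suc i * n \<le> r * n" by (intro mult_le_mono1) simp
  then show ?thesis using assms True by (simp add: myc_vertex_def)
qed (simp add: myc_vertex_def)

lemma myc_vertex_div: "v < n \<Longrightarrow> i \<le> r \<Longrightarrow> myc_vertex r n i v div n = i"
  by (auto simp: myc_vertex_def)

lemma myc_vertex_mod: "v < n \<Longrightarrow> i < r \<Longrightarrow> myc_vertex r n i v mod n = v"
  by (auto simp: myc_vertex_def)

lemma myc_edge:
  assumes "u < n" "v < n" "(u, v) \<in> R" "i \<le> r" "j \<le> r" "i = 0 \<and> j = 0 \<or> j = Suc i \<or> i = Suc j" "r > 0"
  shows "(myc_vertex r n i u, myc_vertex r n j v) \<in> myc r n R"
  using assms by (auto simp: myc_def myc_vertex_le myc_vertex_div myc_vertex_mod)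

lemma myc_apex_edge:
  assumes "v < n" "r > 0"
  shows "(myc_vertex r n (r - 1) v, r * n) \<in> myc r n R" "(r * n, myc_vertex r n (r - 1) v) \<in> myc r n R"
  using assms by (auto simp: myc_def myc_vertex_le myc_vertex_div)

text \<open>
  A closed walk that avoids the apex projects to \<open>R\<close>. Otherwise it may start at the apex; the level
  changes by one in each step except along edges inside level 0, so an odd closed walk uses such an
  edge, after at least \<open>r\<close> steps down and before at least \<open>r\<close> steps up.
\<close>

lemma myc_no_odd_closed_walk:
  assumes R: "no_odd_closed_walk R (2 * r)" and n: "n > 0"
  shows "no_odd_closed_walk (myc r n R) (2 * r)"
  unfolding no_odd_closed_walk_def
proof (intro allI impI notI, elim conjE)
  fix l v assume l: "odd l" "l \<le> 2 * r" and walk: "(v, v) \<in> myc r n R ^^ l"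
  obtain w where w: "w 0 = v" "w l = v" "\<And>i. i < l \<Longrightarrow> (w i, w (Suc i)) \<in> myc r n R"
    using relpow_walk[OF walk] by metis
  show False
  proof (cases "\<exists>t\<le>l. w t div n = r")
    case False
    have "(w i mod n, w (Suc i) mod n) \<in> R" if "i < l" for i
    proof -
      have "w i div n \<noteq> r" "w (Suc i) div n \<noteq> r" using False that by auto
      then show ?thesis using w(3)[OF that] by (auto simp: myc_def)
    qed
    then have "(w 0 mod n, w l mod n) \<in> R ^^ (l - 0)"
      using relpow_of_fun[of 0 l "\<lambda>i. w i mod n" R] by simp
    then show False using w(1,2) no_odd_closed_walkD[OF R _ l] by simp
  next
    case True
    then obtain t where t: "t \<le> l" "w t div n = r" by blast
    have wt: "w t = r * n"
    proof -
      have "w t \<le> r * n"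
      proof (cases "t < l")
        case True
        then show ?thesis using w(3)[of t] by (auto simp: myc_def)
      next
        case False
        then have "w t = w 0" "0 < l" using t(1) w(1,2) odd_pos[OF l(1)] by auto
        then show ?thesis using w(3)[of 0] by (auto simp: myc_def)
      qed
      moreover have "r * n \<le> w t" using t(2) by (metis div_mult_mod_eq le_add1)
      ultimately show ?thesis by simp
    qed
    have "(w 0, w t) \<in> myc r n R ^^ (t - 0)" "(w t, w l) \<in> myc r n R ^^ (l - t)"
      using t(1) w(3) by (intro relpow_of_fun; simp)+
    then have "(v, r * n) \<in> myc r n R ^^ t" "(r * n, v) \<in> myc r n R ^^ (l - t)"
      using w(1,2) wt by simp_all
    then have "(r * n, r * n) \<in> myc r n R ^^ (l - t + t)" using relpow_append by metis
    then have "(r * n, r * n) \<in> myc r n R ^^ l" using t(1) by simp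
    then obtain u where u: "u 0 = r * n" "u l = r * n" "\<And>i. i < l \<Longrightarrow> (u i, u (Suc i)) \<in> myc r n R"
      using relpow_walk by metis
    define d where "d i = u i div n" for i
    have d0: "d 0 = r" "d l = r" using n u(1,2) by (auto simp: d_def)
    have dstep: "d i = 0 \<and> d (Suc i) = 0 \<or> d (Suc i) = Suc (d i) \<or> d i = Suc (d (Suc i))" if "i < l" for i
      using u(3)[OF that] by (auto simp: myc_def d_def)
    have "\<exists>i<l. d i = 0 \<and> d (Suc i) = 0"
    proof (rule ccontr)
      assume no: "\<not> ?thesis"
      have "even (d i + r + i)" if "i \<le> l" for i using that
      proof (induction i)
        case (Suc i)
        then have "i < l" by simp
        then have "d (Suc i) = Suc (d i) \<or> d i = Suc (d (Suc i))" using dstep[of i] no by blast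
        then show ?case using Suc by auto
      qed (simp add: d0)
      then show False using d0 l(1) by (metis even_add le_refl)
    qed
    then obtain i where i: "i < l" "d i = 0" "d (Suc i) = 0" by blast
    have up: "r \<le> d i + i" if "i \<le> l" for i using that
    proof (induction i)
      case (Suc i) then show ?case using dstep[of i] by auto
    qed (simp add: d0)
    have a: "r \<le> i" using up[of i] i by simp
    have down: "r \<le> d j + (l - j)" if "j \<le> l" for j using that
    proof (induction j rule: inc_induct)
      case (step j)
      have "d j = 0 \<and> d (Suc j) = 0 \<or> d (Suc j) = Suc (d j) \<or> d j = Suc (d (Suc j))"
        using dstep[of j] step.hyps by blast
      then show ?case using step by auto
    qed (simp add: d0)
    have "r \<le> l - Suc i" using down[of "Suc i"] i by simp
    then show False using a l i by auto
  qed
qed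

lemma myc_neighbour:
  assumes R: "\<And>v. v < n \<Longrightarrow> \<exists>u<n. (v, u) \<in> R" and n: "n > 0" and r: "r > 0" and x: "x < r * n + 1"
  shows "\<exists>y. (x, y) \<in> myc r n R"
proof (cases "x div n < r")
  case True
  obtain u where u: "u < n" "(x mod n, u) \<in> R" using R[of "x mod n"] n by auto
  have x': "x = myc_vertex r n (x div n) (x mod n)" using True by (simp add: myc_vertex_def)
  have "(myc_vertex r n (x div n) (x mod n), myc_vertex r n (x div n - 1) u) \<in> myc r n R"
    by (rule myc_edge) (use u n r True in auto)
  then show ?thesis using x' by metis
next
  case False
  then have "x = r * n" using x n by (metis div_less_iff_less_mult less_Suc_eq Suc_eq_plus1)
  then show ?thesis using myc_apex_edge(2)[of 0 n r R] n r by auto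
qed

lemma myc_radius:
  assumes R: "\<And>v. v < n \<Longrightarrow> \<exists>u<n. (v, u) \<in> R" and n: "n > 0" and x: "x < r * n + 1"
  shows "(x, r * n) \<in> myc r n R ^^ (r - x div n)"
  using x
proof (induction "r - x div n" arbitrary: x)
  case 0
  then have "x = r * n" using n
    by (metis diff_is_0_eq div_less_iff_less_mult less_Suc_eq Suc_eq_plus1 not_less)
  then show ?case using 0 by simp
next
  case (Suc k)
  let ?i = "x div n"
  have i: "?i < r" using Suc by simp
  have x': "x = myc_vertex r n ?i (x mod n)" using i by (simp add: myc_vertex_def)
  obtain u where u: "u < n" "(x mod n, u) \<in> R" using R[of "x mod n"] n by auto
  define y where "y = myc_vertex r n (Suc ?i) u"
  have xy: "(x, y) \<in> myc r n R" unfolding y_def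
    by (subst x', rule myc_edge) (use u n i in auto)
  have "y div n = Suc ?i" unfolding y_def using u i by (intro myc_vertex_div) auto
  then have k: "k = r - y div n" using Suc.hyps(2) by simp
  moreover have "y < r * n + 1" using myc_vertex_le[OF u(1), of r "Suc ?i"] by (simp add: y_def)
  ultimately have "(y, r * n) \<in> myc r n R ^^ k" using Suc.hyps(1)[of y] by metis
  then show ?case using xy Suc.hyps(2) by (metis relpow_Suc_I2)
qed

text \<open>
  The vertices with mark \<open>True\<close> and those with mark \<open>False\<close> are moved up alternately: \<open>L t s\<close> is the level of the vertices
  marked \<open>s\<close> at time \<open>t\<close>, so that at any time after the start the two marks sit on consecutive
  levels. At time \<open>r\<close> one of the marks has been collapsed to the apex. The apex is joined to all
  oppositely marked vertices of the last level, so the whole complex contracts to it.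
\<close>

lemma myc_has_sphere:
  assumes sph: "has_sphere {..<n} R N" and N: "N \<ge> 1" and "sym R" and n: "n > 0" and r: "r > 0"
  shows "has_sphere {..<r * n + 1} (myc r n R) (Suc N)"
proof -
  define L where "L t s = (if t = 0 then 0 else if even t = s then t else t - 1)" for t :: nat and s
  define g where "g t x = (if t \<le> r then (myc_vertex r n (L t (snd x)) (fst x), snd x) else (r * n, even r))"
    for t and x :: "nat \<times> bool"
  have Lle: "L t s \<le> t" for t s by (simp add: L_def)
  have b: "biclique {..<r * n + 1} (myc r n R) (g t ` X \<union> g (Suc t) ` X)"
    if t: "t < Suc r" and X: "biclique {..<n} R X" for t X
    unfolding biclique_def
  proof (intro conjI allI impI, goal_cases)
    case 1
    have "myc_vertex r n i v < r * n + 1" if "(v, s) \<in> X" for i v s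
      using myc_vertex_le[of v n r i] X that by (fastforce simp: biclique_def)
    then show ?case by (auto simp: g_def split: if_splits)
  next
    case (2 x y)
    show ?case
    proof (cases "t < r")
      case True
      then obtain a u b v where u: "(u, True) \<in> X" "x = myc_vertex r n a u" "a \<in> {L t True, L (Suc t) True}"
        and v: "(v, False) \<in> X" "y = myc_vertex r n b v" "b \<in> {L t False, L (Suc t) False}"
        using 2 by (auto simp: g_def)
      have "a = 0 \<and> b = 0 \<or> b = Suc a \<or> a = Suc b" "a \<le> r" "b \<le> r"
        using u(3) v(3) True by (auto simp: L_def split: if_splits)
      moreover have "(u, v) \<in> R" "u < n" "v < n" using X u(1) v(1) by (force simp: biclique_def)+
      ultimately show ?thesis unfolding u v using r by (intro myc_edge) auto
    next
      case False
      then have tr: "t = r" using t by simp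
      show ?thesis
      proof (cases "even r")
        case True
        then obtain v where "x = r * n" "(v, False) \<in> X" "y = myc_vertex r n (r - 1) v"
          using 2 tr r by (auto simp: g_def L_def myc_vertex_def)
        moreover have "v < n" using X calculation(2) by (force simp: biclique_def)
        ultimately show ?thesis using myc_apex_edge(2)[OF _ r] by simp
      next
        case False
        then obtain v where "y = r * n" "(v, True) \<in> X" "x = myc_vertex r n (r - 1) v"
          using 2 tr r by (auto simp: g_def L_def myc_vertex_def)
        moreover have "v < n" using X calculation(2) by (force simp: biclique_def)
        ultimately show ?thesis using myc_apex_edge(1)[OF _ r] by simp
      qed
    qed
  qed
  show ?thesis
  proof (rule has_sphere_suspension[OF sph N \<open>sym R\<close>, where g = g and T = "Suc r" and z = "(r * n, even r)"])
    show "biclique {..<r * n + 1} (myc r n R) (g t ` X \<union> g (Suc t) ` X)"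
      if "t < Suc r" "biclique {..<n} R X" for t X using b that .
  qed (auto simp: g_def L_def antipode_def)
qed

lemma has_sphere_K2: "has_sphere {..<2} {(0, 1), (1, 0)} 1"
proof -
  define h :: "nat \<Rightarrow> (nat \<times> bool) list list" where
    "h i = (if i = 0 then [[(0, True)]] else [[(0, True), (1, True)], [(1, True), (0, False)]])" for i
  have "(\<Sum>\<sigma>\<leftarrow>h (Suc 0). coboundary F \<sigma>) = (\<Sum>\<sigma>\<leftarrow>h 0. F \<sigma> + F (map antipode \<sigma>))" for F
    by (simp add: h_def algebra_simps)
  moreover have "length \<sigma> = Suc i \<and> biclique {..<2} {(0, 1), (1, 0)} (set \<sigma>)" if "i \<le> 1" "\<sigma> \<in> set (h i)" for i \<sigma>
    using that by (auto simp: h_def biclique_def le_Suc_eq split: if_splits)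
  ultimately show ?thesis unfolding has_sphere_def by (intro exI[of _ h]) (auto simp: h_def)
qed

primrec myc_order :: "nat \<Rightarrow> nat \<Rightarrow> nat" where
  "myc_order r 0 = 2" | "myc_order r (Suc i) = r * myc_order r i + 1"

primrec iter_myc :: "nat \<Rightarrow> nat \<Rightarrow> (nat \<times> nat) set" where
  "iter_myc r 0 = {(0, 1), (1, 0)}" | "iter_myc r (Suc i) = myc r (myc_order r i) (iter_myc r i)"

lemma myc_order_pos: "myc_order r i > 0"
  by (induction i) auto

lemma sym_iter_myc: "sym (iter_myc r i)"
  by (induction i) (auto simp: sym_myc, auto simp: sym_def)

lemma iter_myc_range: "iter_myc r i \<subseteq> {..<myc_order r i} \<times> {..<myc_order r i}"
  by (cases i) (use myc_range in \<open>auto simp: subset_iff\<close>)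

lemma iter_myc_no_odd_closed_walk: "no_odd_closed_walk (iter_myc r i) (2 * r)"
proof (induction i)
  case 0
  have "(x, y) \<in> iter_myc r 0 ^^ l \<Longrightarrow> x \<le> 1 \<Longrightarrow> even (x + y + l) \<and> y \<le> 1" for x y l
    by (induction l arbitrary: y) fastforce+
  moreover have "x \<le> 1" if "(x, x) \<in> iter_myc r 0 ^^ l" "odd l" for x l
    using that by (cases l) auto
  ultimately show ?case unfolding no_odd_closed_walk_def by (metis even_add)
next
  case (Suc i) then show ?case using myc_no_odd_closed_walk myc_order_pos by simp
qed

lemma iter_myc_neighbour: "r > 0 \<Longrightarrow> x < myc_order r i \<Longrightarrow> \<exists>y<myc_order r i. (x, y) \<in> iter_myc r i"
proof (induction i arbitrary: x)
  case 0
  then show ?case by (auto simp: numeral_2_eq_2 less_Suc_eq)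
next
  case (Suc i)
  have "\<exists>y. (x, y) \<in> iter_myc r (Suc i)"
    using myc_neighbour[of "myc_order r i" "iter_myc r i" r x] Suc myc_order_pos by simp
  then show ?case using iter_myc_range[of r "Suc i"] by blast
qed

lemma iter_myc_has_sphere: "r > 0 \<Longrightarrow> has_sphere {..<myc_order r i} (iter_myc r i) (Suc i)"
proof (induction i)
  case 0 then show ?case using has_sphere_K2 by simp
next
  case (Suc i)
  then show ?case using myc_has_sphere[OF _ _ sym_iter_myc myc_order_pos] by simp
qed

lemma iter_myc_radius:
  assumes "r > 0" "x < myc_order r (Suc i)"
  shows "\<exists>l\<le>r. (r * myc_order r i, x) \<in> iter_myc r (Suc i) ^^ l"
proof -
  have "(x, r * myc_order r i) \<in> iter_myc r (Suc i) ^^ (r - x div myc_order r i)"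
    using myc_radius[of "myc_order r i" "iter_myc r i" x r] iter_myc_neighbour assms myc_order_pos by simp
  then show ?thesis using relpow_rev[OF sym_iter_myc] by (meson diff_le_self)
qed

lemma myc_order_closed_form:
  assumes "r \<ge> 2"
  shows "real (myc_order r (Suc i)) = real r ^ i * (2 * real r + 1) + (real r ^ i - 1) / (real r - 1)"
proof (induction i)
  case (Suc i)
  have "real (myc_order r (Suc (Suc i))) = real r * real (myc_order r (Suc i)) + 1"
    unfolding myc_order.simps(2)[of r "Suc i"] by (simp only: of_nat_add of_nat_mult of_nat_1)
  also have "\<dots> = real r ^ Suc i * (2 * real r + 1) + (real r * (real r ^ i - 1) / (real r - 1) + 1)"
    unfolding Suc by (simp add: algebra_simps)
  also have "real r * (real r ^ i - 1) / (real r - 1) + 1 = (real r ^ Suc i - 1) / (real r - 1)"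
    using assms by (simp add: field_simps)
  finally show ?case .
qed simp

section \<open>Colouring balls in graphs without a fixed odd cycle\<close>

text \<open>
  Breadth-first search trees, with a linear order on each level that is compatible with the tree:
  \<open>before h x y\<close> says that \<open>h\<close> is the height of the closest common ancestor above \<open>x\<close> and \<open>y\<close>, and that
  the branch towards \<open>x\<close> comes first there.
\<close>

locale rooted_graph =
  fixes R :: "(nat \<times> nat) set" and z :: nat
  assumes sym: "sym R" and loopless: "(x, x) \<notin> R"
begin

definition depth :: "nat \<Rightarrow> nat" where "depth x = (LEAST l. (z, x) \<in> R ^^ l)"

definition level :: "nat \<Rightarrow> nat \<Rightarrow> bool" where
  "level i x \<longleftrightarrow> (\<exists>l. (z, x) \<in> R ^^ l) \<and> depth x = i"

lemma depth_walk: "level i x \<Longrightarrow> (z, x) \<in> R ^^ i"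
  unfolding level_def depth_def by (metis LeastI_ex)

lemma depth_le: "(z, x) \<in> R ^^ l \<Longrightarrow> \<exists>i\<le>l. level i x"
  unfolding level_def depth_def by (meson Least_le)

lemma level_unique: "level i x \<Longrightarrow> level j x \<Longrightarrow> i = j"
  by (simp add: level_def)

lemma level_0: "level 0 x \<Longrightarrow> x = z"
  using depth_walk[of 0 x] by simp

lemma level_edge:
  assumes "level i x" "(x, y) \<in> R" shows "\<exists>j\<le>Suc i. level j y"
  using depth_le[OF relpow_Suc_I[OF depth_walk[OF assms(1)] assms(2)]] .

lemma level_Suc:
  assumes "level (Suc i) x" shows "\<exists>y. (y, x) \<in> R \<and> level i y"
proof -
  obtain y where y: "(z, y) \<in> R ^^ i" "(y, x) \<in> R" using depth_walk[OF assms] by auto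
  obtain j where j: "j \<le> i" "level j y" using depth_le[OF y(1)] by blast
  obtain l where l: "l \<le> Suc j" "level l x" using level_edge[OF j(2) y(2)] by blast
  have "l = Suc i" using level_unique[OF l(2) assms] .
  then have "j = i" using l j by simp
  then show ?thesis using y j by blast
qed

definition parent :: "nat \<Rightarrow> nat" where
  "parent x = (SOME y. (y, x) \<in> R \<and> level (depth x - 1) y)"

lemma parent:
  assumes "level (Suc i) x" shows "(parent x, x) \<in> R" "level i (parent x)"
proof -
  have "depth x - 1 = i" using assms by (simp add: level_def)
  then show "(parent x, x) \<in> R" "level i (parent x)"
    using someI_ex[OF level_Suc[OF assms]] by (simp_all add: parent_def)
qed

definition anc :: "nat \<Rightarrow> nat \<Rightarrow> nat" where "anc h x = (parent ^^ h) x"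

lemma anc_level: "level i x \<Longrightarrow> h \<le> i \<Longrightarrow> level (i - h) (anc h x)"
proof (induction h)
  case (Suc h)
  then have "level (Suc (i - Suc h)) (anc h x)" by (simp add: Suc_diff_Suc)
  then show ?case using parent(2) by (simp add: anc_def)
qed (simp add: anc_def)

lemma anc_edge:
  assumes "level i x" "h < i" shows "(anc (Suc h) x, anc h x) \<in> R"
proof -
  have "level (Suc (i - Suc h)) (anc h x)" using anc_level[of i x h] assms by (simp add: Suc_diff_Suc)
  then show ?thesis using parent(1) by (simp add: anc_def)
qed

lemma anc_eq_mono: "anc h x = anc h y \<Longrightarrow> h \<le> g \<Longrightarrow> anc g x = anc g y"
  by (induction g) (auto simp: le_Suc_eq anc_def)

definition before :: "nat \<Rightarrow> nat \<Rightarrow> nat \<Rightarrow> bool" where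
  "before h x y \<longleftrightarrow> h \<ge> 1 \<and> anc h x = anc h y \<and> anc (h - 1) x < anc (h - 1) y"

lemma before_neq: "before h x y \<Longrightarrow> x \<noteq> y"
  by (auto simp: before_def)

text \<open>
  The height of the common ancestor of the ends of an increasing sequence is the maximum of the heights
  of its consecutive pairs, as in a planar drawing of the tree. This is what makes the
  length of the cycle in \<open>increasing_path_gives_cycle\<close> computable.
\<close>

lemma before_trans:
  assumes "before a x y" "before b y w" shows "before (max a b) x w"
proof -
  consider "a < b" | "b < a" | "a = b" by linarith
  then show ?thesis
  proof cases
    case 1
    then have "anc (b - 1) x = anc (b - 1) y" "anc b x = anc b y"
      using assms(1) by (auto simp: before_def intro: anc_eq_mono)
    then show ?thesis using assms(2) 1 by (simp add: before_def max_def)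
  next
    case 2
    then have "anc (a - 1) y = anc (a - 1) w" "anc a y = anc a w"
      using assms(2) by (auto simp: before_def intro: anc_eq_mono)
    then show ?thesis using assms(1) 2 by (simp add: before_def max_def)
  qed (use assms in \<open>auto simp: before_def\<close>)
qed

lemma before_total:
  assumes "level i x" "level i y" "x \<noteq> y"
  shows "\<exists>h. before h x y \<or> before h y x"
proof -
  have "anc i x = anc i y"
    using level_0[of "anc i x"] level_0[of "anc i y"] anc_level[OF assms(1), of i]
      anc_level[OF assms(2), of i] by simp
  define h where "h = (LEAST h. anc h x = anc h y)"
  have h: "anc h x = anc h y" unfolding h_def by (rule LeastI) fact
  have "h \<noteq> 0" using h assms(3) by (cases h) (auto simp: anc_def)
  then have "h - 1 < (LEAST h. anc h x = anc h y)" unfolding h_def[symmetric] by simp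
  from not_less_Least[OF this] have "anc (h - 1) x \<noteq> anc (h - 1) y" .
  then show ?thesis using h \<open>h \<noteq> 0\<close> unfolding before_def by (intro exI[of _ h]) (auto simp: neq_iff)
qed

lemma before_height_le:
  assumes "level i x" "level i y" "before h x y" shows "h \<le> i"
proof (rule ccontr)
  assume "\<not> h \<le> i"
  have "anc i x = anc i y"
    using level_0[of "anc i x"] level_0[of "anc i y"] anc_level[OF assms(1), of i]
      anc_level[OF assms(2), of i] by simp
  then have "anc (h - 1) x = anc (h - 1) y" by (rule anc_eq_mono) (use \<open>\<not> h \<le> i\<close> in simp)
  then show False using assms(3) by (simp add: before_def)
qed

lemma before_path:
  assumes step: "\<And>t. s \<le> t \<Longrightarrow> t < e \<Longrightarrow> before (h t) (x t) (x (Suc t)) \<and> h t \<le> M"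
    and "s \<le> t0" "t0 < e" "h t0 = M"
  shows "before M (x s) (x e)"
proof -
  have "before (Max (h ` {s..<e'})) (x s) (x e')" if "s < e'" "e' \<le> e" for e'
    using that
  proof (induction e' rule: less_induct)
    case (less e')
    then obtain f where f: "e' = Suc f" by (cases e') auto
    show ?case
    proof (cases "f = s")
      case True
      then show ?thesis using step[of s] less f by simp
    next
      case False
      then have "before (max (Max (h ` {s..<f})) (h f)) (x s) (x (Suc f))"
        using less.IH[of f] step[of f] less.prems f by (intro before_trans) auto
      moreover have "Max (h ` {s..<e'}) = max (Max (h ` {s..<f})) (h f)"
      proof -
        have "h ` {s..<e'} = insert (h f) (h ` {s..<f})" using f less.prems by (auto simp: less_Suc_eq)
        moreover have "h ` {s..<f} \<noteq> {}" using False less.prems f by auto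
        ultimately show ?thesis by (simp add: max.commute)
      qed
      ultimately show ?thesis using f by simp
    qed
  qed
  moreover have "Max (h ` {s..<e}) = M"
    using step assms(2-4) by (intro Max_eqI) auto
  ultimately show ?thesis using assms(2,3) by (metis le_less_trans order_refl)
qed

text \<open>
  Let \<open>M\<close> be the largest height occurring between consecutive vertices of the path. A segment of the
  path of length \<open>2 k - 1 - 2 M\<close> that contains the corresponding step has ends whose common ancestor has
  height \<open>M\<close>, so the tree closes it by \<open>2 M\<close> further edges to a cycle of length \<open>2 k - 1\<close>. Since
  \<open>1 \<le> M \<le> k - 1\<close>, the segment has at least one edge and fits into a path with \<open>2 k - 3\<close> edges.
\<close>

lemma increasing_path_gives_cycle:
  assumes lev: "\<And>t. t \<le> L \<Longrightarrow> level i (x t)" and path: "\<And>t. t < L \<Longrightarrow> (x t, x (Suc t)) \<in> R"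
    and inc: "\<And>t. t < L \<Longrightarrow> \<exists>h. before h (x t) (x (Suc t))"
    and L: "L = 2 * k - 3" and i: "i \<le> k - 1" and k: "k \<ge> 2"
  shows "\<exists>w. (\<forall>q<2 * k - 1. (w q, w (Suc q)) \<in> R) \<and> w (2 * k - 1) = w 0 \<and> inj_on w {..<2 * k - 1}"
proof -
  obtain h where h: "\<And>t. t < L \<Longrightarrow> before (h t) (x t) (x (Suc t))" using inc by metis
  have L0: "L > 0" using L k by simp
  define M where "M = Max (h ` {..<L})"
  have "M \<in> h ` {..<L}" unfolding M_def using L0 by (intro Max_in) auto
  then obtain t0 where t0: "t0 < L" "h t0 = M" by auto
  have hM: "h t \<le> M" if "t < L" for t unfolding M_def using that by (intro Max_ge) auto
  have M1: "M \<ge> 1" using h[OF t0(1)] t0(2) by (simp add: before_def)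
  have Mi: "M \<le> i" using before_height_le[OF lev lev h[OF t0(1)]] t0 by simp
  define m where "m = 2 * k - 1"
  define j where "j = m - 2 * M"
  have mj: "m = j + 2 * M" "1 \<le> j" "j \<le> L" using Mi i k M1 L by (auto simp: m_def j_def)
  \<comment> \<open>The segment starts at the step \<open>t0\<close> of maximal height, or is pushed back to end with the path.\<close>
  define s where "s = (if t0 + j \<le> L then t0 else L - j)"
  define e where "e = s + j"
  have se: "s \<le> t0" "t0 < e" "e \<le> L" "s < e" using t0(1) mj by (auto simp: s_def e_def)
  have b: "before M (x s) (x e)"
    by (rule before_path[where h = h and ?t0.0 = t0]) (use h hM se t0 in auto)
  have xdist: "x p \<noteq> x q" if "p < q" "q \<le> L" for p q
  proof -
    have "\<exists>g. before g (x p) (x q)" using that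
    proof (induction q)
      case (Suc q)
      then show ?case using before_trans h[of q] by (cases "p = q") (auto, meson Suc_leD less_SucE Suc_le_lessD)
    qed simp
    then show ?thesis using before_neq by blast
  qed
  \<comment> \<open>The cycle runs along the segment, from \<open>x e\<close> up to the common ancestor, and down to \<open>x s\<close>.\<close>
  define w where "w q = (if q \<le> j then x (s + q) else if q \<le> j + M then anc (q - j) (x e) else anc (m - q) (x s))" for q
  have ls: "level i (x s)" and le: "level i (x e)" using lev se by auto
  have symR: "(a, c) \<in> R \<Longrightarrow> (c, a) \<in> R" for a c using sym by (meson symE)
  have anc0: "anc 0 y = y" for y by (simp add: anc_def)
  have w2: "w q = anc (q - j) (x e)" if "j \<le> q" "q \<le> j + M" for q
    using that by (auto simp: w_def anc0 e_def)
  have w3: "w q = anc (m - q) (x s)" if "j + M \<le> q" "q \<le> m" for q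
  proof (cases "q = j + M")
    case True
    then show ?thesis using w2[of q] b mj by (simp add: before_def)
  next
    case False
    then show ?thesis using that M1 by (simp add: w_def)
  qed
  have "(w q, w (Suc q)) \<in> R" if q: "q < m" for q
  proof -
    consider "q < j" | "j \<le> q" "q < j + M" | "j + M \<le> q" by linarith
    then show ?thesis
    proof cases
      case 1
      then show ?thesis using path[of "s + q"] se by (simp add: w_def e_def)
    next
      case 2
      then show ?thesis using w2[of q] w2[of "Suc q"] anc_edge[OF le, of "q - j"] Mi
        by (auto simp: Suc_diff_le intro: symR)
    next
      case 3
      then show ?thesis using w3[of q] w3[of "Suc q"] q anc_edge[OF ls, of "m - Suc q"] Mi mj
        by (auto simp: Suc_diff_Suc)
    qed
  qed
  moreover have "w m = w 0" using w3[of m] mj by (simp add: w_def anc0)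
  moreover have "inj_on w {..<m}"
  proof -
    have lev1: "level i (w q)" if "q \<le> j" for q using that lev[of "s + q"] se by (simp add: w_def e_def)
    have lev2: "level (i - (q - j)) (w q)" if "j \<le> q" "q \<le> j + M" for q
      using w2[OF that] anc_level[OF le, of "q - j"] Mi that by simp
    have lev3: "level (i - (m - q)) (w q)" if "j + M \<le> q" "q \<le> m" for q
      using w3[OF that] anc_level[OF ls, of "m - q"] Mi that mj by simp
    have "w p \<noteq> w q" if pq: "p < q" "q < m" for p q
    proof
      assume eq: "w p = w q"
      then have lev_eq: "level a (w p) \<Longrightarrow> level b (w q) \<Longrightarrow> a = b" for a b
        using level_unique by simp
      consider "q \<le> j" | "p \<le> j" "j < q" "q \<le> j + M" | "p \<le> j" "j + M \<le> q"
        | "j \<le> p" "q \<le> j + M" | "j \<le> p" "p \<le> j + M" "j + M < q" | "j + M < p" by linarith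
      then show False
      proof cases
        case 1
        then show False using eq pq xdist[of "s + p" "s + q"] se by (simp add: w_def e_def)
      next
        case 2
        then have "i = i - (q - j)" by (intro lev_eq lev1 lev2) simp_all
        then show False using 2 Mi M1 by linarith
      next
        case 3
        then have "i = i - (m - q)" using pq by (intro lev_eq lev1 lev3) simp_all
        then show False using 3 Mi M1 mj pq by linarith
      next
        case 4
        then have "i - (p - j) = i - (q - j)" using pq by (intro lev_eq lev2) simp_all
        then show False using 4 Mi pq by linarith
      next
        case 5
        then have "i - (p - j) = i - (m - q)" using pq by (intro lev_eq lev2 lev3) simp_all
        then have pj: "p - j = m - q" using 5 Mi pq mj by linarith
        then have "anc (m - q) (x e) = anc (m - q) (x s)" using w2[of p] w3[of q] eq 5 pq by simp
        then have "anc (M - 1) (x e) = anc (M - 1) (x s)" by (rule anc_eq_mono) (use 5 mj in simp)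
        then show False using b by (simp add: before_def)
      next
        case 6
        then have "i - (m - p) = i - (m - q)" using pq by (intro lev_eq lev3) simp_all
        then show False using 6 Mi pq mj by linarith
      qed
    qed
    then show ?thesis by (intro inj_onI) (metis lessThan_iff linorder_neqE_nat)
  qed
  ultimately show ?thesis unfolding m_def by blast
qed

primrec chain :: "nat \<Rightarrow> nat \<Rightarrow> nat \<Rightarrow> bool" where
  "chain i 0 x = level i x"
| "chain i (Suc L) x = (level i x \<and> (\<exists>y h. chain i L y \<and> (y, x) \<in> R \<and> before h y x))"

lemma chain_path:
  "chain i L x \<Longrightarrow> \<exists>f. f L = x \<and> (\<forall>t\<le>L. level i (f t)) \<and>
     (\<forall>t<L. (f t, f (Suc t)) \<in> R \<and> (\<exists>h. before h (f t) (f (Suc t))))"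
proof (induction L arbitrary: x)
  case 0
  then show ?case by (intro exI[of _ "\<lambda>_. x"]) simp
next
  case (Suc L)
  then obtain y h where y: "chain i L y" "(y, x) \<in> R" "before h y x" "level i x" by auto
  obtain f where f: "f L = y" "\<forall>t\<le>L. level i (f t)"
    "\<forall>t<L. (f t, f (Suc t)) \<in> R \<and> (\<exists>h. before h (f t) (f (Suc t)))" using Suc.IH[OF y(1)] by blast
  show ?case
    by (intro exI[of _ "f(Suc L := x)"]) (use f y in \<open>auto simp: less_Suc_eq le_Suc_eq\<close>)
qed

lemma chain_shorten: "chain i L x \<Longrightarrow> l \<le> L \<Longrightarrow> \<exists>y. chain i l y"
  by (induction L arbitrary: x) (auto simp: le_Suc_eq, metis chain.simps(2))

text \<open>
  Within a level, colour each vertex by the length of the longest increasing path ending there; adjacent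
  vertices get different colours, and \<open>increasing_path_gives_cycle\<close> bounds the number of colours by
  \<open>2 k - 3\<close>. Edges join only equal or consecutive levels, so two disjoint palettes for the levels of
  even and of odd depth suffice.
\<close>

lemma ball_colouring:
  assumes no: "\<not> (\<exists>w. (\<forall>q<2 * k - 1. (w q, w (Suc q)) \<in> R) \<and> w (2 * k - 1) = w 0 \<and> inj_on w {..<2 * k - 1})"
    and k: "k \<ge> 2" and S: "\<And>x. x \<in> S \<Longrightarrow> \<exists>l\<le>k - 1. (z, x) \<in> R ^^ l"
  shows "\<exists>c :: nat \<Rightarrow> nat. (\<forall>x\<in>S. c x < 2 * (2 * k - 3)) \<and> (\<forall>x\<in>S. \<forall>y\<in>S. (x, y) \<in> R \<longrightarrow> c x \<noteq> c y)"
proof -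
  have short: "L < 2 * k - 3" if i: "i \<le> k - 1" "chain i L x" for i L x
  proof (rule ccontr)
    assume "\<not> L < 2 * k - 3"
    then obtain y where "chain i (2 * k - 3) y" using chain_shorten[OF i(2)] by fastforce
    from chain_path[OF this] obtain f where f: "\<forall>t\<le>2 * k - 3. level i (f t)"
      "\<forall>t<2 * k - 3. (f t, f (Suc t)) \<in> R \<and> (\<exists>h. before h (f t) (f (Suc t)))" by blast
    then show False using no increasing_path_gives_cycle[of "2 * k - 3" i f k] i(1) k by blast
  qed
  define rank where "rank x = Max {L. chain (depth x) L x}" for x
  have lev: "level (depth x) x" "depth x \<le> k - 1" if "x \<in> S" for x
    using S[OF that] depth_le by (auto simp: level_def) (meson depth_le le_trans level_def)+
  have fin: "finite {L. chain (depth x) L x}" if "x \<in> S" for x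
    by (rule finite_subset[of _ "{..<2 * k - 3}"]) (use short lev[OF that] in auto)
  have rank: "chain (depth x) (rank x) x" if "x \<in> S" for x
  proof -
    have "0 \<in> {L. chain (depth x) L x}" using lev[OF that] by simp
    then have "rank x \<in> {L. chain (depth x) L x}" unfolding rank_def using Max_in[OF fin[OF that]] by blast
    then show ?thesis by simp
  qed
  have rank_less: "rank x < rank y" if "x \<in> S" "y \<in> S" "(x, y) \<in> R" "depth x = depth y" "before h x y" for x y h
  proof -
    have "chain (depth y) (Suc (rank x)) y" using rank[OF that(1)] that lev[OF that(2)] by auto
    then have "Suc (rank x) \<le> rank y" unfolding rank_def[of y] using fin[OF that(2)] by (intro Max_ge) auto
    then show ?thesis by simp
  qed
  have rank_bound: "rank x < 2 * k - 3" if "x \<in> S" for x using short rank[OF that] lev[OF that] by blast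
  have symR: "(a, c) \<in> R \<Longrightarrow> (c, a) \<in> R" for a c using sym by (meson symE)
  define c where "c x = rank x + (if even (depth x) then 0 else 2 * k - 3)" for x
  have "c x \<noteq> c y" if xy: "x \<in> S" "y \<in> S" "(x, y) \<in> R" for x y
  proof (cases "even (depth x) = even (depth y)")
    case True
    have "depth y \<le> Suc (depth x)" "depth x \<le> Suc (depth y)"
      using level_edge[OF lev(1)[OF xy(1)] xy(3)] level_edge[OF lev(1)[OF xy(2)] symR[OF xy(3)]]
      by (auto simp: level_def)
    then have d: "depth x = depth y" using True by presburger
    have "x \<noteq> y" using loopless xy(3) by blast
    then obtain h where "before h x y \<or> before h y x"
      using before_total[OF lev(1)[OF xy(1)], of y] lev(1)[OF xy(2)] d by auto
    then have "rank x \<noteq> rank y" using rank_less[OF xy(1,2,3) d] rank_less[OF xy(2,1) symR[OF xy(3)] d[symmetric]] by force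
    then show ?thesis using d by (simp add: c_def)
  next
    case False
    then show ?thesis using rank_bound[OF xy(1)] rank_bound[OF xy(2)] by (auto simp: c_def)
  qed
  moreover have "c x < 2 * (2 * k - 3)" if "x \<in> S" for x using rank_bound[OF that] by (auto simp: c_def)
  ultimately show ?thesis by blast
qed

end

section \<open>The lower bound for a single odd cycle\<close>

text \<open>
  Each vertex \<open>u\<close> receives a pendant path \<open>u, n + u, 2 n + u\<close>, whose two new vertices form \<open>J\<close>. Folding the
  path back onto an edge of the graph at \<open>u\<close> identifies the neighbours of each new vertex, so short closed
  walks avoid \<open>J\<close>.
\<close>

lemma pendant_lower_bound:
  fixes R :: "(nat \<times> nat) set"
  assumes n: "n > 0" and R: "R \<subseteq> {..<n} \<times> {..<n}" "sym R" and m: "odd m" "m \<ge> 3"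
    and noR: "no_odd_closed_walk R (m - 1)" and nb: "\<And>v. v < n \<Longrightarrow> \<exists>u. (v, u) \<in> R"
    and nohom: "\<And>H f. pair_graph H \<Longrightarrow> family_free \<F>2 H \<Longrightarrow>
       (\<And>u v. (u, v) \<in> R \<Longrightarrow> (f u, f v) \<in> parcs H) \<Longrightarrow> False"
  shows "ereal (1 / real (2 * n)) \<le> delta_hom (odd_cycles m) \<F>2"
proof -
  define T J where "T = {..<n}" and "J = {n..<3 * n}"
  define A0 where "A0 = {(u, n + u) | u. u < n} \<union> {(n + u, 2 * n + u) | u. u < n}"
  define A where "A = R \<union> A0 \<union> A0\<inverse>"
  obtain g where g: "\<And>v. v < n \<Longrightarrow> (v, g v) \<in> R" using nb by metis
  have symR: "(a, b) \<in> R \<Longrightarrow> (b, a) \<in> R" for a b using R(2) by (meson symE)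
  define \<pi> where "\<pi> v = (if v < n then v else if v < 2 * n then g (v - n) else v - 2 * n)" for v
  have AV: "A \<subseteq> (T \<union> J) \<times> (T \<union> J)" using R(1) by (auto simp: A_def A0_def T_def J_def)
  have symA: "sym A" using R(2) by (auto simp: A_def sym_def)
  have hom0: "(\<pi> u, \<pi> v) \<in> R" if "(u, v) \<in> A0" for u v
    using that g symR[OF g] by (auto simp: A0_def \<pi>_def)
  have homR: "(\<pi> u, \<pi> v) \<in> R" if "(u, v) \<in> R" for u v
    using that R(1) by (auto simp: \<pi>_def)
  have hom: "(\<pi> u, \<pi> v) \<in> R" if "(u, v) \<in> A" for u v
  proof -
    consider "(u, v) \<in> R" | "(u, v) \<in> A0" | "(v, u) \<in> A0" using \<open>(u, v) \<in> A\<close> by (auto simp: A_def)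
    then show ?thesis using homR hom0 symR by cases blast+
  qed
  have fold: "\<pi> a = \<pi> b" if v: "v \<in> J" and "(v, a) \<in> A" "(v, b) \<in> A" for v a b
  proof -
    have "\<pi> x = (if v < 2 * n then v - n else g (v - 2 * n))" if "(v, x) \<in> A" for x
      using that v R(1) by (auto simp: A_def A0_def J_def \<pi>_def)
    then show ?thesis using that by simp
  qed
  have "ereal (1 / real (card J)) \<le> delta_hom (odd_cycles m) \<F>2"
  proof (rule lift_lower_bound[where T = T and A = A])
    note * = closed_walks_avoid_folded[where \<pi> = \<pi> and F = J, OF hom noR m AV symA fold]
    show "no_odd_closed_walk A (m - 1)" by (rule *(1)) auto
    show "w i \<in> T" if "\<And>i. i < m \<Longrightarrow> (w i, w (Suc i)) \<in> A" "w m = w 0" "i < m" for w i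
      using *(2) that by simp
  next
    fix v assume v: "v \<in> T \<union> J"
    have "v < 3 * n" using v n by (auto simp: T_def J_def)
    then consider "v < n" | "n \<le> v" "v < 2 * n" | "2 * n \<le> v" "v < 3 * n" by linarith
    then show "\<exists>j\<in>J. (v, j) \<in> A"
    proof cases
      case 1
      then show ?thesis by (intro bexI[of _ "n + v"]) (auto simp: A_def A0_def J_def)
    next
      case 2
      then have "v - n < n" by linarith
      then have "(n + (v - n), 2 * n + (v - n)) \<in> A0" unfolding A0_def by blast
      then show ?thesis using 2 by (intro bexI[of _ "2 * n + (v - n)"]) (auto simp: A_def J_def)
    next
      case 3
      then have "v - 2 * n < n" by linarith
      then have "(n + (v - 2 * n), 2 * n + (v - 2 * n)) \<in> A0" unfolding A0_def by blast
      then show ?thesis using 3 by (intro bexI[of _ "n + (v - 2 * n)"]) (auto simp: A_def J_def)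
    qed
  next
    fix H f assume H: "pair_graph H" "family_free \<F>2 H"
      and f: "\<And>u v. (u, v) \<in> A \<Longrightarrow> u \<in> T \<Longrightarrow> v \<in> T \<Longrightarrow> (f u, f v) \<in> parcs H"
    show False by (rule nohom[OF H, of f], rule f) (use R(1) in \<open>auto simp: A_def T_def\<close>)
  qed (use n m AV symA in \<open>auto simp: T_def J_def\<close>)
  then show ?thesis by (simp add: J_def)
qed

text \<open>
  The order of the iterated generalised Mycielski graph over \<open>K\<^sub>2\<close> is the bracket in the bound. If a
  homomorphic image \<open>H\<close> were free of \<open>C\<^sub>m\<close>, then by \<open>ball_colouring\<close>, applied around the image of
  the apex, it could be coloured with \<open>4 k - 6\<close> colours, and so could the graph itself.
\<close>

lemma single_cycle_lower_bound:
  assumes k: "k \<ge> 3" and m: "m = 2 * k - 1"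
  shows "ereal (1 / (2 * ((real k - 1) ^ (4 * k - 5) * (2 * real k - 1)
               + ((real k - 1) ^ (4 * k - 5) - 1) / (real k - 2))))
           \<le> delta_hom (odd_cycles m) {cycle_graph m}"
proof -
  define r where "r = k - 1"
  have r: "r \<ge> 2" using k by (simp add: r_def)
  have mr: "m - 1 = 2 * r" using k by (simp add: m r_def)
  define i where "i = 4 * k - 5"
  define n where "n = myc_order r (Suc i)"
  define R where "R = iter_myc r (Suc i)"
  have "ereal (1 / real (2 * n)) \<le> delta_hom (odd_cycles m) {cycle_graph m}"
  proof (rule pendant_lower_bound)
    show "n > 0" unfolding n_def by (rule myc_order_pos)
    show "R \<subseteq> {..<n} \<times> {..<n}" unfolding R_def n_def by (rule iter_myc_range)
    show "sym R" unfolding R_def by (rule sym_iter_myc)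
    show "odd m" "m \<ge> 3" using k m by auto
    show "no_odd_closed_walk R (m - 1)" unfolding mr R_def by (rule iter_myc_no_odd_closed_walk)
    show "\<exists>u. (v, u) \<in> R" if "v < n" for v
      using iter_myc_neighbour[of r v "Suc i"] that r unfolding R_def n_def by auto
  next
    fix H f assume H: "pair_graph H" "family_free {cycle_graph m} H"
      and f: "\<And>u v. (u, v) \<in> R \<Longrightarrow> (f u, f v) \<in> parcs H"
    interpret H: pair_graph H by fact
    define a where "a = r * myc_order r i"
    have noloop: "(x, x) \<notin> parcs H" for x using H.pair_no_loops[of "(x, x)"] by auto
    interpret rg: rooted_graph "parcs H" "f a"
      by standard (rule sym_parcs[OF H(1)], rule noloop)
    define S where "S = f ` {..<n}"
    have "\<exists>c :: nat \<Rightarrow> nat. (\<forall>x\<in>S. c x < 2 * (2 * k - 3)) \<and>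
        (\<forall>x\<in>S. \<forall>y\<in>S. (x, y) \<in> parcs H \<longrightarrow> c x \<noteq> c y)"
    proof (rule rg.ball_colouring)
      have "m \<ge> 3" using k m by simp
      from family_free_cycle_iff[OF H(1) this] H(2)
      show "\<not> (\<exists>w. (\<forall>q<2 * k - 1. (w q, w (Suc q)) \<in> parcs H) \<and> w (2 * k - 1) = w 0 \<and> inj_on w {..<2 * k - 1})"
        unfolding m by blast
      show "k \<ge> 2" using k by simp
      fix x assume "x \<in> S"
      then obtain v where v: "v < n" "x = f v" by (auto simp: S_def)
      obtain l where l: "l \<le> r" "(a, v) \<in> R ^^ l"
        using iter_myc_radius[of r v i] v(1) r unfolding a_def R_def n_def by auto
      have "(f a, f v) \<in> parcs H ^^ l" by (rule relpow_hom[where f = f, OF f l(2)])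
      then show "\<exists>l\<le>k - 1. (f a, x) \<in> parcs H ^^ l" using l(1) v(2) unfolding r_def by blast
    qed
    then obtain c :: "nat \<Rightarrow> nat" where c: "\<forall>x\<in>S. c x < 2 * (2 * k - 3)"
      "\<forall>x\<in>S. \<forall>y\<in>S. (x, y) \<in> parcs H \<longrightarrow> c x \<noteq> c y" by blast
    have "has_sphere {..<n} R (Suc (Suc i))"
      unfolding n_def R_def by (rule iter_myc_has_sphere) (use r in simp)
    then have "Suc (Suc i) < 2 * (2 * k - 3)"
    proof (rule has_sphere_colours)
      show "c (f v) < 2 * (2 * k - 3)" if "v \<in> {..<n}" for v using that c(1) by (auto simp: S_def)
      fix u v assume uv: "(u, v) \<in> R"
      then have "u < n" "v < n" using iter_myc_range[of r "Suc i"] by (auto simp: R_def n_def)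
      then show "c (f u) \<noteq> c (f v)" using c(2) f[OF uv] by (auto simp: S_def)
    qed
    then show False using k by (simp add: i_def)
  qed
  moreover have "real n = (real k - 1) ^ (4 * k - 5) * (2 * real k - 1)
               + ((real k - 1) ^ (4 * k - 5) - 1) / (real k - 2)"
    unfolding n_def myc_order_closed_form[OF r] using k by (simp add: r_def i_def of_nat_diff)
  ultimately show ?thesis by simp
qed

section \<open>The four estimates\<close>

theorem corollary1p3:
  fixes k m :: nat
  assumes "k \<ge> 3" and "m = 2 * k - 1"
  shows "ereal (1 / (2 * ((real k - 1) ^ (4 * k - 5) * (2 * real k - 1)
               + ((real k - 1) ^ (4 * k - 5) - 1) / (real k - 2))))
           \<le> delta_hom (odd_cycles m) {cycle_graph m}
       \<and> delta_hom (odd_cycles m) {cycle_graph m}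
           \<le> ereal (2 * (real m - 1) / (2 * real m * (real m - 1) + 1))
       \<and> ereal (2 * (real m - 1) / (2 * real m * (real m - 1) + 1)) < ereal (1 / real m)
       \<and> ereal (1 / real m) = delta_hom (odd_cycles m) (odd_cycles m)"
proof -
  have m: "odd m" "m \<ge> 5" using assms by auto
  have "2 * (real m - 1) / (2 * real m * (real m - 1) + 1) < 1 / real m"
  proof (rule mult_imp_div_pos_less)
    show "0 < 2 * real m * (real m - 1) + 1" using m by (intro add_nonneg_pos) auto
    have "1 / real m * (2 * real m * (real m - 1) + 1) = 2 * (real m - 1) + 1 / real m"
      using m by (simp add: field_simps)
    then show "2 * (real m - 1) < 1 / real m * (2 * real m * (real m - 1) + 1)" using m by simp
  qed
  then have less: "ereal (2 * (real m - 1) / (2 * real m * (real m - 1) + 1)) < ereal (1 / real m)"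
    by (simp only: ereal_less_eq(1) less_ereal.simps(1))
  have eq: "ereal (1 / real m) = delta_hom (odd_cycles m) (odd_cycles m)"
    by (rule antisym[OF odd_cycles_lower_bound[OF m] odd_cycles_upper_bound[OF m]])
  show ?thesis
    by (intro conjI single_cycle_lower_bound[OF assms] single_cycle_upper_bound[OF m] less eq)
qed

end
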